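(* Let $\alpha>0$, let $w\in A^{\mathrm{restricted}}_{\infty}$, and let $\mu$ be a positive Borel measure on $\mathbb{C}$ such that $T_{\mu}$ is bounded on $F^2_{\alpha,w}$. Then there exists $\delta\in(0,1)$ such that for $r\in(0,\delta)$, $$\|T_{\mu}\|_{e,F^2_{\alpha,w}\to F^2_{\alpha,w}}\asymp\limsup_{|z|\to\infty}\widetilde{\mu}(z)\asymp\limsup_{|z|\to\infty}\widehat{\mu}_{w,r}(z),$$ where the implicit constants are independent of $\mu$.
   Context: A weight is a non-negative locally integrable function $w$ on $\mathbb{C}$; $dA$ (and $A(\cdot)$) is Lebesgue measure on $\mathbb{C}$; $w(E):=\int_E w\,dA$; $D(z,r)$ is the disk with center $z$ and radius $r$. Squares $Q\subset\mathbb{C}$ have sides parallel to the axes, with side length $\ell(Q)$. For $1<p<\infty$ with $1/p+1/p'=1$, $w\in A_p^{\mathrm{restricted}}$ if for some (equivalently any) fixed $r>0$, $\sup_{\ell(Q)=r}\big(\frac1{A(Q)}\int_Q w\,dA\big)\big(\frac1{A(Q)}\int_Q w^{-p'/p}dA\big)^{p/p'}<\infty$; $w\in A_1^{\mathrm{restricted}}$ if for some (equivalently any) fixed $r>0$, $\sup_{\ell(Q)=r}\big(\frac1{A(Q)}\int_Q w\,dA\big)\|w^{-1}\|_{L^\infty(Q)}<\infty$ (in particular both factors are finite, so $w>0$ a.e.). Set $A_\infty^{\mathrm{restricted}}:=\bigcup_{1\le p<\infty}A_p^{\mathrm{restricted}}$. $F^2_{\alpha,w}$ is the Hilbert space of entire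 functions $f$ with $\|f\|^2_{F^2_{\alpha,w}}=\int_{\mathbb{C}}|f(z)|^2e^{-\alpha|z|^2}w(z)\,dA(z)<\infty$, with inner product $\langle f,g\rangle_{F^2_{\alpha,w}}=\int_{\mathbb{C}}f\overline{g}\,e^{-\alpha|z|^2}w\,dA$. $B^w_z$ is its reproducing kernel at $z$ (so $f(z)=\langle f,B^w_z\rangle_{F^2_{\alpha,w}}$), and $b^w_z:=B^w_z/\|B^w_z\|_{F^2_{\alpha,w}}$. For a positive Borel measure $\mu$: the Toeplitz operator is $T_\mu f(z):=\int_{\mathbb{C}}f(\xi)\overline{B^w_z(\xi)}e^{-\alpha|\xi|^2}d\mu(\xi)$, $z\in\mathbb{C}$. "$T_\mu$ is bounded on $F^2_{\alpha,w}$" means that for every $f\in F^2_{\alpha,w}$ the integral converges absolutely for every $z$, and $T_\mu$ maps $F^2_{\alpha,w}$ boundedly into itself. The average function is $\widehat{\mu}_{w,r}(z):=\mu(D(z,r))/w(D(z,r))$; the Berezin transform is $\widetilde{\mu}(z):=\int_{\mathbb{C}}|b^w_z(\xi)|^2e^{-\alpha|\xi|^2}d\mu(\xi)$. For a bounded operator $T$ on a Hilbert space $H$, the essential norm is $\|T\|_{e,H\to H}:=\inf\{\|T-K\|_{H\to H}: K \text{ compact on } H\}$. $X\asymp Y$ means $c\,Y\le X\le C\,Y$ for constants $c,C>0$ (which may depend on $\alpha,w,r$). *)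

theory Defs
  imports "HOL-Complex_Analysis.Complex_Analysis" "HOL-Probability.Essential_Supremum"
begin

section \<open>Restricted Muckenhoupt weights\<close>

definition weight :: "(complex \<Rightarrow> real) \<Rightarrow> bool" where
  "weight w \<longleftrightarrow> (\<forall>z. 0 \<le> w z) \<and> (\<forall>K. compact K \<longrightarrow> w absolutely_integrable_on K)"

text \<open>The closed square with sides parallel to the axes, lower left corner \<open>a\<close> and side length \<open>l\<close>.\<close>

definition square :: "complex \<Rightarrow> real \<Rightarrow> complex set" where
  "square a l = {z. Re a \<le> Re z \<and> Re z \<le> Re a + l \<and> Im a \<le> Im z \<and> Im z \<le> Im a + l}"

definition average :: "(complex \<Rightarrow> real) \<Rightarrow> complex set \<Rightarrow> real" where
  "average f Q = (LINT z:Q|lebesgue. f z) / measure lebesgue Q"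

text \<open>
  For \<open>p > 1\<close>, put \<open>p' = p / (p - 1)\<close>. A negative power of \<open>0\<close> has to be read as \<open>\<infinity>\<close>, whereas
  \<^term>\<open>(0::real) powr a = 0\<close>, and the Bochner integral of a non-integrable function is \<open>0\<close>.
  So the finiteness of the factor with \<open>w\<close> to the power \<open>-p'/p\<close> is made explicit: it says that
  \<open>w > 0\<close> almost everywhere on \<open>Q\<close> and that the real-valued power is integrable on \<open>Q\<close>.
\<close>

definition Ap_restricted :: "real \<Rightarrow> (complex \<Rightarrow> real) \<Rightarrow> bool" where
  "Ap_restricted p w \<longleftrightarrow> weight w \<and>
     (let p' = p / (p - 1) in
      \<exists>r>0. (\<forall>a. (AE z in lebesgue_on (square a r). 0 < w z)
               \<and> (\<lambda>z. w z powr (- p' / p)) absolutely_integrable_on square a r)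
          \<and> bdd_above (range (\<lambda>a. average w (square a r) *
                average (\<lambda>z. w z powr (- p' / p)) (square a r) powr (p / p'))))"

text \<open>
  In \<^typ>\<open>ennreal\<close> the inverse of \<open>0\<close> is \<open>\<infinity>\<close>, as wanted here; but \<open>0 * \<infinity> = 0\<close>, so the finiteness
  of the second factor is a separate condition.
\<close>

definition A1_restricted :: "(complex \<Rightarrow> real) \<Rightarrow> bool" where
  "A1_restricted w \<longleftrightarrow> weight w \<and>
     (\<exists>r>0. (\<forall>a. esssup (lebesgue_on (square a r)) (\<lambda>z. inverse (ennreal (w z))) < \<infinity>)
          \<and> (SUP a. ennreal (average w (square a r)) *
               esssup (lebesgue_on (square a r)) (\<lambda>z. inverse (ennreal (w z)))) < \<infinity>)"

definition Ainf_restricted :: "(complex \<Rightarrow> real) \<Rightarrow> bool" where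
  "Ainf_restricted w \<longleftrightarrow> A1_restricted w \<or> (\<exists>p>1. Ap_restricted p w)"


section \<open>Weighted Fock spaces\<close>

definition fock_space :: "real \<Rightarrow> (complex \<Rightarrow> real) \<Rightarrow> (complex \<Rightarrow> complex) set" where
  "fock_space \<alpha> w = {f. f holomorphic_on UNIV \<and>
     integrable lebesgue (\<lambda>z. (cmod (f z))\<^sup>2 * exp (- \<alpha> * (cmod z)\<^sup>2) * w z)}"

definition fock_inner ::
    "real \<Rightarrow> (complex \<Rightarrow> real) \<Rightarrow> (complex \<Rightarrow> complex) \<Rightarrow> (complex \<Rightarrow> complex) \<Rightarrow> complex" where
  "fock_inner \<alpha> w f g =
     (LINT z|lebesgue. f z * cnj (g z) * of_real (exp (- \<alpha> * (cmod z)\<^sup>2) * w z))"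

definition fock_norm :: "real \<Rightarrow> (complex \<Rightarrow> real) \<Rightarrow> (complex \<Rightarrow> complex) \<Rightarrow> real" where
  "fock_norm \<alpha> w f =
     sqrt (LINT z|lebesgue. (cmod (f z))\<^sup>2 * exp (- \<alpha> * (cmod z)\<^sup>2) * w z)"

definition rep_kernel :: "real \<Rightarrow> (complex \<Rightarrow> real) \<Rightarrow> complex \<Rightarrow> complex \<Rightarrow> complex" where
  "rep_kernel \<alpha> w z =
     (THE g. g \<in> fock_space \<alpha> w \<and> (\<forall>f\<in>fock_space \<alpha> w. f z = fock_inner \<alpha> w f g))"

definition normalized_kernel :: "real \<Rightarrow> (complex \<Rightarrow> real) \<Rightarrow> complex \<Rightarrow> complex \<Rightarrow> complex" where
  "normalized_kernel \<alpha> w z \<xi> = rep_kernel \<alpha> w z \<xi> / of_real (fock_norm \<alpha> w (rep_kernel \<alpha> w z))"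


section \<open>Operators on the Fock space\<close>

text \<open>
  Operators are maps on functions of which only the values on the Fock space matter.
\<close>

definition fock_operator ::
    "real \<Rightarrow> (complex \<Rightarrow> real) \<Rightarrow> ((complex \<Rightarrow> complex) \<Rightarrow> complex \<Rightarrow> complex) \<Rightarrow> bool" where
  "fock_operator \<alpha> w T \<longleftrightarrow>
     (\<forall>f\<in>fock_space \<alpha> w. T f \<in> fock_space \<alpha> w) \<and>
     (\<forall>f\<in>fock_space \<alpha> w. \<forall>g\<in>fock_space \<alpha> w. \<forall>a b.
        T (\<lambda>z. a * f z + b * g z) = (\<lambda>z. a * T f z + b * T g z))"

definition fock_compact ::
    "real \<Rightarrow> (complex \<Rightarrow> real) \<Rightarrow> ((complex \<Rightarrow> complex) \<Rightarrow> complex \<Rightarrow> complex) \<Rightarrow> bool" where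
  "fock_compact \<alpha> w K \<longleftrightarrow> fock_operator \<alpha> w K \<and>
     (\<forall>s. (\<forall>n::nat. s n \<in> fock_space \<alpha> w) \<and> bdd_above (range (\<lambda>n. fock_norm \<alpha> w (s n))) \<longrightarrow>
        (\<exists>\<sigma>. strict_mono \<sigma> \<and> (\<exists>g\<in>fock_space \<alpha> w.
           (\<lambda>n. fock_norm \<alpha> w (\<lambda>z. K (s (\<sigma> n)) z - g z)) \<longlonglongrightarrow> 0)))"

definition fock_opnorm ::
    "real \<Rightarrow> (complex \<Rightarrow> real) \<Rightarrow> ((complex \<Rightarrow> complex) \<Rightarrow> complex \<Rightarrow> complex) \<Rightarrow> ennreal" where
  "fock_opnorm \<alpha> w T =
     (SUP f\<in>{f \<in> fock_space \<alpha> w. fock_norm \<alpha> w f \<le> 1}. ennreal (fock_norm \<alpha> w (T f)))"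

definition fock_essnorm ::
    "real \<Rightarrow> (complex \<Rightarrow> real) \<Rightarrow> ((complex \<Rightarrow> complex) \<Rightarrow> complex \<Rightarrow> complex) \<Rightarrow> ennreal" where
  "fock_essnorm \<alpha> w T = (INF K\<in>{K. fock_compact \<alpha> w K}. fock_opnorm \<alpha> w (\<lambda>f z. T f z - K f z))"


section \<open>Toeplitz operators, averages and the Berezin transform\<close>

definition toeplitz_integrand ::
    "real \<Rightarrow> (complex \<Rightarrow> real) \<Rightarrow> (complex \<Rightarrow> complex) \<Rightarrow> complex \<Rightarrow> complex \<Rightarrow> complex" where
  "toeplitz_integrand \<alpha> w f z \<xi> =
     f \<xi> * cnj (rep_kernel \<alpha> w z \<xi>) * of_real (exp (- \<alpha> * (cmod \<xi>)\<^sup>2))"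

definition toeplitz ::
    "real \<Rightarrow> (complex \<Rightarrow> real) \<Rightarrow> complex measure \<Rightarrow> (complex \<Rightarrow> complex) \<Rightarrow> complex \<Rightarrow> complex" where
  "toeplitz \<alpha> w \<mu> f z = (LINT \<xi>|\<mu>. toeplitz_integrand \<alpha> w f z \<xi>)"

definition toeplitz_bounded :: "real \<Rightarrow> (complex \<Rightarrow> real) \<Rightarrow> complex measure \<Rightarrow> bool" where
  "toeplitz_bounded \<alpha> w \<mu> \<longleftrightarrow>
     (\<forall>f\<in>fock_space \<alpha> w. \<forall>z. integrable \<mu> (toeplitz_integrand \<alpha> w f z)) \<and>
     (\<forall>f\<in>fock_space \<alpha> w. toeplitz \<alpha> w \<mu> f \<in> fock_space \<alpha> w) \<and>
     (\<exists>C. \<forall>f\<in>fock_space \<alpha> w. fock_norm \<alpha> w (toeplitz \<alpha> w \<mu> f) \<le> C * fock_norm \<alpha> w f)"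

definition average_function ::
    "(complex \<Rightarrow> real) \<Rightarrow> complex measure \<Rightarrow> real \<Rightarrow> complex \<Rightarrow> ennreal" where
  "average_function w \<mu> r z =
     emeasure \<mu> (ball z r) / (\<integral>\<^sup>+\<xi>\<in>ball z r. ennreal (w \<xi>) \<partial>lebesgue)"

definition berezin ::
    "real \<Rightarrow> (complex \<Rightarrow> real) \<Rightarrow> complex measure \<Rightarrow> complex \<Rightarrow> ennreal" where
  "berezin \<alpha> w \<mu> z =
     (\<integral>\<^sup>+\<xi>. ennreal ((cmod (normalized_kernel \<alpha> w z \<xi>))\<^sup>2 * exp (- \<alpha> * (cmod \<xi>)\<^sup>2)) \<partial>\<mu>)"

end

theory Submission
  imports Defs
begin

text \<open>
  The Muckenhoupt condition enters only through a doubling property of the measure \<open>w dA\<close> at one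
  fixed scale.  From it one gets the pointwise bound
  \<open>|f(z)|\<^sup>2 e\<^bsup>-\<alpha>|z|\<^sup>2\<^esup> w(D(z,\<rho>)) \<le> C \<integral>\<^bsub>D(z,r)\<^esub> |f|\<^sup>2 e\<^bsup>-\<alpha>|\<xi>|\<^sup>2\<^esup> w dA\<close>, hence the size
  of the reproducing kernel on the diagonal, a lower bound for it near the diagonal, and the Carleson
  embedding of the Fock space into \<open>L\<^sup>2(e\<^bsup>-\<alpha>|\<xi>|\<^sup>2\<^esup> d\<mu>)\<close>.  The essential norm dominates the Berezin
  transform at infinity, because the normalized kernels tend weakly to \<open>0\<close>.  It is dominated by the
  averages at infinity: the part of \<open>\<mu>\<close> in a large disk gives a compact operator, and the
  Carleson constant of the rest is controlled by the averages outside the disk.  The averages are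
  dominated by the Berezin transform, because of the lower bound for the kernel near the diagonal.
\<close>

section \<open>Bergman-type spaces of entire functions\<close>

text \<open>The comparison closes a cycle: Berezin transform \<le> essential norm \<le> constant
  times averages \<le> constant times Berezin transform. Going round it yields every two-sided
  bound, with constants that come from \<open>\<alpha>\<close>, \<open>w\<close> and
  \<open>r\<close> alone. The obstacle is that the weight is controlled on squares of one size only.
  Above that size, chaining loses a fixed factor for each step of length \<open>\<rho> / 2\<close>,
  so the mass of a disk may grow exponentially with its radius; the Gaussian absorbs this. Below it,
  a disk of radius \<open>t\<close> is only known to carry at least a multiple of
  \<open>t ^ (2 * N)\<close> of the mass at size \<open>\<rho>\<close>, with \<open>N\<close>
  possibly large, and the local estimates have to pay for that power. The kernel has no formula. Its
  diagonal is bounded above by applying the evaluation estimate to the kernel itself, and below by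
  testing evaluation at \<open>z\<close> on the exponential
  \<open>exp (\<alpha> * cnj z * \<xi>)\<close>. Near the diagonal it stays large because, once the
  Gaussian is recentred at \<open>z\<close>, it becomes a holomorphic function whose upper bound on
  a disk of radius \<open>\<rho>\<close> is comparable to its value at the centre.\<close>

lemma Cauchy_Schwarz_complex_integral:
  fixes f g :: "'a \<Rightarrow> complex"
  assumes [measurable]: "f \<in> borel_measurable N" "g \<in> borel_measurable N"
    and f: "integrable N (\<lambda>z. (cmod (f z))\<^sup>2)" and g: "integrable N (\<lambda>z. (cmod (g z))\<^sup>2)"
  shows "integrable N (\<lambda>z. f z * cnj (g z))"
    and "(cmod (LINT z|N. f z * cnj (g z)))\<^sup>2
           \<le> (LINT z|N. (cmod (f z))\<^sup>2) * (LINT z|N. (cmod (g z))\<^sup>2)"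
proof -
  show int: "integrable N (\<lambda>z. f z * cnj (g z))"
  proof (rule Bochner_Integration.integrable_bound)
    show "integrable N (\<lambda>z. (cmod (f z))\<^sup>2 + (cmod (g z))\<^sup>2)" using f g by simp
    show "AE x in N. norm (f x * cnj (g x)) \<le> norm ((cmod (f x))\<^sup>2 + (cmod (g x))\<^sup>2)"
    proof (rule AE_I2)
      fix x
      have "2 * (cmod (f x) * cmod (g x)) \<le> (cmod (f x))\<^sup>2 + (cmod (g x))\<^sup>2"
        using sum_squares_bound[of "cmod (f x)" "cmod (g x)"] by simp
      moreover have "0 \<le> cmod (f x) * cmod (g x)" by simp
      ultimately have "cmod (f x) * cmod (g x) \<le> (cmod (f x))\<^sup>2 + (cmod (g x))\<^sup>2" by linarith
      then show "norm (f x * cnj (g x)) \<le> norm ((cmod (f x))\<^sup>2 + (cmod (g x))\<^sup>2)"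
        by (simp add: norm_mult)
    qed
    show "(\<lambda>z. f z * cnj (g z)) \<in> borel_measurable N"
      by (intro borel_measurable_times borel_measurable_continuous_on[of cnj] continuous_intros) simp_all
  qed
  have abs: "integrable N (\<lambda>z. cmod (f z) * cmod (g z))"
    using integrable_norm[OF int] by (simp add: norm_mult)
  let ?I = "LINT z|N. cmod (f z) * cmod (g z)"
  have "(\<integral>\<^sup>+z. ennreal (cmod (f z)) * ennreal (cmod (g z)) \<partial>N)\<^sup>2
      \<le> (\<integral>\<^sup>+z. (ennreal (cmod (f z)))\<^sup>2 \<partial>N) * (\<integral>\<^sup>+z. (ennreal (cmod (g z)))\<^sup>2 \<partial>N)"
    by (rule Cauchy_Schwarz_nn_integral) simp_all
  moreover have "(\<integral>\<^sup>+z. ennreal (cmod (f z)) * ennreal (cmod (g z)) \<partial>N) = ennreal ?I"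
    by (subst nn_integral_eq_integral[OF abs, symmetric]) (simp_all add: ennreal_mult)
  moreover have "(\<integral>\<^sup>+z. (ennreal (cmod (f z)))\<^sup>2 \<partial>N) = ennreal (LINT z|N. (cmod (f z))\<^sup>2)"
    by (subst nn_integral_eq_integral[OF f, symmetric]) (simp_all add: ennreal_power)
  moreover have "(\<integral>\<^sup>+z. (ennreal (cmod (g z)))\<^sup>2 \<partial>N) = ennreal (LINT z|N. (cmod (g z))\<^sup>2)"
    by (subst nn_integral_eq_integral[OF g, symmetric]) (simp_all add: ennreal_power)
  ultimately have "ennreal (?I\<^sup>2) \<le> ennreal ((LINT z|N. (cmod (f z))\<^sup>2) * (LINT z|N. (cmod (g z))\<^sup>2))"
    by (simp add: ennreal_power ennreal_mult)
  then have *: "?I\<^sup>2 \<le> (LINT z|N. (cmod (f z))\<^sup>2) * (LINT z|N. (cmod (g z))\<^sup>2)"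
    by (subst (asm) ennreal_le_iff) simp_all
  have "cmod (LINT z|N. f z * cnj (g z)) \<le> ?I"
    using integral_norm_bound[of N "\<lambda>z. f z * cnj (g z)"] by (simp add: norm_mult)
  then have "(cmod (LINT z|N. f z * cnj (g z)))\<^sup>2 \<le> ?I\<^sup>2" by (intro power_mono) auto
  with * show "(cmod (LINT z|N. f z * cnj (g z)))\<^sup>2
           \<le> (LINT z|N. (cmod (f z))\<^sup>2) * (LINT z|N. (cmod (g z))\<^sup>2)" by linarith
qed

section \<open>Inner product and norm of square-integrable entire functions\<close>

definition holL2 :: "complex measure \<Rightarrow> (complex \<Rightarrow> complex) set" where
  "holL2 P = {f. f holomorphic_on UNIV \<and> integrable P (\<lambda>z. (cmod (f z))\<^sup>2)}"

definition ip :: "complex measure \<Rightarrow> (complex \<Rightarrow> complex) \<Rightarrow> (complex \<Rightarrow> complex) \<Rightarrow> complex" where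
  "ip P f g = (LINT z|P. f z * cnj (g z))"

definition nrm2 :: "complex measure \<Rightarrow> (complex \<Rightarrow> complex) \<Rightarrow> real" where
  "nrm2 P f = (LINT z|P. (cmod (f z))\<^sup>2)"

lemma nrm2_nonneg: "0 \<le> nrm2 P f"
  unfolding nrm2_def by simp

lemma entire_borel_measurable:
  assumes "f holomorphic_on UNIV" "sets P = sets borel"
  shows "f \<in> borel_measurable P"
proof -
  have "f \<in> borel_measurable borel"
    using assms(1) by (intro borel_measurable_continuous_onI holomorphic_on_imp_continuous_on)
  then show ?thesis using assms(2) measurable_cong_sets by blast
qed

lemma entire_borel: "f holomorphic_on UNIV \<Longrightarrow> f \<in> borel_measurable borel"
  by (rule entire_borel_measurable) simp_all

text \<open>The vanishing first variation at a minimum; in \<open>riesz\<close> it turns an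
  inequality valid for all real \<open>t\<close> into an equality of real parts.\<close>

lemma quadratic_nonneg_linear_zero:
  fixes a b :: real
  assumes "\<And>t. 0 \<le> 2 * t * a + t\<^sup>2 * b"
  shows "a = 0"
proof (rule ccontr)
  assume "a \<noteq> 0"
  have "0 \<le> b" using assms[of 1] assms[of "-1"] by simp
  \<comment> \<open>The minimum over \<open>t\<close> is at \<open>- a / b\<close>; the shifted
    denominator also serves \<open>b = 0\<close>.\<close>
  define t where "t = - a / (b + 1)"
  have "2 * t * a + t\<^sup>2 * b = a\<^sup>2 * (b - 2 * (b+1)) / (b+1)\<^sup>2"
    using \<open>0 \<le> b\<close> by (simp add: t_def power2_eq_square divide_simps) (simp add: algebra_simps)
  also have "\<dots> < 0"
    using \<open>0 \<le> b\<close> \<open>a \<noteq> 0\<close> by (intro divide_neg_pos mult_pos_neg) auto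
  finally show False using assms[of t] by linarith
qed

text \<open>The bound on evaluations, uniform on disks, has three uses: evaluations become bounded
  functionals, norm-bounded families become locally bounded as Montel's theorem asks, and functions
  at distance 0 agree at every point.\<close>

locale bergman_space =
  fixes P :: "complex measure"
  assumes sets_P: "sets P = sets borel"
    and eval_bound: "\<And>R. \<exists>C. \<forall>f\<in>holL2 P. \<forall>z\<in>cball 0 R. (cmod (f z))\<^sup>2 \<le> C * nrm2 P f"
begin

lemma measurable_holL2: "f \<in> holL2 P \<Longrightarrow> f \<in> borel_measurable P"
  using entire_borel_measurable sets_P unfolding holL2_def by blast

lemma lincomb_holL2:
  assumes "f \<in> holL2 P" "g \<in> holL2 P"
  shows "(\<lambda>z. a * f z + b * g z) \<in> holL2 P"
proof -
  note [measurable] = assms[THEN measurable_holL2]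
  have "integrable P (\<lambda>z. (cmod (a * f z + b * g z))\<^sup>2)"
  proof (rule Bochner_Integration.integrable_bound)
    show "integrable P (\<lambda>z. 2 * (cmod a)\<^sup>2 * (cmod (f z))\<^sup>2 + 2 * (cmod b)\<^sup>2 * (cmod (g z))\<^sup>2)"
      using assms by (simp add: holL2_def)
    show "AE z in P. norm ((cmod (a * f z + b * g z))\<^sup>2)
        \<le> norm (2 * (cmod a)\<^sup>2 * (cmod (f z))\<^sup>2 + 2 * (cmod b)\<^sup>2 * (cmod (g z))\<^sup>2)"
    proof (rule AE_I2)
      fix z
      have "(cmod (a * f z + b * g z))\<^sup>2 \<le> (cmod (a * f z) + cmod (b * g z))\<^sup>2"
        by (intro power_mono norm_triangle_ineq) auto
      also have "\<dots> \<le> 2 * (cmod (a * f z))\<^sup>2 + 2 * (cmod (b * g z))\<^sup>2"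
        using sum_squares_bound[of "cmod (a * f z)" "cmod (b * g z)"] by (simp add: power2_sum)
      finally show "norm ((cmod (a * f z + b * g z))\<^sup>2)
        \<le> norm (2 * (cmod a)\<^sup>2 * (cmod (f z))\<^sup>2 + 2 * (cmod b)\<^sup>2 * (cmod (g z))\<^sup>2)"
        by (simp add: norm_mult power_mult_distrib)
    qed
  qed simp
  then show ?thesis using assms unfolding holL2_def by (auto intro!: holomorphic_intros)
qed

lemma diff_holL2: "f \<in> holL2 P \<Longrightarrow> g \<in> holL2 P \<Longrightarrow> (\<lambda>z. f z - g z) \<in> holL2 P"
  using lincomb_holL2[of f g 1 "-1"] by simp

lemma scale_holL2: "f \<in> holL2 P \<Longrightarrow> (\<lambda>z. a * f z) \<in> holL2 P"
  using lincomb_holL2[of f f a 0] by simp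

lemma zero_holL2: "(\<lambda>z. 0) \<in> holL2 P"
  by (simp add: holL2_def)

lemma
  assumes "f \<in> holL2 P" "g \<in> holL2 P"
  shows integrable_ip: "integrable P (\<lambda>z. f z * cnj (g z))"
    and cauchy_schwarz: "(cmod (ip P f g))\<^sup>2 \<le> nrm2 P f * nrm2 P g"
  using Cauchy_Schwarz_complex_integral[of f P g] assms measurable_holL2
  unfolding ip_def nrm2_def holL2_def by auto

lemma ip_lincomb_left:
  assumes "f \<in> holL2 P" "g \<in> holL2 P" "h \<in> holL2 P"
  shows "ip P (\<lambda>z. a * f z + b * g z) h = a * ip P f h + b * ip P g h"
proof -
  have "ip P (\<lambda>z. a * f z + b * g z) h = (LINT z|P. a * (f z * cnj (h z)) + b * (g z * cnj (h z)))"
    unfolding ip_def by (simp add: algebra_simps)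
  also have "\<dots> = a * ip P f h + b * ip P g h"
    unfolding ip_def using assms integrable_ip by simp
  finally show ?thesis .
qed

lemma ip_cnj: "cnj (ip P f g) = ip P g f"
  unfolding ip_def by (subst Bochner_Integration.integral_cnj[symmetric]) (simp add: mult.commute)

lemma ip_self: "ip P f f = of_real (nrm2 P f)"
  unfolding ip_def nrm2_def
  unfolding integral_complex_of_real[symmetric] complex_norm_square ..

lemma nrm2_lincomb:
  assumes "f \<in> holL2 P" "g \<in> holL2 P"
  shows "nrm2 P (\<lambda>z. a * f z + b * g z)
    = (cmod a)\<^sup>2 * nrm2 P f + (cmod b)\<^sup>2 * nrm2 P g + 2 * Re (a * cnj b * ip P f g)"
proof -
  have *: "(cmod (x + y))\<^sup>2 = (cmod x)\<^sup>2 + (cmod y)\<^sup>2 + 2 * Re (x * cnj y)" for x y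
    by (simp add: cmod_power2) (simp add: power2_eq_square algebra_simps)
  have int: "integrable P (\<lambda>z. a * cnj b * (f z * cnj (g z)))"
    using integrable_ip[OF assms] by (rule integrable_mult_right)
  have "nrm2 P (\<lambda>z. a * f z + b * g z) = (LINT z|P. (cmod a)\<^sup>2 * (cmod (f z))\<^sup>2
     + (cmod b)\<^sup>2 * (cmod (g z))\<^sup>2 + 2 * Re (a * cnj b * (f z * cnj (g z))))"
    unfolding nrm2_def * by (simp add: norm_mult power_mult_distrib algebra_simps)
  also have "\<dots> = (cmod a)\<^sup>2 * nrm2 P f + (cmod b)\<^sup>2 * nrm2 P g
      + 2 * (LINT z|P. Re (a * cnj b * (f z * cnj (g z))))"
  proof -
    have "integrable P (\<lambda>z. (cmod (f z))\<^sup>2)" "integrable P (\<lambda>z. (cmod (g z))\<^sup>2)"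
      using assms by (simp_all add: holL2_def)
    with integrable_Re[OF int] show ?thesis unfolding nrm2_def
      by (simp only: Bochner_Integration.integral_add Bochner_Integration.integrable_add
          integrable_mult_right integral_mult_right_zero)
  qed
  also have "(LINT z|P. Re (a * cnj b * (f z * cnj (g z)))) = Re (a * cnj b * ip P f g)"
    using integral_Re[OF int] unfolding ip_def by (simp only: integral_mult_right_zero)
  finally show ?thesis .
qed

lemma nrm2_scale: "nrm2 P (\<lambda>z. a * f z) = (cmod a)\<^sup>2 * nrm2 P f"
  unfolding nrm2_def by (simp add: norm_mult power_mult_distrib)

text \<open>The parallelogram law with the term of the difference dropped.\<close>

lemma nrm2_add_le:
  assumes "f \<in> holL2 P" "g \<in> holL2 P"
  shows "nrm2 P (\<lambda>z. f z + g z) \<le> 2 * nrm2 P f + 2 * nrm2 P g"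
  using nrm2_lincomb[OF assms, of 1 1] nrm2_lincomb[OF assms, of 1 "-1"]
    nrm2_nonneg[of P "\<lambda>z. 1 * f z + (-1) * g z"] by simp

text \<open>The evaluation bound upgrades equality almost everywhere to equality at each point; this
  makes the definite description in \<open>kern\<close> unique.\<close>

lemma nrm2_zero_imp_eq:
  assumes "f \<in> holL2 P" "g \<in> holL2 P" "nrm2 P (\<lambda>z. f z - g z) = 0"
  shows "f = g"
proof
  fix z :: complex
  obtain C where "\<forall>h\<in>holL2 P. \<forall>u\<in>cball 0 (norm z). (cmod (h u))\<^sup>2 \<le> C * nrm2 P h"
    using eval_bound by blast
  then have "(cmod (f z - g z))\<^sup>2 \<le> C * nrm2 P (\<lambda>z. f z - g z)"
    using diff_holL2[OF assms(1,2)] by force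
  then show "f z = g z" using assms(3) by simp
qed

section \<open>Limits of norm-bounded sequences\<close>

text \<open>Fatou's lemma for the squared moduli. The bound is asked for eventually only, because in
  \<open>riesz\<close> the distance to the later members of a sequence is small only from some index
  on.\<close>

lemma nrm2_le_of_pointwise_limit:
  assumes f: "\<And>n. f n \<in> holL2 P" and g: "g holomorphic_on UNIV"
    and lim: "\<And>z. (\<lambda>n. f n z) \<longlonglongrightarrow> g z"
    and le: "eventually (\<lambda>n. nrm2 P (f n) \<le> B) sequentially"
  shows "g \<in> holL2 P" "nrm2 P g \<le> B"
proof -
  have [measurable]: "f n \<in> borel_measurable P" for n using f measurable_holL2 by blast
  have [measurable]: "g \<in> borel_measurable P" using g entire_borel_measurable sets_P by blast
  obtain N where "nrm2 P (f N) \<le> B" using le by (auto simp: eventually_sequentially)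
  then have B: "0 \<le> B" using nrm2_nonneg[of P "f N"] by linarith
  have "(\<integral>\<^sup>+z. ennreal ((cmod (g z))\<^sup>2) \<partial>P) = (\<integral>\<^sup>+z. liminf (\<lambda>n. ennreal ((cmod (f n z))\<^sup>2)) \<partial>P)"
  proof (rule nn_integral_cong)
    fix z
    have "(\<lambda>n. ennreal ((cmod (f n z))\<^sup>2)) \<longlonglongrightarrow> ennreal ((cmod (g z))\<^sup>2)"
      by (intro tendsto_intros lim tendsto_ennrealI)
    then show "ennreal ((cmod (g z))\<^sup>2) = liminf (\<lambda>n. ennreal ((cmod (f n z))\<^sup>2))"
      by (intro lim_imp_Liminf[symmetric]) simp_all
  qed
  also have "\<dots> \<le> liminf (\<lambda>n. \<integral>\<^sup>+z. ennreal ((cmod (f n z))\<^sup>2) \<partial>P)"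
    by (rule nn_integral_liminf) simp
  also have "\<dots> \<le> Limsup sequentially (\<lambda>n. \<integral>\<^sup>+z. ennreal ((cmod (f n z))\<^sup>2) \<partial>P)"
    by (rule Liminf_le_Limsup) simp
  also have "\<dots> \<le> ennreal B"
  proof (rule Limsup_bounded)
    show "\<forall>\<^sub>F n in sequentially. (\<integral>\<^sup>+z. ennreal ((cmod (f n z))\<^sup>2) \<partial>P) \<le> ennreal B"
      using le
    proof eventually_elim
      case (elim n)
      have "(\<integral>\<^sup>+z. ennreal ((cmod (f n z))\<^sup>2) \<partial>P) = ennreal (nrm2 P (f n))"
        unfolding nrm2_def using f by (intro nn_integral_eq_integral) (auto simp: holL2_def)
      then show ?case using elim by (simp add: ennreal_leI)
    qed
  qed
  finally have *: "(\<integral>\<^sup>+z. ennreal ((cmod (g z))\<^sup>2) \<partial>P) \<le> ennreal B" .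
  have int: "integrable P (\<lambda>z. (cmod (g z))\<^sup>2)"
    using * by (intro integrableI_bounded) (simp_all add: le_less_trans[OF _ ennreal_less_top])
  then show "g \<in> holL2 P" using g by (simp add: holL2_def)
  have "ennreal (nrm2 P g) \<le> ennreal B"
    using * unfolding nrm2_def by (subst nn_integral_eq_integral[OF int, symmetric]) auto
  then show "nrm2 P g \<le> B" using B by (simp add: ennreal_le_iff)
qed

text \<open>Weak sequential compactness of balls in concrete form: the evaluation bound gives local
  boundedness, Montel's theorem a locally uniform limit, and Fatou's lemma keeps that limit in the
  space.\<close>

lemma bounded_sequence_limit:
  assumes f: "\<And>n. f n \<in> holL2 P" and le: "\<And>n. nrm2 P (f n) \<le> B"
  obtains g \<sigma> where "g \<in> holL2 P" "strict_mono (\<sigma> :: nat \<Rightarrow> nat)"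
    "\<And>z. (\<lambda>n. f (\<sigma> n) z) \<longlonglongrightarrow> g z"
    "\<And>R. uniform_limit (cball 0 R) (\<lambda>n. f (\<sigma> n)) g sequentially"
proof -
  have bd: "\<exists>C. \<forall>h\<in>range f. \<forall>z\<in>K. norm (h z) \<le> C" if "compact K" for K
  proof -
    from compact_imp_bounded[OF that] obtain R where R: "K \<subseteq> cball 0 R"
      unfolding bounded_iff by (auto simp: subset_iff)
    obtain C where C: "\<forall>h\<in>holL2 P. \<forall>u\<in>cball 0 R. (cmod (h u))\<^sup>2 \<le> C * nrm2 P h"
      using eval_bound by blast
    have "norm (f n z) \<le> sqrt (\<bar>C\<bar> * B)" if "z \<in> K" for n z
    proof (rule real_le_rsqrt)
      have "(cmod (f n z))\<^sup>2 \<le> C * nrm2 P (f n)" using C f R that by blast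
      also have "\<dots> \<le> \<bar>C\<bar> * B" by (intro mult_mono le nrm2_nonneg) auto
      finally show "(cmod (f n z))\<^sup>2 \<le> \<bar>C\<bar> * B" .
    qed
    then show ?thesis by blast
  qed
  obtain g \<sigma> where g: "g holomorphic_on UNIV" "strict_mono (\<sigma> :: nat \<Rightarrow> nat)"
    and lim: "\<And>z. (\<lambda>n. f (\<sigma> n) z) \<longlonglongrightarrow> g z"
    and unif: "\<And>K. compact K \<Longrightarrow> uniform_limit K (f \<circ> \<sigma>) g sequentially"
  proof (rule Montel[of UNIV "range f" f])
    fix h assume "h \<in> range f"
    then obtain n where "h = f n" by (rule rangeE)
    then show "h holomorphic_on UNIV" using f[of n] by (simp add: holL2_def)
  qed (use bd in simp_all)
  have "g \<in> holL2 P"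
  proof (rule nrm2_le_of_pointwise_limit(1)[OF _ g(1) lim])
    show "\<forall>\<^sub>F n in sequentially. nrm2 P (f (\<sigma> n)) \<le> B" using le by simp
  qed (rule f)
  moreover have "uniform_limit (cball 0 R) (\<lambda>n. f (\<sigma> n)) g sequentially" for R
    using unif[OF compact_cball, of 0 R] by (simp add: comp_def)
  ultimately show ?thesis using that g(2) lim by blast
qed

section \<open>Riesz representation and the reproducing kernel\<close>

text \<open>
  A minimizing sequence of \<open>g \<mapsto> \<parallel>g\<parallel>\<^sup>2 - 2 Re (L g)\<close> is Cauchy by the parallelogram law, and
  Montel's theorem together with Fatou's lemma provides its limit.
\<close>

proposition riesz:
  assumes lin: "\<And>f g a b. f \<in> holL2 P \<Longrightarrow> g \<in> holL2 P \<Longrightarrow> L (\<lambda>z. a * f z + b * g z) = a * L f + b * L g"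
    and bdd: "\<And>f. f \<in> holL2 P \<Longrightarrow> (cmod (L f))\<^sup>2 \<le> C * nrm2 P f"
  obtains h where "h \<in> holL2 P" "\<And>f. f \<in> holL2 P \<Longrightarrow> L f = ip P f h"
proof -
  define \<Phi> where "\<Phi> g = nrm2 P g - 2 * Re (L g)" for g
  have low: "- \<bar>C\<bar> \<le> \<Phi> g" if "g \<in> holL2 P" for g
  proof -
    have "(Re (L g))\<^sup>2 \<le> (cmod (L g))\<^sup>2" by (simp add: cmod_power2)
    also have "\<dots> \<le> C * nrm2 P g" by (rule bdd[OF that])
    also have "\<dots> \<le> \<bar>C\<bar> * nrm2 P g" by (intro mult_right_mono nrm2_nonneg) auto
    \<comment> \<open>The inequality of arithmetic and geometric means: then
      \<open>2 * Re (L g)\<close> is at most \<open>\<bar>C\<bar> + nrm2 P g\<close>, and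
      \<open>\<Phi>\<close> is bounded below.\<close>
    also have "\<dots> \<le> ((\<bar>C\<bar> + nrm2 P g)/2)\<^sup>2"
    proof -
      have "0 \<le> (\<bar>C\<bar> - nrm2 P g)\<^sup>2" by simp
      then show ?thesis by (simp add: power2_eq_square algebra_simps)
    qed
    finally have "Re (L g) \<le> (\<bar>C\<bar> + nrm2 P g)/2"
      by (rule power2_le_imp_le) (simp add: nrm2_nonneg)
    then show ?thesis by (simp add: \<Phi>_def)
  qed
  define m where "m = Inf (\<Phi> ` holL2 P)"
  have bel: "bdd_below (\<Phi> ` holL2 P)" using low by (auto intro!: bdd_belowI)
  have m: "m \<le> \<Phi> g" if "g \<in> holL2 P" for g
    unfolding m_def by (rule cINF_lower[OF bel that])
  define e where "e n = 1 / real (Suc n)" for n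
  have e_pos: "0 < e n" for n by (simp add: e_def)
  have "\<exists>g\<in>holL2 P. \<Phi> g < m + e n" for n
  proof -
    have "Inf (\<Phi> ` holL2 P) < m + e n" using e_pos by (simp add: m_def)
    then show ?thesis using cInf_lessD[of "\<Phi> ` holL2 P"] zero_holL2 by blast
  qed
  then obtain g where g: "\<And>n. g n \<in> holL2 P" and gm: "\<And>n. \<Phi> (g n) < m + e n"
    by metis
  have cauchy: "nrm2 P (\<lambda>z. g i z - g j z) \<le> 2 * e i + 2 * e j" for i j
  proof -
    have "m \<le> \<Phi> (\<lambda>z. (1/2) * g i z + (1/2) * g j z)" using m g lincomb_holL2 by blast
    also have "\<dots> = (\<Phi> (g i) + \<Phi> (g j)) / 2 - nrm2 P (\<lambda>z. 1 * g i z + (-1) * g j z) / 4"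
      unfolding \<Phi>_def lin[OF g g] nrm2_lincomb[OF g g]
      by (simp add: power2_eq_square add_divide_distrib diff_divide_distrib)
    finally have "m \<le> (\<Phi> (g i) + \<Phi> (g j)) / 2 - nrm2 P (\<lambda>z. g i z - g j z) / 4" by simp
    moreover have "d \<le> 2 * x + 2 * y" if "m \<le> (p + q) / 2 - d / 4" "p < m + x" "q < m + y"
      for d x y p q :: real using that by (simp add: field_simps)
    ultimately show ?thesis using gm[of i] gm[of j] by blast
  qed
  have "nrm2 P (g n) \<le> 8 + 2 * nrm2 P (g 0)" for n
  proof -
    have "nrm2 P (\<lambda>z. (g n z - g 0 z) + g 0 z) \<le> 2 * nrm2 P (\<lambda>z. g n z - g 0 z) + 2 * nrm2 P (g 0)"
      by (rule nrm2_add_le) (use g diff_holL2 in auto)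
    moreover have "e n \<le> 1" "e 0 = 1" by (simp_all add: e_def)
    ultimately show ?thesis using cauchy[of n 0] by simp
  qed
  then obtain h \<sigma> where h: "h \<in> holL2 P" and \<sigma>: "strict_mono (\<sigma> :: nat \<Rightarrow> nat)"
    and lim: "\<And>z. (\<lambda>n. g (\<sigma> n) z) \<longlonglongrightarrow> h z"
    using bounded_sequence_limit[of g "8 + 2 * nrm2 P (g 0)"] g by metis
  have dist: "nrm2 P (\<lambda>z. g n z - h z) \<le> 4 * e n" for n
  proof (rule nrm2_le_of_pointwise_limit(2)[of "\<lambda>k z. g n z - g (\<sigma> k) z"])
    show "\<forall>\<^sub>F k in sequentially. nrm2 P (\<lambda>z. g n z - g (\<sigma> k) z) \<le> 4 * e n"
      using eventually_ge_at_top[of n]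
    proof eventually_elim
      case (elim k)
      then have "n \<le> \<sigma> k" using seq_suble[OF \<sigma>, of k] by linarith
      then have "e (\<sigma> k) \<le> e n" by (simp add: e_def field_simps)
      then show ?case using cauchy[of n "\<sigma> k"] by simp
    qed
  qed (use g h diff_holL2 lim in \<open>auto intro!: tendsto_intros simp: holL2_def holomorphic_on_diff\<close>)
  have e_lim: "e \<longlonglongrightarrow> 0"
    unfolding e_def using LIMSEQ_inverse_real_of_nat by (simp add: inverse_eq_divide)
  have lim_ip: "(\<lambda>n. ip P f (g n)) \<longlonglongrightarrow> ip P f h" if f: "f \<in> holL2 P" for f
  proof -
    have "(\<lambda>n. (cmod (ip P f (g n) - ip P f h))\<^sup>2) \<longlonglongrightarrow> 0"
    proof (rule tendsto_sandwich[where f = "\<lambda>_. 0"])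
      show "\<forall>\<^sub>F n in sequentially. (cmod (ip P f (g n) - ip P f h))\<^sup>2 \<le> nrm2 P f * (4 * e n)"
      proof (rule always_eventually, rule allI)
        fix n
        have "ip P f (g n) - ip P f h = cnj (ip P (\<lambda>z. 1 * g n z + (-1) * h z) f)"
          by (subst ip_lincomb_left[OF g h f]) (simp add: ip_cnj)
        also have "\<dots> = ip P f (\<lambda>z. g n z - h z)" by (simp add: ip_cnj)
        finally have "(cmod (ip P f (g n) - ip P f h))\<^sup>2 \<le> nrm2 P f * nrm2 P (\<lambda>z. g n z - h z)"
          using cauchy_schwarz[OF f diff_holL2[OF g h]] by simp
        also have "\<dots> \<le> nrm2 P f * (4 * e n)"
          by (intro mult_left_mono dist nrm2_nonneg)
        finally show "(cmod (ip P f (g n) - ip P f h))\<^sup>2 \<le> nrm2 P f * (4 * e n)" .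
      qed
      show "(\<lambda>n. nrm2 P f * (4 * e n)) \<longlonglongrightarrow> 0"
        using e_lim by (auto intro!: tendsto_eq_intros)
    qed auto
    then have "(\<lambda>n. cmod (ip P f (g n) - ip P f h)) \<longlonglongrightarrow> 0"
      using tendsto_real_sqrt by fastforce
    then show ?thesis by (simp add: LIM_zero_iff tendsto_norm_zero_iff)
  qed
  have re: "Re (ip P f h) = Re (L f)" if f: "f \<in> holL2 P" for f
  proof -
    \<comment> \<open>Minimality is tested at the approximants \<open>g n\<close>, where it holds up
      to \<open>e n\<close>, and only then is the limit taken; so the value of \<open>\<Phi>\<close>
      at \<open>h\<close> is never computed.\<close>
    have "0 \<le> 2 * t * (Re (ip P f h) - Re (L f)) + t\<^sup>2 * nrm2 P f" for t
    proof (rule tendsto_lowerbound)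
      show "(\<lambda>n. 2 * t * (Re (ip P f (g n)) - Re (L f)) + t\<^sup>2 * nrm2 P f + e n)
              \<longlonglongrightarrow> 2 * t * (Re (ip P f h) - Re (L f)) + t\<^sup>2 * nrm2 P f"
        using e_lim lim_ip[OF f] by (auto intro!: tendsto_eq_intros)
      show "\<forall>\<^sub>F n in sequentially. 0 \<le> 2 * t * (Re (ip P f (g n)) - Re (L f)) + t\<^sup>2 * nrm2 P f + e n"
      proof (rule always_eventually, rule allI)
        fix n
        have "m \<le> \<Phi> (\<lambda>z. of_real t * f z + 1 * g n z)" using m f g lincomb_holL2 by blast
        also have "\<dots> = 2 * t * (Re (ip P f (g n)) - Re (L f)) + t\<^sup>2 * nrm2 P f + \<Phi> (g n)"
          unfolding \<Phi>_def lin[OF f g] nrm2_lincomb[OF f g] by (simp add: algebra_simps)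
        finally show "0 \<le> 2 * t * (Re (ip P f (g n)) - Re (L f)) + t\<^sup>2 * nrm2 P f + e n"
          using gm[of n] by linarith
      qed
    qed simp
    from quadratic_nonneg_linear_zero[OF this] show ?thesis by simp
  qed
  have "L f = ip P f h" if f: "f \<in> holL2 P" for f
  proof -
    \<comment> \<open>Real parts for \<open>\<i> * f\<close> are imaginary parts for
      \<open>f\<close>, up to sign; the summand \<open>0 * f z\<close> only brings the function into
      the shape that \<open>lin\<close> expects.\<close>
    have "Re (ip P (\<lambda>z. \<i> * f z + 0 * f z) h) = Re (L (\<lambda>z. \<i> * f z + 0 * f z))"
      by (rule re) (use f lincomb_holL2 in blast)
    then have "Im (ip P f h) = Im (L f)"
      unfolding lin[OF f f] ip_lincomb_left[OF f f h] by simp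
    with re[OF f] show ?thesis by (simp add: complex_eq_iff)
  qed
  with h that show ?thesis by blast
qed

text \<open>The same description as \<open>rep_kernel\<close>, in terms of \<open>holL2\<close> and
  \<open>ip\<close>, so that \<open>rep_kernel_eq\<close> reduces to equivalent predicates.\<close>

definition kern :: "complex \<Rightarrow> complex \<Rightarrow> complex" where
  "kern z = (THE g. g \<in> holL2 P \<and> (\<forall>f\<in>holL2 P. f z = ip P f g))"

lemma
  shows kern_holL2: "kern z \<in> holL2 P"
    and kern_reproducing: "f \<in> holL2 P \<Longrightarrow> ip P f (kern z) = f z"
proof -
  obtain C where C: "\<forall>h\<in>holL2 P. \<forall>u\<in>cball 0 (norm z). (cmod (h u))\<^sup>2 \<le> C * nrm2 P h"
    using eval_bound by blast
  obtain h where h: "h \<in> holL2 P" "\<And>f. f \<in> holL2 P \<Longrightarrow> f z = ip P f h"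
    by (rule riesz[of "\<lambda>f. f z" C]) (use C in auto)
  have "kern z \<in> holL2 P \<and> (\<forall>f\<in>holL2 P. f z = ip P f (kern z))"
    unfolding kern_def
  proof (rule theI[of _ h])
    fix g assume g: "g \<in> holL2 P \<and> (\<forall>f\<in>holL2 P. f z = ip P f g)"
    let ?d = "\<lambda>z. 1 * g z + (-1) * h z"
    have d: "?d \<in> holL2 P" using g h lincomb_holL2 by blast
    have "ip P ?d g = ip P ?d h" using g h d by metis
    then have "cnj (ip P ?d g) = cnj (ip P ?d h)" by simp
    then have "ip P ?d ?d = 0"
      using g h d by (subst ip_lincomb_left) (auto simp: ip_cnj)
    then have "nrm2 P (\<lambda>z. g z - h z) = 0" by (simp add: ip_self)
    then show "g = h" using nrm2_zero_imp_eq g h by blast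
  qed (use h in blast)
  then show "kern z \<in> holL2 P" "f \<in> holL2 P \<Longrightarrow> ip P f (kern z) = f z" by auto
qed

lemma kern_diag: "kern z z = of_real (nrm2 P (kern z))"
  using kern_reproducing[OF kern_holL2, of z z] by (simp add: ip_self)

lemma eval_le_kern:
  assumes "f \<in> holL2 P"
  shows "(cmod (f z))\<^sup>2 \<le> nrm2 P f * nrm2 P (kern z)"
  using cauchy_schwarz[OF assms kern_holL2, of z] kern_reproducing[OF assms] by simp

text \<open>With \<open>J\<close> the inclusion into \<open>L\<^sup>2(\<nu>)\<close>, the Toeplitz operator is \<open>J\<^sup>* J\<close>.\<close>

lemma toeplitz_carleson:
  assumes sets_\<nu>: "sets \<nu> = sets borel" and C: "0 \<le> C"
    and carleson: "\<And>f. f \<in> holL2 P \<Longrightarrow> (\<integral>\<^sup>+z. ennreal ((cmod (f z))\<^sup>2) \<partial>\<nu>) \<le> ennreal (C * nrm2 P f)"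
    and f: "f \<in> holL2 P"
  shows "integrable \<nu> (\<lambda>u. f u * cnj (kern z u))"
    and "(\<lambda>z. LINT u|\<nu>. f u * cnj (kern z u)) \<in> holL2 P"
    and "nrm2 P (\<lambda>z. LINT u|\<nu>. f u * cnj (kern z u)) \<le> C * (LINT u|\<nu>. (cmod (f u))\<^sup>2)"
    and "nrm2 P (\<lambda>z. LINT u|\<nu>. f u * cnj (kern z u)) \<le> C\<^sup>2 * nrm2 P f"
proof -
  have meas[measurable]: "g \<in> borel_measurable \<nu>" if "g \<in> holL2 P" for g
    using that entire_borel_measurable sets_\<nu> unfolding holL2_def by blast
  have int: "integrable \<nu> (\<lambda>u. (cmod (g u))\<^sup>2)" if g: "g \<in> holL2 P" for g
    using carleson[OF g] meas[OF g]
    by (intro integrableI_bounded) (auto simp: less_top[symmetric] top_unique)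
  have le: "(LINT u|\<nu>. (cmod (g u))\<^sup>2) \<le> C * nrm2 P g" if g: "g \<in> holL2 P" for g
  proof -
    have "ennreal (LINT u|\<nu>. (cmod (g u))\<^sup>2) \<le> ennreal (C * nrm2 P g)"
      using carleson[OF g] by (subst nn_integral_eq_integral[OF int[OF g], symmetric]) auto
    then show ?thesis using C nrm2_nonneg by (simp add: ennreal_le_iff)
  qed
  have intp: "integrable \<nu> (\<lambda>u. g u * cnj (h u))" if "g \<in> holL2 P" "h \<in> holL2 P" for g h
    using Cauchy_Schwarz_complex_integral(1) meas int that by blast
  \<comment> \<open>\<open>L g\<close> pairs \<open>g\<close> with \<open>f\<close> in the space of
    \<open>\<nu>\<close>, so its Riesz representative \<open>h\<close> is the adjoint of the
    inclusion applied to \<open>f\<close>. Evaluating \<open>h\<close> through \<open>kern z\<close>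
    then identifies it with the Toeplitz integral.\<close>
  define L where "L g = (LINT u|\<nu>. g u * cnj (f u))" for g
  let ?F = "LINT u|\<nu>. (cmod (f u))\<^sup>2"
  have F: "0 \<le> ?F" by simp
  have L: "(cmod (L g))\<^sup>2 \<le> ?F * C * nrm2 P g" if g: "g \<in> holL2 P" for g
  proof -
    have "(cmod (L g))\<^sup>2 \<le> (LINT u|\<nu>. (cmod (g u))\<^sup>2) * ?F"
      unfolding L_def using Cauchy_Schwarz_complex_integral(2) meas int g f by blast
    also have "\<dots> \<le> C * nrm2 P g * ?F" by (intro mult_right_mono le g F)
    finally show ?thesis by (simp add: mult_ac)
  qed
  obtain h where h: "h \<in> holL2 P" and Lh: "\<And>g. g \<in> holL2 P \<Longrightarrow> L g = ip P g h"
  proof (rule riesz[of L "?F * C"])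
    fix g k a b assume gk: "g \<in> holL2 P" "k \<in> holL2 P"
    have "L (\<lambda>z. a * g z + b * k z) = (LINT u|\<nu>. a * (g u * cnj (f u)) + b * (k u * cnj (f u)))"
      unfolding L_def by (simp add: algebra_simps)
    then show "L (\<lambda>z. a * g z + b * k z) = a * L g + b * L k"
      unfolding L_def using intp gk f by simp
  qed (use L in auto)
  show "integrable \<nu> (\<lambda>u. f u * cnj (kern z u))" using intp f kern_holL2 by blast
  have eq: "(\<lambda>z. LINT u|\<nu>. f u * cnj (kern z u)) = h"
  proof
    fix z
    have "h z = ip P h (kern z)" using kern_reproducing[OF h] by simp
    also have "\<dots> = cnj (L (kern z))" by (simp add: Lh[OF kern_holL2] ip_cnj)
    also have "\<dots> = (LINT u|\<nu>. f u * cnj (kern z u))"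
      unfolding L_def by (subst Bochner_Integration.integral_cnj[symmetric]) (simp add: mult.commute)
    finally show "(LINT u|\<nu>. f u * cnj (kern z u)) = h z" by simp
  qed
  show "(\<lambda>z. LINT u|\<nu>. f u * cnj (kern z u)) \<in> holL2 P" using eq h by simp
  \<comment> \<open>The functional is tested on its own representative, after which one factor
    \<open>nrm2 P h\<close> cancels.\<close>
  have "(nrm2 P h)\<^sup>2 = (cmod (L h))\<^sup>2" using Lh[OF h] by (simp add: ip_self)
  also have "\<dots> \<le> C * ?F * nrm2 P h" using L[OF h] by (simp add: mult_ac)
  finally have "nrm2 P h * nrm2 P h \<le> C * ?F * nrm2 P h" by (simp add: power2_eq_square)
  then have 1: "nrm2 P h \<le> C * ?F"
    using nrm2_nonneg[of P h] C F by (cases "nrm2 P h = 0") (auto simp: mult_le_cancel_right)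
  show "nrm2 P (\<lambda>z. LINT u|\<nu>. f u * cnj (kern z u)) \<le> C * ?F" using 1 eq by simp
  have "C * ?F \<le> C * (C * nrm2 P f)" by (intro mult_left_mono le f C)
  with 1 eq show "nrm2 P (\<lambda>z. LINT u|\<nu>. f u * cnj (kern z u)) \<le> C\<^sup>2 * nrm2 P f"
    by (simp add: power2_eq_square mult_ac)
qed

end

section \<open>Local estimates for entire functions\<close>

text \<open>Disks of radius \<open>R / 4\<close> about points of the half-size disk stay inside
  \<open>ball z R\<close>, so Cauchy's estimate bounds the derivative by \<open>4 * K / R\<close>
  there; the half-size disk is convex.\<close>

lemma holomorphic_lipschitz:
  assumes f: "f holomorphic_on ball z R" and R: "0 < R"
    and K: "\<And>u. u \<in> ball z R \<Longrightarrow> cmod (f u) \<le> K" and x: "dist z x \<le> R / 2"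
  shows "cmod (f x - f z) \<le> 4 * K / R * cmod (x - z)"
proof (rule field_differentiable_bound[of "cball z (R/2)"])
  fix u assume u: "u \<in> cball z (R/2)"
  have sub: "cball u (R/4) \<subseteq> ball z R"
  proof
    fix y assume "y \<in> cball u (R/4)"
    then show "y \<in> ball z R" using u R dist_triangle[of z y u] by simp
  qed
  show "(f has_field_derivative deriv f u) (at u within cball z (R / 2))"
  proof (rule has_field_derivative_at_within, rule holomorphic_derivI[OF f open_ball])
    show "u \<in> ball z R" using u R by simp
  qed
  have "norm ((deriv ^^ 1) f u) \<le> fact 1 * K / (R/4)^1"
  proof (rule Cauchy_inequality)
    show "f holomorphic_on ball u (R/4)"
      by (rule holomorphic_on_subset[OF f order_trans[OF ball_subset_cball sub]])
    show "continuous_on (cball u (R/4)) f"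
      using holomorphic_on_imp_continuous_on[OF holomorphic_on_subset[OF f sub]] .
    show "cmod (f x) \<le> K" if "cmod (u - x) = R/4" for x
    proof (rule K)
      have "x \<in> cball u (R/4)" using that by (simp add: dist_norm)
      then show "x \<in> ball z R" using sub by blast
    qed
  qed (use R in simp)
  then show "cmod (deriv f u) \<le> 4 * K / R" by (simp add: mult.commute)
qed (use R x in auto)

text \<open>
  The centre \<open>\<zeta>\<close> maximizes \<open>(r - |\<zeta> - z|)\<^sup>N |f(\<zeta>)|\<close>: near \<open>\<zeta>\<close> the function is at most \<open>2\<^sup>N |f(\<zeta>)|\<close>, so
  Cauchy's estimate keeps it large on a ball around \<open>\<zeta>\<close>, and a small ball is paid for by the
  size of \<open>f\<close>. The exponent \<open>N\<close> is chosen to match the doubling exponent of the measure; this makes the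
  subharmonicity of small powers of \<open>|f|\<close> unnecessary.
\<close>

lemma large_on_small_ball:
  fixes f :: "complex \<Rightarrow> complex"
  assumes f: "f holomorphic_on UNIV" and r: "0 < r" and N: "0 < N"
  obtains \<zeta> s where "dist z \<zeta> < r" "0 < s" "s \<le> r" "ball \<zeta> s \<subseteq> ball z r"
    "\<And>\<xi>. \<xi> \<in> ball \<zeta> s \<Longrightarrow> r ^ N * cmod (f z) / (2 * (16 * 2 ^ N) ^ N) \<le> cmod (f \<xi>) * s ^ N"
proof (cases "f z = 0")
  case True
  then show ?thesis using that[of z r] r by simp
next
  case False
  define \<phi> where "\<phi> \<zeta> = (r - dist z \<zeta>) ^ N * cmod (f \<zeta>)" for \<zeta>
  have "continuous_on (cball z r) \<phi>"
    unfolding \<phi>_def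
    by (intro continuous_intros holomorphic_on_imp_continuous_on holomorphic_on_subset[OF f]) auto
  then obtain \<zeta> where \<zeta>: "\<zeta> \<in> cball z r" and max: "\<And>u. u \<in> cball z r \<Longrightarrow> \<phi> u \<le> \<phi> \<zeta>"
    using continuous_attains_sup[of "cball z r" \<phi>] r by auto
  have z: "r ^ N * cmod (f z) \<le> \<phi> \<zeta>" using max[of z] r by (simp add: \<phi>_def)
  moreover have "0 < r ^ N * cmod (f z)" using False r by simp
  ultimately have "0 < \<phi> \<zeta>" by linarith
  then have "dist z \<zeta> \<noteq> r" using N by (auto simp: \<phi>_def zero_power)
  then have dist: "dist z \<zeta> < r" using \<zeta> by simp
  \<comment> \<open>Half the distance from \<open>\<zeta>\<close> to the boundary: on
    \<open>ball \<zeta> t\<close> the boundary distance is still at least \<open>t\<close>, so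
    maximality of \<open>\<phi>\<close> at \<open>\<zeta>\<close> costs only a factor
    \<open>2 ^ N\<close>.\<close>
  define t where "t = (r - dist z \<zeta>) / 2"
  have t: "0 < t" "t \<le> r / 2" using dist by (simp_all add: t_def)
  \<comment> \<open>The Lipschitz constant at \<open>\<zeta>\<close> is
    \<open>4 * 2 ^ N * cmod (f \<zeta>) / t\<close>; on this radius \<open>f\<close> varies by at
    most \<open>cmod (f \<zeta>) / 2\<close>.\<close>
  define s where "s = t / (8 * 2 ^ N)"
  have "(1::real) \<le> 2 ^ N" by simp
  then have "(2::real) \<le> 8 * 2 ^ N" by linarith
  then have s: "0 < s" "s \<le> t / 2"
    using t divide_left_mono[of 2 "8 * 2 ^ N" t] unfolding s_def by auto
  have bound: "cmod (f u) \<le> 2 ^ N * cmod (f \<zeta>)" if u: "u \<in> ball \<zeta> t" for u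
  proof -
    have d: "t \<le> r - dist z u"
      using u dist_triangle[of z u \<zeta>] by (simp add: t_def)
    then have "\<phi> u \<le> \<phi> \<zeta>" using t by (intro max) simp
    moreover have "t ^ N * cmod (f u) \<le> \<phi> u"
      unfolding \<phi>_def using d t by (intro mult_right_mono power_mono) auto
    moreover have "\<phi> \<zeta> = t ^ N * (2 ^ N * cmod (f \<zeta>))"
      unfolding \<phi>_def by (simp add: t_def power_divide)
    ultimately have "t ^ N * cmod (f u) \<le> t ^ N * (2 ^ N * cmod (f \<zeta>))" by linarith
    then show ?thesis using t by simp
  qed
  show ?thesis
  proof (rule that[of \<zeta> s])
    show "ball \<zeta> s \<subseteq> ball z r"
    proof
      fix y assume "y \<in> ball \<zeta> s"
      then show "y \<in> ball z r" using s t dist_triangle[of z y \<zeta>] by (simp add: t_def)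
    qed
    fix \<xi> assume \<xi>: "\<xi> \<in> ball \<zeta> s"
    have "cmod (f \<xi> - f \<zeta>) \<le> 4 * (2 ^ N * cmod (f \<zeta>)) / t * cmod (\<xi> - \<zeta>)"
    proof (rule holomorphic_lipschitz)
      show "f holomorphic_on ball \<zeta> t" using holomorphic_on_subset[OF f] by simp
      show "dist \<zeta> \<xi> \<le> t / 2" using \<xi> s by simp
    qed (use t bound in auto)
    also have "\<dots> \<le> 4 * (2 ^ N * cmod (f \<zeta>)) / t * s"
      using \<xi> t by (intro mult_left_mono) (auto simp: dist_norm norm_minus_commute)
    also have "\<dots> = cmod (f \<zeta>) / 2" using t by (simp add: s_def)
    finally have *: "cmod (f \<zeta>) / 2 \<le> cmod (f \<xi>)"
      using norm_triangle_ineq2[of "f \<zeta>" "f \<xi>"] by (simp add: norm_minus_commute)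
    have "r ^ N * cmod (f z) / (2 * (16 * 2 ^ N) ^ N) \<le> \<phi> \<zeta> / (2 * (16 * 2 ^ N) ^ N)"
      by (intro divide_right_mono z) simp
    also have "\<phi> \<zeta> = (2 * t) ^ N * cmod (f \<zeta>)"
    proof -
      have "2 * t = r - dist z \<zeta>" by (simp add: t_def)
      then show ?thesis by (simp only: \<phi>_def)
    qed
    \<comment> \<open>The source of the constant in the claim: \<open>16 * 2 ^ N\<close> is the
      ratio of the boundary distance \<open>2 * t\<close> to \<open>s\<close>, and the remaining 2
      is the half of \<open>cmod (f \<zeta>)\<close> that survives.\<close>
    also have "2 * t = (16 * 2 ^ N) * s" by (simp add: s_def)
    also have "((16 * 2 ^ N) * s) ^ N * cmod (f \<zeta>) / (2 * (16 * 2 ^ N) ^ N) = cmod (f \<zeta>) / 2 * s ^ N"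
      by (simp add: power_mult_distrib)
    also have "\<dots> \<le> cmod (f \<xi>) * s ^ N" using * s by (intro mult_right_mono) auto
    finally show "r ^ N * cmod (f z) / (2 * (16 * 2 ^ N) ^ N) \<le> cmod (f \<xi>) * s ^ N" .
  qed (use s t dist in auto)
qed

lemma gaussian_translate:
  "(cmod (\<xi> - z))\<^sup>2 = (cmod \<xi>)\<^sup>2 - 2 * Re (cnj z * \<xi>) + (cmod z)\<^sup>2"
  unfolding cmod_power2 by (simp add: power2_eq_square algebra_simps)

text \<open>A zero-free holomorphic factor moves the peak of the Gaussian from 0 to
  \<open>z\<close>. On a disk of fixed radius about \<open>z\<close> the new Gaussian lies between
  positive constants independent of \<open>z\<close>, so local estimates reduce to unweighted ones
  for entire functions.\<close>

lemma gaussian_recentre: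
  "(cmod (f \<xi>))\<^sup>2 * exp (- \<alpha> * (cmod \<xi>)\<^sup>2)
    = (cmod (f \<xi> * exp (- (of_real \<alpha> * cnj z * \<xi>))))\<^sup>2 * exp (- \<alpha> * (cmod (\<xi> - z))\<^sup>2) * exp (\<alpha> * (cmod z)\<^sup>2)"
proof -
  have "(cmod (exp (- (of_real \<alpha> * cnj z * \<xi>))))\<^sup>2 = exp (- 2 * \<alpha> * Re (cnj z * \<xi>))"
    unfolding norm_exp_eq_Re power2_eq_square exp_add[symmetric] by (simp add: algebra_simps)
  then have "(cmod (exp (- (of_real \<alpha> * cnj z * \<xi>))))\<^sup>2 * exp (- \<alpha> * (cmod (\<xi> - z))\<^sup>2) * exp (\<alpha> * (cmod z)\<^sup>2)
      = exp (- 2 * \<alpha> * Re (cnj z * \<xi>) + - \<alpha> * (cmod (\<xi> - z))\<^sup>2 + \<alpha> * (cmod z)\<^sup>2)"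
    by (simp only: exp_add)
  also have "- 2 * \<alpha> * Re (cnj z * \<xi>) + - \<alpha> * (cmod (\<xi> - z))\<^sup>2 + \<alpha> * (cmod z)\<^sup>2 = - \<alpha> * (cmod \<xi>)\<^sup>2"
    unfolding gaussian_translate[of \<xi> z] by (simp add: algebra_simps)
  finally show ?thesis by (simp only: norm_mult power_mult_distrib mult.assoc)
qed

section \<open>Fock spaces of doubling measures\<close>

lemma sigma_finite_borel:
  assumes "sets \<nu> = sets (borel :: complex measure)" "\<And>R. emeasure \<nu> (ball 0 R) < \<infinity>"
  shows "sigma_finite_measure \<nu>"
proof
  have "\<exists>n. x \<in> ball 0 (real n)" for x :: complex
    using reals_Archimedean2[of "norm x"] by simp
  then have "\<Union> (range (\<lambda>n::nat. ball (0::complex) (real n))) = space \<nu>"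
    using sets_eq_imp_space_eq[OF assms(1)] by auto
  then show "\<exists>A. countable A \<and> A \<subseteq> sets \<nu> \<and> \<Union> A = space \<nu> \<and> (\<forall>a\<in>A. emeasure \<nu> a \<noteq> \<infinity>)"
    using assms by (intro exI[of _ "range (\<lambda>n::nat. ball (0::complex) (real n))"]) (auto simp: less_top)
qed

text \<open>One inequality covers two needs: \<open>t = \<rho>\<close> compares neighbouring disks
  of the basic size, and small \<open>t\<close> bounds the mass of small disks from below. The
  exponent is even to match \<open>large_on_small_ball\<close>, whose factor \<open>s ^ N\<close>
  gets squared.\<close>

locale doubling_fock =
  fixes \<alpha> \<rho> \<kappa> :: real and N :: nat and M :: "complex measure"
  assumes \<alpha>: "0 < \<alpha>" and \<rho>: "0 < \<rho>" and \<kappa>: "0 < \<kappa>" and N: "0 < N"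
    and sets_M[measurable_cong]: "sets M = sets borel"
    and ball_pos: "0 < emeasure M (ball z \<rho>)" and ball_finite: "emeasure M (ball z \<rho>) < \<infinity>"
    and doubling: "dist z \<zeta> \<le> \<rho> \<Longrightarrow> 0 < t \<Longrightarrow> t \<le> \<rho> \<Longrightarrow>
      ennreal (\<kappa> * t ^ (2 * N)) * emeasure M (ball z \<rho>) \<le> emeasure M (ball \<zeta> t)"
begin

definition v :: "complex \<Rightarrow> real" where "v z = measure M (ball z \<rho>)"

definition gauss :: "complex \<Rightarrow> real" where "gauss z = exp (- \<alpha> * (cmod z)\<^sup>2)"

lemma emeasure_ball_v: "emeasure M (ball z \<rho>) = ennreal (v z)"
  unfolding v_def using ball_finite[of z] by (intro emeasure_eq_ennreal_measure) auto

lemma v_pos: "0 < v z"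
  using ball_pos[of z] by (simp add: emeasure_ball_v)

lemma gauss_pos: "0 < gauss z" by (simp add: gauss_def)

lemma ball_sets_M[measurable, simp]: "ball z r \<in> sets M"
  by (simp add: sets_M)

lemma gauss_measurable[measurable]: "gauss \<in> borel_measurable borel"
  unfolding gauss_def by measurable

lemma entire_measurable_M: "f holomorphic_on UNIV \<Longrightarrow> f \<in> borel_measurable M"
  using entire_borel_measurable sets_M by blast

lemma doubling_real:
  "dist z \<zeta> \<le> \<rho> \<Longrightarrow> 0 < t \<Longrightarrow> t \<le> \<rho> \<Longrightarrow> ennreal (\<kappa> * t ^ (2 * N) * v z) \<le> emeasure M (ball \<zeta> t)"
  using doubling[of z \<zeta> t] \<kappa> v_pos[of z] by (simp add: emeasure_ball_v ennreal_mult)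

definition A :: real where "A = 1 / (\<kappa> * \<rho> ^ (2 * N))"

lemma A_pos: "0 < A" using \<kappa> \<rho> by (simp add: A_def)

lemma v_near:
  assumes "dist z \<zeta> \<le> \<rho>"
  shows "v z \<le> A * v \<zeta>"
proof -
  have "ennreal (\<kappa> * \<rho> ^ (2 * N) * v z) \<le> ennreal (v \<zeta>)"
    using doubling_real[OF assms, of \<rho>] \<rho> by (simp add: emeasure_ball_v)
  then have "\<kappa> * \<rho> ^ (2 * N) * v z \<le> v \<zeta>" using v_pos[of \<zeta>] by (subst (asm) ennreal_le_iff) auto
  then show ?thesis using \<kappa> \<rho> by (simp add: A_def field_simps)
qed

text \<open>On the disk from \<open>large_on_small_ball\<close>, taken for the recentred function,
  \<open>cmod (f \<xi>)\<close> squared times \<open>gauss \<xi>\<close> is at least a multiple of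
  \<open>1 / s ^ (2 * N)\<close>, while \<open>doubling\<close> gives the disk mass at least a
  multiple of \<open>s ^ (2 * N) * v z\<close>. The unknown radius \<open>s\<close> cancels.\<close>

lemma pointwise_estimate:
  assumes r: "0 < r" "r \<le> \<rho>"
  shows "\<exists>C>0. \<forall>f z. f holomorphic_on UNIV \<longrightarrow> ennreal ((cmod (f z))\<^sup>2 * gauss z * v z)
       \<le> ennreal C * (\<integral>\<^sup>+\<xi>. ennreal ((cmod (f \<xi>))\<^sup>2 * gauss \<xi>) * indicator (ball z r) \<xi> \<partial>M)"
proof -
  define D where "D = (2 * (16 * 2 ^ N) ^ N :: real)"
  have D: "0 < D" by (simp add: D_def)
  \<comment> \<open>The three losses: the recentred Gaussian over radius \<open>r\<close>, the
    constant of \<open>large_on_small_ball\<close>, and the doubling constant.\<close>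
  define c where "c = exp (- \<alpha> * r\<^sup>2) * (r ^ N / D)\<^sup>2 * \<kappa>"
  have c: "0 < c" using D r \<kappa> by (simp add: c_def)
  have "ennreal ((cmod (f z))\<^sup>2 * gauss z * v z)
    \<le> ennreal (1 / c) * (\<integral>\<^sup>+\<xi>. ennreal ((cmod (f \<xi>))\<^sup>2 * gauss \<xi>) * indicator (ball z r) \<xi> \<partial>M)"
    if f: "f holomorphic_on UNIV" for f z
  proof -
  let ?g = "\<lambda>\<xi>. f \<xi> * exp (- (of_real \<alpha> * cnj z * \<xi>))"
  note [measurable] = entire_measurable_M[OF f]
  have "?g holomorphic_on UNIV" by (intro holomorphic_intros f)
  from large_on_small_ball[OF this r(1) N, of z]
  obtain \<zeta> s where \<zeta>: "dist z \<zeta> < r" and s: "0 < s" "s \<le> r" and sub: "ball \<zeta> s \<subseteq> ball z r"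
    and low: "\<And>\<xi>. \<xi> \<in> ball \<zeta> s \<Longrightarrow> r ^ N * cmod (?g z) / D \<le> cmod (?g \<xi>) * s ^ N"
    unfolding D_def by blast
  define k where "k = (r ^ N * cmod (?g z) / D / s ^ N)\<^sup>2 * exp (- \<alpha> * r\<^sup>2) * exp (\<alpha> * (cmod z)\<^sup>2)"
  have k: "0 \<le> k" by (simp add: k_def)
  have low2: "k \<le> (cmod (f \<xi>))\<^sup>2 * gauss \<xi>" if \<xi>: "\<xi> \<in> ball \<zeta> s" for \<xi>
  proof -
    have "r ^ N * cmod (?g z) / D / s ^ N \<le> cmod (?g \<xi>)"
      unfolding pos_divide_le_eq[OF zero_less_power[OF s(1)]] by (rule low[OF \<xi>])
    then have 1: "(r ^ N * cmod (?g z) / D / s ^ N)\<^sup>2 \<le> (cmod (?g \<xi>))\<^sup>2"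
      using D r s by (intro power_mono) auto
    have "\<xi> \<in> ball z r" using \<xi> sub by blast
    then have "cmod (\<xi> - z) \<le> r" by (simp add: dist_norm norm_minus_commute)
    then have "(cmod (\<xi> - z))\<^sup>2 \<le> r\<^sup>2" by (intro power_mono) auto
    then have 2: "exp (- \<alpha> * r\<^sup>2) \<le> exp (- \<alpha> * (cmod (\<xi> - z))\<^sup>2)" using \<alpha> by simp
    have "k \<le> (cmod (?g \<xi>))\<^sup>2 * exp (- \<alpha> * (cmod (\<xi> - z))\<^sup>2) * exp (\<alpha> * (cmod z)\<^sup>2)"
      unfolding k_def by (intro mult_mono 1 2) auto
    also have "\<dots> = (cmod (f \<xi>))\<^sup>2 * gauss \<xi>"
      unfolding gauss_def by (rule gaussian_recentre[symmetric])
    finally show ?thesis .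
  qed
  have "(cmod (f z))\<^sup>2 * gauss z = (cmod (?g z))\<^sup>2 * exp (\<alpha> * (cmod z)\<^sup>2)"
    unfolding gauss_def gaussian_recentre[of f z \<alpha> z] by simp
  then have eq: "c * ((cmod (f z))\<^sup>2 * gauss z * v z) = k * (\<kappa> * s ^ (2 * N) * v z)"
  proof -
    have "s ^ (2 * N) = (s ^ N)\<^sup>2" by (simp add: power_mult[symmetric] mult.commute)
    then show ?thesis using s D unfolding c_def k_def \<open>(cmod (f z))\<^sup>2 * gauss z = _\<close>
      by (simp add: power_divide power_mult_distrib)
  qed
  have "ennreal (c * ((cmod (f z))\<^sup>2 * gauss z * v z)) = ennreal k * ennreal (\<kappa> * s ^ (2 * N) * v z)"
    unfolding eq using k \<kappa> s v_pos[of z] by (intro ennreal_mult) auto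
  also have "\<dots> \<le> ennreal k * emeasure M (ball \<zeta> s)"
    using \<zeta> s r by (intro mult_left_mono doubling_real) auto
  also have "\<dots> = (\<integral>\<^sup>+\<xi>. ennreal k * indicator (ball \<zeta> s) \<xi> \<partial>M)"
    by (subst nn_integral_cmult_indicator) (auto simp: sets_M)
  also have "\<dots> \<le> (\<integral>\<^sup>+\<xi>. ennreal ((cmod (f \<xi>))\<^sup>2 * gauss \<xi>) * indicator (ball z r) \<xi> \<partial>M)"
    using low2 sub by (intro nn_integral_mono) (auto simp: indicator_def intro: ennreal_leI)
  finally have *: "ennreal (c * ((cmod (f z))\<^sup>2 * gauss z * v z))
     \<le> (\<integral>\<^sup>+\<xi>. ennreal ((cmod (f \<xi>))\<^sup>2 * gauss \<xi>) * indicator (ball z r) \<xi> \<partial>M)" .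
  have "ennreal ((cmod (f z))\<^sup>2 * gauss z * v z) = ennreal (1 / c) * ennreal (c * ((cmod (f z))\<^sup>2 * gauss z * v z))"
    using c by (subst ennreal_mult'[symmetric]) auto
  also have "\<dots> \<le> ennreal (1 / c) * (\<integral>\<^sup>+\<xi>. ennreal ((cmod (f \<xi>))\<^sup>2 * gauss \<xi>) * indicator (ball z r) \<xi> \<partial>M)"
    by (intro mult_left_mono *) auto
  finally show ?thesis .
  qed
  moreover have "0 < 1 / c" using c by simp
  ultimately show ?thesis by blast
qed

section \<open>Mass of large disks and Gaussian integrals\<close>

text \<open>A disk of radius \<open>R + \<rho> / 2\<close> is covered by \<open>card F\<close> disks
  of radius \<open>R\<close> whose centres move by at most \<open>\<rho>\<close>, with
  \<open>F\<close> independent of the disk. Each move costs the factor \<open>A\<close> of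
  \<open>v_near\<close>, hence \<open>B = card F * A\<close> per step.\<close>

lemma ball_growth:
  "\<exists>B>0. \<forall>z n. emeasure M (ball z (\<rho> + real n * \<rho> / 2)) \<le> ennreal (B ^ n * v z)"
proof -
  have "cball 0 \<rho> \<subseteq> (\<Union>e\<in>cball (0::complex) \<rho>. ball e (\<rho>/2))" using \<rho> by (auto intro!: bexI)
  then obtain F where F: "F \<subseteq> cball (0::complex) \<rho>" "finite F" "cball 0 \<rho> \<subseteq> (\<Union>e\<in>F. ball e (\<rho>/2))"
    by (rule compactE_image[OF compact_cball open_ball])
  define B where "B = real (card F) * A"
  have "0 \<in> cball (0::complex) \<rho>" using \<rho> by simp
  then have "F \<noteq> {}" using F(3) by blast
  then have B: "0 < B" using F(2) A_pos by (simp add: B_def card_gt_0_iff)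
  have cover: "ball z (R + \<rho> / 2) \<subseteq> (\<Union>e\<in>F. ball (z + e) R)" if R: "\<rho> \<le> R" for z :: complex and R
  proof
    fix x assume x: "x \<in> ball z (R + \<rho>/2)"
    \<comment> \<open>\<open>x - z\<close> cut back radially to length at most
      \<open>\<rho>\<close>. The rest is shorter than \<open>R - \<rho> / 2\<close>, which leaves
      room for the distance from \<open>d\<close> to a point of the net \<open>F\<close>.\<close>
    define d where "d = (if norm (x - z) < \<rho> then x - z else (\<rho> / norm (x - z)) *\<^sub>R (x - z))"
    have d: "d \<in> cball 0 \<rho>" using \<rho> by (simp add: d_def)
    have "norm (x - z - d) \<le> max 0 (norm (x - z) - \<rho>)"
    proof (cases "norm (x - z) < \<rho>")
      case False
      then have "x - z - d = (1 - \<rho> / norm (x - z)) *\<^sub>R (x - z)" by (simp add: d_def algebra_simps)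
      then have "norm (x - z - d) = \<bar>1 - \<rho> / norm (x - z)\<bar> * norm (x - z)" by (simp only: norm_scaleR)
      moreover have "0 < norm (x - z)" using False \<rho> by linarith
      then have "\<bar>1 - \<rho> / norm (x - z)\<bar> * norm (x - z) = norm (x - z) - \<rho>"
        using False by (simp add: abs_if field_simps)
      ultimately show ?thesis by linarith
    qed (simp add: d_def)
    then have 1: "norm (x - z - d) < R - \<rho>/2" using x R \<rho> by (simp add: dist_norm norm_minus_commute)
    obtain e where e: "e \<in> F" "d \<in> ball e (\<rho>/2)" using F(3) d by blast
    have "norm (x - z - e) \<le> norm (x - z - d) + norm (d - e)"
    proof -
      have "x - z - e = (x - z - d) + (d - e)" by simp
      then show ?thesis using norm_triangle_ineq[of "x - z - d" "d - e"] by (simp only:)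
    qed
    also have "\<dots> < R" using 1 e by (simp add: dist_norm norm_minus_commute)
    finally have "x \<in> ball (z + e) R" by (simp add: dist_norm norm_minus_commute algebra_simps)
    then show "x \<in> (\<Union>e\<in>F. ball (z + e) R)" using e by blast
  qed
  have "emeasure M (ball z (\<rho> + real n * \<rho> / 2)) \<le> ennreal (B ^ n * v z)" for z n
  proof (induction n arbitrary: z)
    case 0
    then show ?case by (simp add: emeasure_ball_v)
  next
    case (Suc n)
    let ?R = "\<rho> + real n * \<rho> / 2"
    have "emeasure M (ball z (\<rho> + real (Suc n) * \<rho> / 2)) = emeasure M (ball z (?R + \<rho> / 2))"
      by (simp add: field_simps)
    also have "\<dots> \<le> emeasure M (\<Union>e\<in>F. ball (z + e) ?R)"
      using \<rho> by (intro emeasure_mono cover) (auto simp: sets_M intro!: borel_open)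
    also have "\<dots> \<le> (\<Sum>e\<in>F. emeasure M (ball (z + e) ?R))"
      using F(2) by (intro emeasure_subadditive_finite) (auto simp: sets_M)
    also have "\<dots> \<le> (\<Sum>e\<in>F. ennreal (B ^ n * (A * v z)))"
    proof (rule sum_mono)
      fix e assume "e \<in> F"
      then have "v (z + e) \<le> A * v z" using F(1) by (intro v_near) (auto simp: dist_norm)
      then have "B ^ n * v (z + e) \<le> B ^ n * (A * v z)" using B by (intro mult_left_mono) auto
      then show "emeasure M (ball (z + e) ?R) \<le> ennreal (B ^ n * (A * v z))"
        using Suc.IH[of "z + e"] ennreal_leI order_trans by blast
    qed
    also have "\<dots> = ennreal (B ^ Suc n * v z)"
    proof -
      have "0 \<le> B ^ n * (A * v z)" using B A_pos v_pos[of z] by simp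
      then show ?thesis by (simp add: ennreal_of_nat_eq_real_of_nat ennreal_mult[symmetric] B_def mult_ac)
    qed
    finally show ?case .
  qed
  with B show ?thesis by blast
qed

lemma exists_nat_radius: "\<exists>n. R < \<rho> + real n * \<rho> / 2"
proof -
  obtain n where "2 * R / \<rho> < real n" using reals_Archimedean2 by blast
  then have "R < real n * \<rho> / 2" using \<rho> by (simp add: field_simps)
  then show ?thesis using \<rho> by (intro exI[of _ n]) linarith
qed

lemma emeasure_ball_finite: "emeasure M (ball z R) < \<infinity>"
proof -
  obtain B where B: "0 < B" "\<And>z n. emeasure M (ball z (\<rho> + real n * \<rho> / 2)) \<le> ennreal (B ^ n * v z)"
    using ball_growth by blast
  obtain n where "R < \<rho> + real n * \<rho> / 2" using exists_nat_radius by blast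
  then have "emeasure M (ball z R) \<le> emeasure M (ball z (\<rho> + real n * \<rho> / 2))"
    by (intro emeasure_mono) (auto simp: sets_M)
  also note B(2)
  finally show ?thesis by (simp add: le_less_trans[OF _ ennreal_less_top])
qed

text \<open>\<open>ball_growth\<close> read at the centre \<open>u\<close>: a disk about
  \<open>u\<close> of radius independent of \<open>u\<close> contains
  \<open>ball 0 \<rho>\<close>.\<close>

lemma v_lower_bound:
  "\<exists>c>0. \<forall>u\<in>cball 0 R. c \<le> v u"
proof -
  obtain B where B: "0 < B" "\<And>z n. emeasure M (ball z (\<rho> + real n * \<rho> / 2)) \<le> ennreal (B ^ n * v z)"
    using ball_growth by blast
  obtain n where n: "R + \<rho> < \<rho> + real n * \<rho> / 2" using exists_nat_radius by blast
  have "v 0 / B ^ n \<le> v u" if u: "u \<in> cball 0 R" for u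
  proof -
    have "ball 0 \<rho> \<subseteq> ball u (\<rho> + real n * \<rho> / 2)"
    proof
      fix y assume "y \<in> ball (0::complex) \<rho>"
      then show "y \<in> ball u (\<rho> + real n * \<rho> / 2)" using u n dist_triangle[of u y 0] by (simp add: dist_commute)
    qed
    then have "emeasure M (ball 0 \<rho>) \<le> emeasure M (ball u (\<rho> + real n * \<rho> / 2))"
      by (intro emeasure_mono) (auto simp: sets_M)
    also note B(2)
    finally have "v 0 \<le> B ^ n * v u" using B(1) v_pos[of u] by (simp add: emeasure_ball_v ennreal_le_iff)
    then show ?thesis using B(1) by (simp add: field_simps)
  qed
  moreover have "0 < v 0 / B ^ n" using B(1) v_pos[of 0] by simp
  ultimately show ?thesis by blast
qed

text \<open>The plane is cut into rings of width \<open>\<rho> / 2\<close> about \<open>z\<close>;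
  the \<open>n\<close>-th one contributes at most
  \<open>exp (- a * n\<^sup>2) * B ^ n * v z\<close>, and quadratic decay beats exponential
  growth.\<close>

lemma gaussian_integral:
  "\<exists>G>0. \<forall>z. (\<integral>\<^sup>+\<xi>. ennreal (exp (- \<alpha> * (cmod (\<xi> - z))\<^sup>2)) \<partial>M) \<le> ennreal (G * v z)"
proof -
  obtain B where B: "0 < B" "\<And>z n. emeasure M (ball z (\<rho> + real n * \<rho> / 2)) \<le> ennreal (B ^ n * v z)"
    using ball_growth by blast
  define a where "a = \<alpha> * \<rho>\<^sup>2 / 4"
  have a: "0 < a" using \<alpha> \<rho> by (simp add: a_def)
  \<comment> \<open>Once \<open>a * n\<close> exceeds \<open>ln (2 * B)\<close>, the Gaussian factor
    outweighs \<open>(2 * B) ^ n\<close>, and the terms lie below those of a geometric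
    series.\<close>
  have summ: "summable (\<lambda>n. exp (- a * (real n)\<^sup>2) * B ^ n)"
  proof (rule summable_comparison_test_ev)
    have "\<forall>\<^sub>F n in sequentially. ln (2 * B) / a \<le> real n"
      using filterlim_real_sequentially by (simp add: filterlim_at_top)
    then show "\<forall>\<^sub>F n in sequentially. norm (exp (- a * (real n)\<^sup>2) * B ^ n) \<le> (1/2) ^ n"
    proof eventually_elim
      case (elim n)
      have "exp (- a * (real n)\<^sup>2) * (2 * B) ^ n = exp (real n * (ln (2 * B) - a * real n))"
        using B(1) by (simp add: power2_eq_square algebra_simps exp_diff exp_minus exp_of_nat_mult field_simps)
      also have "\<dots> \<le> 1"
      proof -
        have "ln (2 * B) \<le> a * real n" using elim a by (simp add: field_simps)
        then have "real n * (ln (2 * B) - a * real n) \<le> 0" by (intro mult_nonneg_nonpos) auto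
        then show ?thesis by simp
      qed
      finally have "exp (- a * (real n)\<^sup>2) * B ^ n * 2 ^ n \<le> 1" by (simp add: power_mult_distrib mult_ac)
      then show ?case using B(1) by (simp add: power_one_over field_simps)
    qed
    show "summable (\<lambda>n. (1/2 :: real) ^ n)" by (simp add: summable_geometric)
  qed
  define G where "G = (\<Sum>n. exp (- a * (real n)\<^sup>2) * B ^ n)"
  have G: "0 < G" unfolding G_def using B(1) by (intro suminf_pos summ) simp
  have "(\<integral>\<^sup>+\<xi>. ennreal (exp (- \<alpha> * (cmod (\<xi> - z))\<^sup>2)) \<partial>M) \<le> ennreal (G * v z)" for z
  proof -
    let ?u = "\<lambda>n \<xi>. ennreal (exp (- a * (real n)\<^sup>2)) * indicator (ball z (\<rho> + real n * \<rho> / 2)) \<xi>"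
    have "(\<integral>\<^sup>+\<xi>. ennreal (exp (- \<alpha> * (cmod (\<xi> - z))\<^sup>2)) \<partial>M) \<le> (\<integral>\<^sup>+\<xi>. (\<Sum>n. ?u n \<xi>) \<partial>M)"
    proof (rule nn_integral_mono)
      fix \<xi>
      define n where "n = nat \<lfloor>2 * cmod (\<xi> - z) / \<rho>\<rfloor>"
      have n: "real n \<le> 2 * cmod (\<xi> - z) / \<rho>" "2 * cmod (\<xi> - z) / \<rho> < real n + 1"
        using \<rho> by (simp_all add: n_def)
      then have n1: "real n * \<rho> / 2 \<le> cmod (\<xi> - z)" and n2: "cmod (\<xi> - z) < \<rho> + real n * \<rho> / 2"
        using \<rho> by (simp_all add: field_simps)
      have "(real n * \<rho> / 2)\<^sup>2 \<le> (cmod (\<xi> - z))\<^sup>2" using n1 \<rho> by (intro power_mono) auto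
      then have "a * (real n)\<^sup>2 \<le> \<alpha> * (cmod (\<xi> - z))\<^sup>2"
        using \<alpha> by (simp add: a_def power_mult_distrib power_divide field_simps)
      then have "ennreal (exp (- \<alpha> * (cmod (\<xi> - z))\<^sup>2)) \<le> ?u n \<xi>"
        using n2 by (auto simp: dist_norm norm_minus_commute intro!: ennreal_leI)
      also have "\<dots> \<le> (\<Sum>n. ?u n \<xi>)"
      proof -
        have *: "U n \<le> suminf U" for U :: "nat \<Rightarrow> ennreal"
          using sum_le_suminf[of U "{n}"] by simp
        show ?thesis by (rule *)
      qed
      finally show "ennreal (exp (- \<alpha> * (cmod (\<xi> - z))\<^sup>2)) \<le> (\<Sum>n. ?u n \<xi>)" .
    qed
    also have "\<dots> = (\<Sum>n. \<integral>\<^sup>+\<xi>. ?u n \<xi> \<partial>M)"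
      by (intro nn_integral_suminf) simp
    also have "\<dots> = (\<Sum>n. ennreal (exp (- a * (real n)\<^sup>2)) * emeasure M (ball z (\<rho> + real n * \<rho> / 2)))"
      by (intro suminf_cong nn_integral_cmult_indicator) (simp add: sets_M)
    also have "\<dots> \<le> (\<Sum>n. ennreal (exp (- a * (real n)\<^sup>2)) * ennreal (B ^ n * v z))"
      by (intro suminf_le mult_left_mono B(2)) auto
    also have "\<dots> = (\<Sum>n. ennreal (exp (- a * (real n)\<^sup>2) * B ^ n * v z))"
      using B(1) v_pos[of z] by (simp add: ennreal_mult[symmetric] mult_ac)
    also have "\<dots> = ennreal (\<Sum>n. exp (- a * (real n)\<^sup>2) * B ^ n * v z)"
      using B(1) v_pos[of z] by (intro suminf_ennreal2 summable_mult2 summ) auto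
    also have "\<dots> = ennreal (G * v z)"
      unfolding G_def using suminf_mult2[OF summ, of "v z"] by simp
    finally show ?thesis .
  qed
  with G show ?thesis by blast
qed

section \<open>The measure of the Fock norm and its point evaluations\<close>

definition P :: "complex measure" where "P = density M (\<lambda>z. ennreal (gauss z))"

lemma P_sets: "sets P = sets borel"
  by (simp add: P_def sets_M)

lemma nn_integral_P:
  assumes "g \<in> borel_measurable borel" "\<And>z. 0 \<le> g z"
  shows "(\<integral>\<^sup>+z. ennreal (g z) \<partial>P) = (\<integral>\<^sup>+z. ennreal (g z * gauss z) \<partial>M)"
proof -
  have [measurable]: "g \<in> borel_measurable M" using assms(1) sets_M measurable_cong_sets by blast
  have [measurable]: "gauss \<in> borel_measurable M"
    using gauss_measurable sets_M measurable_cong_sets by blast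
  show ?thesis unfolding P_def
    by (subst nn_integral_density)
      (auto simp: ennreal_mult[symmetric] assms(2) gauss_pos less_imp_le mult.commute)
qed

text \<open>The indicator is kept for \<open>normalized_kernel_weakly_null\<close>, where the disk
  escapes to infinity and its share of the norm tends to 0.\<close>

lemma local_estimate:
  assumes r: "0 < r" "r \<le> \<rho>"
  shows "\<exists>C>0. \<forall>f z. f \<in> holL2 P \<longrightarrow>
    (cmod (f z))\<^sup>2 * gauss z * v z \<le> C * (LINT \<xi>|P. (cmod (f \<xi>))\<^sup>2 * indicator (ball z r) \<xi>)"
proof -
  obtain C where C: "0 < C" and est: "\<And>f z. f holomorphic_on UNIV \<Longrightarrow> ennreal ((cmod (f z))\<^sup>2 * gauss z * v z)
       \<le> ennreal C * (\<integral>\<^sup>+\<xi>. ennreal ((cmod (f \<xi>))\<^sup>2 * gauss \<xi>) * indicator (ball z r) \<xi> \<partial>M)"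
    using pointwise_estimate[OF r] by blast
  have "(cmod (f z))\<^sup>2 * gauss z * v z \<le> C * (LINT \<xi>|P. (cmod (f \<xi>))\<^sup>2 * indicator (ball z r) \<xi>)"
    if f: "f \<in> holL2 P" for f z
  proof -
    have hol: "f holomorphic_on UNIV" and int: "integrable P (\<lambda>\<xi>. (cmod (f \<xi>))\<^sup>2)"
      using f by (simp_all add: holL2_def)
    note [measurable] = entire_borel[OF hol]
    have int2: "integrable P (\<lambda>\<xi>. (cmod (f \<xi>))\<^sup>2 * indicator (ball z r) \<xi>)"
      using int by (intro integrable_real_mult_indicator) (simp_all add: P_sets)
    let ?I = "LINT \<xi>|P. (cmod (f \<xi>))\<^sup>2 * indicator (ball z r) \<xi>"
    have "(\<integral>\<^sup>+\<xi>. ennreal ((cmod (f \<xi>))\<^sup>2 * gauss \<xi>) * indicator (ball z r) \<xi> \<partial>M)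
        = (\<integral>\<^sup>+\<xi>. ennreal ((cmod (f \<xi>))\<^sup>2 * indicator (ball z r) \<xi> * gauss \<xi>) \<partial>M)"
      by (intro nn_integral_cong) (auto simp: indicator_def)
    also have "\<dots> = (\<integral>\<^sup>+\<xi>. ennreal ((cmod (f \<xi>))\<^sup>2 * indicator (ball z r) \<xi>) \<partial>P)"
      by (subst nn_integral_P) auto
    also have "\<dots> = ennreal ?I"
      by (rule nn_integral_eq_integral[OF int2]) simp
    finally have "ennreal ((cmod (f z))\<^sup>2 * gauss z * v z) \<le> ennreal (C * ?I)"
      using est[OF hol, of z] C by (simp add: ennreal_mult')
    moreover have "0 \<le> ?I" by simp
    ultimately show ?thesis using C by (subst (asm) ennreal_le_iff) simp_all
  qed
  with C show ?thesis by blast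
qed

lemma integral_indicator_le_nrm2:
  assumes "f \<in> holL2 P"
  shows "(LINT \<xi>|P. (cmod (f \<xi>))\<^sup>2 * indicator (ball z r) \<xi>) \<le> nrm2 P f"
  unfolding nrm2_def
proof (rule integral_mono)
  show "integrable P (\<lambda>\<xi>. (cmod (f \<xi>))\<^sup>2 * indicator (ball z r) \<xi>)"
    using assms unfolding holL2_def by (intro integrable_real_mult_indicator) (simp_all add: P_sets)
qed (use assms in \<open>auto simp: holL2_def indicator_def\<close>)

lemma eval_estimate: "\<exists>C>0. \<forall>f z. f \<in> holL2 P \<longrightarrow> (cmod (f z))\<^sup>2 * gauss z * v z \<le> C * nrm2 P f"
proof -
  obtain C where C: "0 < C" and est: "\<And>f z. f \<in> holL2 P \<Longrightarrow>
    (cmod (f z))\<^sup>2 * gauss z * v z \<le> C * (LINT \<xi>|P. (cmod (f \<xi>))\<^sup>2 * indicator (ball z \<rho>) \<xi>)"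
    using local_estimate[OF \<rho> order_refl] by blast
  have "(cmod (f z))\<^sup>2 * gauss z * v z \<le> C * nrm2 P f" if "f \<in> holL2 P" for f z
    using est[OF that, of z] mult_left_mono[OF integral_indicator_le_nrm2[OF that, of z \<rho>], of C] C by linarith
  with C show ?thesis by blast
qed

end

text \<open>On \<open>cball 0 R\<close> both \<open>gauss\<close> and \<open>v\<close> have positive
  lower bounds, so \<open>eval_estimate\<close> becomes a uniform evaluation bound.\<close>

sublocale doubling_fock \<subseteq> bergman_space P
proof
  show "sets P = sets borel" by (rule P_sets)
  fix R :: real
  obtain C where C: "0 < C" and est: "\<And>f z. f \<in> holL2 P \<Longrightarrow> (cmod (f z))\<^sup>2 * gauss z * v z \<le> C * nrm2 P f"
    using eval_estimate by blast
  obtain c where c: "0 < c" "\<And>u. u \<in> cball 0 R \<Longrightarrow> c \<le> v u"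
    using v_lower_bound[of R] by blast
  define d where "d = exp (- \<alpha> * R\<^sup>2) * c"
  have d: "0 < d" using c by (simp add: d_def)
  have "(cmod (f z))\<^sup>2 \<le> C / d * nrm2 P f" if f: "f \<in> holL2 P" and z: "z \<in> cball 0 R" for f z
  proof -
    have "(cmod z)\<^sup>2 \<le> R\<^sup>2" using z by (intro power_mono) auto
    then have "exp (- \<alpha> * R\<^sup>2) \<le> gauss z" using \<alpha> by (simp add: gauss_def)
    then have "d \<le> gauss z * v z" unfolding d_def using c z by (intro mult_mono) (auto simp: gauss_pos less_imp_le)
    then have "(cmod (f z))\<^sup>2 * d \<le> (cmod (f z))\<^sup>2 * (gauss z * v z)" by (intro mult_left_mono) auto
    also have "\<dots> \<le> C * nrm2 P f" using est[OF f, of z] by (simp add: mult.assoc)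
    finally show ?thesis using d by (simp add: field_simps)
  qed
  then show "\<exists>C. \<forall>f\<in>holL2 P. \<forall>z\<in>cball 0 R. (cmod (f z))\<^sup>2 \<le> C * nrm2 P f" by blast
qed

context doubling_fock
begin

section \<open>Size of the reproducing kernel\<close>

abbreviation K :: "complex \<Rightarrow> real" where "K z \<equiv> nrm2 P (kern z)"

lemma norm_kern_diag: "cmod (kern z z) = K z"
  unfolding kern_diag using nrm2_nonneg[of P "kern z"] by (simp add: norm_of_real)

text \<open>The evaluation estimate for \<open>kern z\<close> at \<open>z\<close> is quadratic in
  \<open>K z\<close> on the left and linear on the right, since
  \<open>kern z z = K z\<close>.\<close>

lemma kern_upper: "\<exists>C>0. \<forall>z. K z * v z * gauss z \<le> C"
proof -
  obtain C where C: "0 < C" and est: "\<And>f z. f \<in> holL2 P \<Longrightarrow> (cmod (f z))\<^sup>2 * gauss z * v z \<le> C * nrm2 P f"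
    using eval_estimate by blast
  have "K z * v z * gauss z \<le> C" for z
  proof (cases "K z = 0")
    case True
    then show ?thesis using C by simp
  next
    case False
    then have "0 < K z" using nrm2_nonneg[of P "kern z"] by linarith
    moreover have "K z * (K z * v z * gauss z) \<le> K z * C"
      using est[OF kern_holL2, of z z] unfolding norm_kern_diag by (simp add: power2_eq_square mult_ac)
    ultimately show ?thesis by (simp add: mult_le_cancel_left)
  qed
  with C show ?thesis by blast
qed

text \<open>\<open>K z\<close> is at least the squared value at \<open>z\<close> over the squared
  norm of any test function. The test function \<open>k\<close> is, up to a constant factor, the
  kernel at \<open>z\<close> of the unweighted Fock space, and \<open>gaussian_integral\<close>
  bounds its norm.\<close>

lemma kern_lower: "\<exists>c>0. \<forall>z. c \<le> K z * v z * gauss z"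
proof -
  obtain G where G: "0 < G"
    and int: "\<And>z. (\<integral>\<^sup>+\<xi>. ennreal (exp (- \<alpha> * (cmod (\<xi> - z))\<^sup>2)) \<partial>M) \<le> ennreal (G * v z)"
    using gaussian_integral by blast
  have "1 / G \<le> K z * v z * gauss z" for z
  proof -
    define k where "k \<xi> = exp (of_real \<alpha> * cnj z * \<xi>)" for \<xi>
    have hol: "k holomorphic_on UNIV" unfolding k_def by (intro holomorphic_intros)
    note [measurable] = entire_borel[OF hol]
    have k2: "(cmod (k \<xi>))\<^sup>2 = exp (2 * \<alpha> * Re (cnj z * \<xi>))" for \<xi>
      unfolding k_def norm_exp_eq_Re power2_eq_square exp_add[symmetric] by (simp add: algebra_simps)
    have eq: "(cmod (k \<xi>))\<^sup>2 * gauss \<xi> = exp (- \<alpha> * (cmod (\<xi> - z))\<^sup>2) / gauss z" for \<xi>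
      unfolding k2 gauss_def gaussian_translate[of \<xi> z] exp_add[symmetric] exp_diff[symmetric]
      by (simp add: algebra_simps)
    have "(\<integral>\<^sup>+\<xi>. ennreal ((cmod (k \<xi>))\<^sup>2) \<partial>P)
        = (\<integral>\<^sup>+\<xi>. ennreal (1 / gauss z) * ennreal (exp (- \<alpha> * (cmod (\<xi> - z))\<^sup>2)) \<partial>M)"
      by (subst nn_integral_P) (simp_all add: eq ennreal_mult'[symmetric] less_imp_le gauss_pos)
    also have "\<dots> = ennreal (1 / gauss z) * (\<integral>\<^sup>+\<xi>. ennreal (exp (- \<alpha> * (cmod (\<xi> - z))\<^sup>2)) \<partial>M)"
      by (rule nn_integral_cmult) simp
    also have "\<dots> \<le> ennreal (1 / gauss z) * ennreal (G * v z)"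
      by (intro mult_left_mono int) simp
    also have "\<dots> = ennreal (G * v z / gauss z)"
      using gauss_pos[of z] by (simp add: ennreal_mult'[symmetric])
    finally have *: "(\<integral>\<^sup>+\<xi>. ennreal ((cmod (k \<xi>))\<^sup>2) \<partial>P) \<le> ennreal (G * v z / gauss z)" .
    have [measurable]: "k \<in> borel_measurable P" using entire_borel_measurable[OF hol P_sets] .
    have ik: "integrable P (\<lambda>\<xi>. (cmod (k \<xi>))\<^sup>2)"
      using * by (intro integrableI_bounded) (simp_all add: le_less_trans[OF _ ennreal_less_top])
    then have kL: "k \<in> holL2 P" using hol by (simp add: holL2_def)
    have "ennreal (nrm2 P k) \<le> ennreal (G * v z / gauss z)"
      using * unfolding nrm2_def by (subst nn_integral_eq_integral[OF ik, symmetric]) simp_all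
    then have "nrm2 P k \<le> G * v z / gauss z"
      using G v_pos[of z] gauss_pos[of z] by (subst (asm) ennreal_le_iff) simp_all
    then have "nrm2 P k * K z \<le> G * v z / gauss z * K z" by (intro mult_right_mono nrm2_nonneg)
    moreover have "(cmod (k z))\<^sup>2 \<le> nrm2 P k * K z" by (rule eval_le_kern[OF kL])
    moreover have "(cmod (k z))\<^sup>2 = 1 / gauss z / gauss z"
      using eq[of z] gauss_pos[of z] by (simp add: field_simps)
    ultimately have "1 / gauss z / gauss z \<le> G * v z / gauss z * K z" by linarith
    then show ?thesis using G gauss_pos[of z] by (simp add: field_simps)
  qed
  moreover have "0 < 1 / G" using G by simp
  ultimately show ?thesis by blast
qed

lemma K_pos: "0 < K z"
proof -
  obtain c where "0 < c" "c \<le> K z * v z * gauss z" using kern_lower by blast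
  then have "K z \<noteq> 0" by auto
  then show ?thesis using nrm2_nonneg[of P "kern z"] by linarith
qed

text \<open>The recentred kernel \<open>g\<close> is bounded by \<open>sqrt (D * S)\<close> on
  \<open>ball z \<rho>\<close> and is at least \<open>sqrt (c * S)\<close> at \<open>z\<close>, with
  the same \<open>S\<close>. Its Lipschitz constant is therefore comparable to its central value,
  uniformly in \<open>z\<close>.\<close>

lemma kern_off_diagonal:
  "\<exists>\<delta>>0. \<exists>c>0. \<forall>z \<xi>. dist z \<xi> < \<delta> \<longrightarrow> c * K z \<le> (cmod (kern z \<xi>))\<^sup>2 * gauss \<xi> * v z"
proof -
  obtain C where C: "0 < C" and up: "\<And>z. K z * v z * gauss z \<le> C" using kern_upper by blast
  obtain c where c: "0 < c" and lo: "\<And>z. c \<le> K z * v z * gauss z" using kern_lower by blast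
  define D where "D = C * A * exp (\<alpha> * \<rho>\<^sup>2)"
  have D: "0 < D" using C A_pos by (simp add: D_def)
  \<comment> \<open>\<open>\<rho> / 2\<close> is the range of \<open>holomorphic_lipschitz\<close>;
    within the second radius \<open>g\<close> varies by at most half of
    \<open>sqrt (c * S)\<close>.\<close>
  define \<delta> where "\<delta> = min (\<rho> / 2) (\<rho> * sqrt (c / D) / 8)"
  have \<delta>: "0 < \<delta>" using \<rho> c D by (simp add: \<delta>_def)
  define c' where "c' = c / 4 * exp (- \<alpha> * \<rho>\<^sup>2)"
  have c': "0 < c'" using c by (simp add: c'_def)
  have "c' * K z \<le> (cmod (kern z \<xi>))\<^sup>2 * gauss \<xi> * v z" if \<xi>: "dist z \<xi> < \<delta>" for z \<xi>
  proof -
    define g where "g \<xi> = kern z \<xi> * exp (- (of_real \<alpha> * cnj z * \<xi>))" for \<xi>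
    define S where "S = K z * gauss z / v z"
    have S: "0 < S" using K_pos gauss_pos v_pos by (simp add: S_def)
    have hol: "kern z holomorphic_on UNIV" using kern_holL2[of z] by (simp add: holL2_def)
    have rec: "(cmod (kern z u))\<^sup>2 * gauss u
        = (cmod (g u))\<^sup>2 * exp (- \<alpha> * (cmod (u - z))\<^sup>2) / gauss z" for u
      using gaussian_recentre[of "kern z" u \<alpha> z] unfolding gauss_def g_def
      by (simp add: exp_minus field_simps)
    have gu: "cmod (g u) \<le> sqrt (D * S)" if u: "u \<in> ball z \<rho>" for u
    proof (rule real_le_rsqrt)
      have "cmod (u - z) \<le> \<rho>" using u by (simp add: dist_norm norm_minus_commute)
      then have "(cmod (u - z))\<^sup>2 \<le> \<rho>\<^sup>2" by (intro power_mono) auto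
      then have e: "exp (\<alpha> * (cmod (u - z))\<^sup>2) \<le> exp (\<alpha> * \<rho>\<^sup>2)" using \<alpha> by simp
      have "v z \<le> A * v u" using u by (intro v_near) simp
      then have "K u * gauss u * v z \<le> K u * gauss u * (A * v u)"
        using K_pos[of u] gauss_pos[of u] by (intro mult_left_mono) auto
      also have "\<dots> \<le> C * A" using mult_left_mono[OF up[of u], of A] A_pos by (simp add: mult_ac)
      finally have ku: "K u * gauss u \<le> C * A / v z" using v_pos[of z] by (simp add: field_simps)
      have "(cmod (kern z u))\<^sup>2 \<le> K z * K u" by (rule eval_le_kern[OF kern_holL2])
      then have "(cmod (kern z u))\<^sup>2 * gauss u \<le> K z * K u * gauss u"
        using gauss_pos[of u] by (intro mult_right_mono) auto
      also have "\<dots> \<le> K z * (C * A / v z)"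
        using mult_left_mono[OF ku, of "K z"] K_pos[of z] by (simp add: mult_ac)
      finally have le: "(cmod (kern z u))\<^sup>2 * gauss u \<le> K z * (C * A / v z)" .
      have "(cmod (g u))\<^sup>2 = (cmod (kern z u))\<^sup>2 * gauss u * gauss z * exp (\<alpha> * (cmod (u - z))\<^sup>2)"
        unfolding rec using gauss_pos[of z] by (simp add: exp_minus field_simps)
      also have "\<dots> \<le> K z * (C * A / v z) * gauss z * exp (\<alpha> * \<rho>\<^sup>2)"
        using K_pos[of z] C A_pos v_pos[of z] gauss_pos[of z] gauss_pos[of u]
        by (intro mult_mono le e) auto
      also have "\<dots> = D * S" by (simp add: D_def S_def mult_ac)
      finally show "(cmod (g u))\<^sup>2 \<le> D * S" .
    qed
    have gz: "sqrt (c * S) \<le> cmod (g z)"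
    proof (rule real_le_lsqrt)
      have "(cmod (g z))\<^sup>2 = (K z)\<^sup>2 * gauss z * gauss z"
        using rec[of z] gauss_pos[of z] by (simp add: norm_kern_diag)
      also have "\<dots> = S * (K z * v z * gauss z)"
        using v_pos[of z] by (simp add: S_def power2_eq_square)
      finally show "c * S \<le> (cmod (g z))\<^sup>2" using mult_left_mono[OF lo[of z], of S] S by (simp add: mult_ac)
    qed simp
    have "cmod (g \<xi> - g z) \<le> 4 * sqrt (D * S) / \<rho> * cmod (\<xi> - z)"
    proof (rule holomorphic_lipschitz)
      have "g holomorphic_on UNIV" unfolding g_def by (intro holomorphic_intros hol)
      then show "g holomorphic_on ball z \<rho>" by (rule holomorphic_on_subset) simp
      show "dist z \<xi> \<le> \<rho> / 2" using \<xi> by (simp add: \<delta>_def)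
    qed (use \<rho> gu in auto)
    also have "\<dots> \<le> 4 * sqrt (D * S) / \<rho> * (\<rho> * sqrt (c / D) / 8)"
      using \<xi> \<rho> D S by (intro mult_left_mono) (auto simp: \<delta>_def dist_norm norm_minus_commute)
    also have "\<dots> = sqrt (c * S) / 2"
      using \<rho> D by (simp add: real_sqrt_mult real_sqrt_divide)
    finally have "sqrt (c * S) / 2 \<le> cmod (g \<xi>)"
      using gz norm_triangle_ineq2[of "g z" "g \<xi>"] by (simp add: norm_minus_commute)
    then have "(sqrt (c * S) / 2)\<^sup>2 \<le> (cmod (g \<xi>))\<^sup>2" using c S by (intro power_mono) auto
    then have g1: "c * S / 4 \<le> (cmod (g \<xi>))\<^sup>2" using c S by (simp add: power_divide)
    have "cmod (\<xi> - z) \<le> \<rho>" using \<xi> \<rho> by (simp add: \<delta>_def dist_norm norm_minus_commute)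
    then have "(cmod (\<xi> - z))\<^sup>2 \<le> \<rho>\<^sup>2" by (intro power_mono) auto
    then have e: "exp (- \<alpha> * \<rho>\<^sup>2) \<le> exp (- \<alpha> * (cmod (\<xi> - z))\<^sup>2)" using \<alpha> by simp
    have "c * S / 4 * exp (- \<alpha> * \<rho>\<^sup>2) \<le> (cmod (g \<xi>))\<^sup>2 * exp (- \<alpha> * (cmod (\<xi> - z))\<^sup>2)"
      by (intro mult_mono g1 e) auto
    also have "\<dots> = (cmod (kern z \<xi>))\<^sup>2 * gauss \<xi> * gauss z"
      unfolding rec using gauss_pos[of z] by simp
    finally have "c * S / 4 * exp (- \<alpha> * \<rho>\<^sup>2) \<le> (cmod (kern z \<xi>))\<^sup>2 * gauss \<xi> * gauss z" .
    moreover have "c * S / 4 * exp (- \<alpha> * \<rho>\<^sup>2) = c' * K z / v z * gauss z"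
      by (simp add: S_def c'_def mult_ac)
    ultimately have "c' * K z / v z * gauss z \<le> (cmod (kern z \<xi>))\<^sup>2 * gauss \<xi> * gauss z"
      by (simp only:)
    then have "c' * K z / v z \<le> (cmod (kern z \<xi>))\<^sup>2 * gauss \<xi>"
      by (rule mult_right_le_imp_le[OF _ gauss_pos])
    then show ?thesis using v_pos[of z] by (simp add: field_simps)
  qed
  with \<delta> c' show ?thesis by blast
qed

text \<open>The quotient is the squared modulus of the pairing of \<open>g\<close> with the
  normalized kernel at \<open>s n\<close>. By \<open>local_estimate\<close> and
  \<open>kern_lower\<close> it is at most a constant times the part of the norm of \<open>g\<close>
  over \<open>ball (s n) \<rho>\<close>, which vanishes by dominated convergence.\<close>

lemma normalized_kernel_weakly_null:
  assumes g: "g \<in> holL2 P" and s: "filterlim s at_infinity sequentially"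
  shows "(\<lambda>n. (cmod (g (s n)))\<^sup>2 / K (s n)) \<longlonglongrightarrow> 0"
proof -
  obtain C where C: "0 < C" and est: "\<And>f z. f \<in> holL2 P \<Longrightarrow>
    (cmod (f z))\<^sup>2 * gauss z * v z \<le> C * (LINT \<xi>|P. (cmod (f \<xi>))\<^sup>2 * indicator (ball z \<rho>) \<xi>)"
    using local_estimate[OF \<rho> order_refl] by blast
  obtain c where c: "0 < c" and lo: "\<And>z. c \<le> K z * v z * gauss z" using kern_lower by blast
  let ?I = "\<lambda>z. LINT \<xi>|P. (cmod (g \<xi>))\<^sup>2 * indicator (ball z \<rho>) \<xi>"
  have le: "(cmod (g z))\<^sup>2 / K z \<le> C / c * ?I z" for z
  proof -
    have "c * (cmod (g z))\<^sup>2 \<le> K z * v z * gauss z * (cmod (g z))\<^sup>2"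
      by (intro mult_right_mono lo) simp
    also have "\<dots> = K z * ((cmod (g z))\<^sup>2 * gauss z * v z)" by (simp add: mult_ac)
    also have "\<dots> \<le> K z * (C * ?I z)" by (intro mult_left_mono est g nrm2_nonneg)
    finally show ?thesis using c K_pos[of z] by (simp add: field_simps)
  qed
  have gm[measurable]: "g \<in> borel_measurable P" by (rule measurable_holL2[OF g])
  have [measurable]: "ball z r \<in> sets P" for z r by (simp add: P_sets)
  have "(\<lambda>n. ?I (s n)) \<longlonglongrightarrow> (LINT \<xi>|P. 0)"
  proof (rule integral_dominated_convergence[where w = "\<lambda>\<xi>. (cmod (g \<xi>))\<^sup>2"])
    show "integrable P (\<lambda>\<xi>. (cmod (g \<xi>))\<^sup>2)" using g by (simp add: holL2_def)
    show "AE \<xi> in P. (\<lambda>n. (cmod (g \<xi>))\<^sup>2 * indicator (ball (s n) \<rho>) \<xi>) \<longlonglongrightarrow> 0"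
    proof (rule AE_I2)
      fix \<xi>
      have "\<forall>\<^sub>F n in sequentially. cmod \<xi> + \<rho> \<le> cmod (s n)"
        using s unfolding filterlim_at_infinity_conv_norm_at_top filterlim_at_top by blast
      then have "\<forall>\<^sub>F n in sequentially. (cmod (g \<xi>))\<^sup>2 * indicator (ball (s n) \<rho>) \<xi> = (0::real)"
      proof eventually_elim
        case (elim n)
        then have "\<rho> \<le> cmod (s n - \<xi>)" using norm_triangle_ineq2[of "s n" \<xi>] by linarith
        then show ?case by (simp add: dist_norm)
      qed
      then show "(\<lambda>n. (cmod (g \<xi>))\<^sup>2 * indicator (ball (s n) \<rho>) \<xi>) \<longlonglongrightarrow> (0::real)"
        by (rule tendsto_eventually)
    qed
    show "AE \<xi> in P. norm ((cmod (g \<xi>))\<^sup>2 * indicator (ball (s n) \<rho>) \<xi>) \<le> (cmod (g \<xi>))\<^sup>2" for n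
      by (simp add: indicator_def)
  qed simp_all
  then have lim: "(\<lambda>n. C / c * ?I (s n)) \<longlonglongrightarrow> 0"
    using tendsto_mult_left[of "\<lambda>n. ?I (s n)" 0 sequentially "C / c"] by simp
  show ?thesis
  proof (rule tendsto_sandwich[OF _ _ tendsto_const lim])
    show "\<forall>\<^sub>F n in sequentially. 0 \<le> (cmod (g (s n)))\<^sup>2 / K (s n)"
      by (intro always_eventually allI divide_nonneg_nonneg nrm2_nonneg) simp
  qed (intro always_eventually allI le)
qed

section \<open>Carleson embedding\<close>

lemma sigma_finite_M: "sigma_finite_measure M"
  by (rule sigma_finite_borel[OF sets_M emeasure_ball_finite])

text \<open>\<open>v x\<close> is the measure of a section of the set of pairs at distance below
  \<open>\<rho>\<close>. Fubini's theorem in \<open>carleson_embedding\<close> divides by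
  \<open>v\<close>.\<close>

lemma v_measurable[measurable]: "v \<in> borel_measurable borel"
proof -
  interpret M: sigma_finite_measure M by (rule sigma_finite_M)
  let ?Q = "{x \<in> space (borel \<Otimes>\<^sub>M M). dist (fst x) (snd x) < \<rho>}"
  have "(\<lambda>x. emeasure M (Pair x -` ?Q)) \<in> borel_measurable borel"
    by (rule M.measurable_emeasure_Pair) measurable
  moreover have "Pair x -` ?Q = ball x \<rho>" for x
    by (auto simp: space_pair_measure sets_eq_imp_space_eq[OF sets_M])
  ultimately show ?thesis unfolding v_def measure_def by simp
qed

text \<open>Integrate the pointwise estimate at \<open>\<xi>\<close> against \<open>\<nu>\<close>
  and exchange the order: the point \<open>u\<close> is then weighted by the
  \<open>\<nu>\<close>-mass of \<open>ball u r\<close>, divided by \<open>v u\<close>.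
  \<open>S\<close> enters linearly and \<open>C\<close> is uniform in \<open>\<nu>\<close>, which is
  what the essential norm needs.\<close>

lemma carleson_embedding:
  assumes r: "0 < r" "r \<le> \<rho>"
  shows "\<exists>C>0. \<forall>\<nu> S f. sets \<nu> = sets borel \<longrightarrow> (\<forall>R. emeasure \<nu> (ball 0 R) < \<infinity>) \<longrightarrow> 0 \<le> S \<longrightarrow>
    (\<forall>u. emeasure \<nu> (ball u r) \<le> ennreal (S * v u)) \<longrightarrow> f \<in> holL2 P \<longrightarrow>
    (\<integral>\<^sup>+\<xi>. ennreal ((cmod (f \<xi>))\<^sup>2 * gauss \<xi>) \<partial>\<nu>) \<le> ennreal (C * S * nrm2 P f)"
proof -
  obtain C where C: "0 < C" and est: "\<And>f z. f holomorphic_on UNIV \<Longrightarrow> ennreal ((cmod (f z))\<^sup>2 * gauss z * v z)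
       \<le> ennreal C * (\<integral>\<^sup>+\<xi>. ennreal ((cmod (f \<xi>))\<^sup>2 * gauss \<xi>) * indicator (ball z r) \<xi> \<partial>M)"
    using pointwise_estimate[OF r] by blast
  have "(\<integral>\<^sup>+\<xi>. ennreal ((cmod (f \<xi>))\<^sup>2 * gauss \<xi>) \<partial>\<nu>) \<le> ennreal (C * A * S * nrm2 P f)"
    if sets_\<nu>[measurable_cong]: "sets \<nu> = sets borel" and fin: "\<And>R. emeasure \<nu> (ball 0 R) < \<infinity>"
      and S: "0 \<le> S" and ball: "\<And>u. emeasure \<nu> (ball u r) \<le> ennreal (S * v u)" and f: "f \<in> holL2 P"
    for \<nu> :: "complex measure" and S f
  proof -
    interpret M: sigma_finite_measure M by (rule sigma_finite_M)
    interpret \<nu>: sigma_finite_measure \<nu> by (rule sigma_finite_borel[OF sets_\<nu> fin])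
    interpret pair_sigma_finite \<nu> M ..
    have hol: "f holomorphic_on UNIV" and int: "integrable P (\<lambda>\<xi>. (cmod (f \<xi>))\<^sup>2)"
      using f by (simp_all add: holL2_def)
    note [measurable] = entire_borel[OF hol]
    define h where "h u = (cmod (f u))\<^sup>2 * gauss u" for u
    have h0: "0 \<le> h u" for u using gauss_pos[of u] by (simp add: h_def)
    have [measurable]: "h \<in> borel_measurable borel" unfolding h_def by measurable
    \<comment> \<open>The kernel of the double integral, with \<open>v u\<close> already in place of
      \<open>v \<xi>\<close> at the cost of \<open>A\<close>, so that the integral over
      \<open>\<xi>\<close> involves only the disk about \<open>u\<close>.\<close>
    define F where "F \<xi> u = ennreal (C * A) * ennreal (h u / v u) * indicator {x. dist (fst x) (snd x) < r} (\<xi>, u)"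
      for \<xi> u
    have "open {x::complex \<times> complex. dist (fst x) (snd x) < r}"
      by (intro open_Collect_less continuous_intros)
    then have "{x::complex \<times> complex. dist (fst x) (snd x) < r} \<in> sets (borel \<Otimes>\<^sub>M borel)"
      unfolding borel_prod by (rule borel_open)
    then have [measurable]: "{x. dist (fst x) (snd x) < r} \<in> sets (\<nu> \<Otimes>\<^sub>M M)"
      using sets_pair_measure_cong[OF sets_\<nu> sets_M] by simp
    have [measurable]: "(\<lambda>x. F (fst x) (snd x)) \<in> borel_measurable (\<nu> \<Otimes>\<^sub>M M)"
      unfolding F_def by simp
    have "ennreal (h \<xi>) \<le> (\<integral>\<^sup>+u. F \<xi> u \<partial>M)" for \<xi>
    proof -
      have "ennreal (h \<xi>) = ennreal (1 / v \<xi>) * ennreal (h \<xi> * v \<xi>)"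
        using v_pos[of \<xi>] h0[of \<xi>] by (simp add: ennreal_mult[symmetric])
      also have "\<dots> \<le> ennreal (1 / v \<xi>) * (ennreal C * (\<integral>\<^sup>+u. ennreal (h u) * indicator (ball \<xi> r) u \<partial>M))"
        unfolding h_def by (intro mult_left_mono est hol) simp
      also have "\<dots> = (\<integral>\<^sup>+u. ennreal (C / v \<xi>) * (ennreal (h u) * indicator (ball \<xi> r) u) \<partial>M)"
      proof -
        have "ennreal (C / v \<xi>) = ennreal (1 / v \<xi>) * ennreal C"
          using C v_pos[of \<xi>] by (simp add: ennreal_mult[symmetric])
        moreover have "(\<integral>\<^sup>+u. ennreal (C / v \<xi>) * (ennreal (h u) * indicator (ball \<xi> r) u) \<partial>M)
            = ennreal (C / v \<xi>) * (\<integral>\<^sup>+u. ennreal (h u) * indicator (ball \<xi> r) u \<partial>M)"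
          by (rule nn_integral_cmult) simp
        ultimately show ?thesis by (simp only: mult.assoc)
      qed
      also have "\<dots> \<le> (\<integral>\<^sup>+u. F \<xi> u \<partial>M)"
      proof (rule nn_integral_mono)
        fix u
        show "ennreal (C / v \<xi>) * (ennreal (h u) * indicator (ball \<xi> r) u) \<le> F \<xi> u"
        proof (cases "u \<in> ball \<xi> r")
          case True
          then have "v u \<le> A * v \<xi>" using r by (intro v_near) (simp add: dist_commute)
          then have "C / v \<xi> \<le> C * A / v u"
            using v_pos[of u] v_pos[of \<xi>] C by (simp add: field_simps)
          then have "C / v \<xi> * h u \<le> C * A / v u * h u" by (intro mult_right_mono h0)
          then have "ennreal (C / v \<xi> * h u) \<le> ennreal (C * A * (h u / v u))"
            by (intro ennreal_leI) simp
          then show ?thesis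
            using True C A_pos h0[of u] v_pos[of u] v_pos[of \<xi>] by (simp add: F_def ennreal_mult[symmetric])
        qed simp
      qed
      finally show ?thesis .
    qed
    then have "(\<integral>\<^sup>+\<xi>. ennreal (h \<xi>) \<partial>\<nu>) \<le> (\<integral>\<^sup>+\<xi>. \<integral>\<^sup>+u. F \<xi> u \<partial>M \<partial>\<nu>)"
      by (intro nn_integral_mono)
    also have "\<dots> = (\<integral>\<^sup>+u. \<integral>\<^sup>+\<xi>. F \<xi> u \<partial>\<nu> \<partial>M)"
      by (intro Fubini'[symmetric]) (simp add: case_prod_beta)
    also have "\<dots> \<le> (\<integral>\<^sup>+u. ennreal (C * A * S) * ennreal (h u) \<partial>M)"
    proof (rule nn_integral_mono)
      fix u
      have "(\<integral>\<^sup>+\<xi>. F \<xi> u \<partial>\<nu>) = (\<integral>\<^sup>+\<xi>. ennreal (C * A) * ennreal (h u / v u) * indicator (ball u r) \<xi> \<partial>\<nu>)"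
        by (intro nn_integral_cong) (simp add: F_def indicator_def dist_commute)
      also have "\<dots> = ennreal (C * A) * ennreal (h u / v u) * emeasure \<nu> (ball u r)"
        by (rule nn_integral_cmult_indicator) (simp add: sets_\<nu>)
      also have "\<dots> \<le> ennreal (C * A) * ennreal (h u / v u) * ennreal (S * v u)"
        by (intro mult_left_mono ball) simp
      also have "\<dots> = ennreal (C * A * (h u / v u) * (S * v u))"
        using C A_pos S h0[of u] v_pos[of u] by (simp add: ennreal_mult[symmetric])
      also have "\<dots> = ennreal (C * A * S) * ennreal (h u)"
        using C A_pos S h0[of u] v_pos[of u] by (simp add: ennreal_mult[symmetric] mult_ac)
      finally show "(\<integral>\<^sup>+\<xi>. F \<xi> u \<partial>\<nu>) \<le> ennreal (C * A * S) * ennreal (h u)" .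
    qed
    also have "\<dots> = ennreal (C * A * S) * (\<integral>\<^sup>+u. ennreal (h u) \<partial>M)"
      by (rule nn_integral_cmult) simp
    also have "(\<integral>\<^sup>+u. ennreal (h u) \<partial>M) = (\<integral>\<^sup>+u. ennreal ((cmod (f u))\<^sup>2) \<partial>P)"
      unfolding h_def by (subst nn_integral_P) simp_all
    also have "\<dots> = ennreal (nrm2 P f)"
      unfolding nrm2_def by (rule nn_integral_eq_integral[OF int]) simp
    also have "ennreal (C * A * S) * ennreal (nrm2 P f) = ennreal (C * A * S * nrm2 P f)"
      using C A_pos S nrm2_nonneg by (simp add: ennreal_mult)
    finally show ?thesis unfolding h_def .
  qed
  moreover have "0 < C * A" using C A_pos by simp
  ultimately show ?thesis by blast
qed

end

section \<open>Restricted Muckenhoupt weights are doubling\<close>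

lemma square_eq_cbox: "square a l = cbox a (Complex (Re a + l) (Im a + l))"
  unfolding square_def cbox_def by (auto simp: Basis_complex_def)

lemma measure_square:
  assumes "0 \<le> l"
  shows "measure lebesgue (square a l) = l\<^sup>2"
proof -
  have "measure lebesgue (square a l) = measure lborel (cbox a (Complex (Re a + l) (Im a + l)))"
    unfolding square_eq_cbox by simp
  also have "\<dots> = l\<^sup>2"
    using assms by (subst content_cbox) (auto simp: Basis_complex_def power2_eq_square)
  finally show ?thesis .
qed

lemma square_lmeasurable: "square a l \<in> lmeasurable"
  unfolding square_eq_cbox by (rule lmeasurable_cbox)

lemma compact_square: "compact (square a l)"
  unfolding square_eq_cbox by (rule compact_cbox)

lemma set_integral_ge_measure:
  fixes f :: "complex \<Rightarrow> real"
  assumes f: "f absolutely_integrable_on E" and E: "E \<in> lmeasurable"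
    and le: "AE z in lebesgue. z \<in> E \<longrightarrow> 1 \<le> f z"
  shows "measure lebesgue E \<le> (LINT z:E|lebesgue. f z)"
proof -
  have "(LINT z:E|lebesgue. (1::real)) \<le> (LINT z:E|lebesgue. f z)"
    unfolding set_lebesgue_integral_def
  proof (rule integral_mono_AE)
    show "integrable lebesgue (\<lambda>z. indicat_real E z *\<^sub>R (1::real))"
      using E by (auto intro!: integrable_real_indicator simp: fmeasurable_def)
    show "integrable lebesgue (\<lambda>z. indicat_real E z *\<^sub>R f z)"
      using f unfolding set_integrable_def .
    show "AE z in lebesgue. indicat_real E z *\<^sub>R (1::real) \<le> indicat_real E z *\<^sub>R f z"
      using le by eventually_elim (auto simp: indicator_def)
  qed
  then show ?thesis using E by (simp add: fmeasurable_def set_lebesgue_integral_def)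
qed

text \<open>
  The form in which the Muckenhoupt condition is used: \<open>|E| / |Q|\<close> is bounded by a power of
  \<open>w(E) / w(Q)\<close>.  For \<open>p > 1\<close> the pointwise inequality \<open>1 \<le> t w + (t w)\<^sup>-\<^sup>q\<close>, optimized in \<open>t\<close>,
  replaces Hoelder's inequality.
\<close>

definition muckenhoupt_comparison :: "real \<Rightarrow> (complex \<Rightarrow> real) \<Rightarrow> bool" where
  "muckenhoupt_comparison p w \<longleftrightarrow>
    (\<exists>r>0. \<exists>C>0. \<forall>a E. E \<in> sets lebesgue \<longrightarrow> E \<subseteq> square a r \<longrightarrow> 0 < measure lebesgue E \<longrightarrow>
      0 < (LINT z:E|lebesgue. w z) \<and>
      (LINT z:square a r|lebesgue. w z) * (measure lebesgue E / r\<^sup>2) powr p \<le> C * (LINT z:E|lebesgue. w z))"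

lemma weight_nonneg: "weight w \<Longrightarrow> 0 \<le> w z"
  by (simp add: weight_def)

lemma weight_integrable_square: "weight w \<Longrightarrow> w absolutely_integrable_on square a l"
  using compact_square by (simp add: weight_def)

lemma subset_square_lmeasurable: "E \<in> sets lebesgue \<Longrightarrow> E \<subseteq> square a l \<Longrightarrow> E \<in> lmeasurable"
  using fmeasurableI2[OF square_lmeasurable] by blast

lemma set_lebesgue_integral_nonneg:
  assumes "\<And>z. (0::real) \<le> f z" shows "0 \<le> (LINT z:E|lebesgue. f z)"
  unfolding set_lebesgue_integral_def using assms by simp

text \<open>With \<open>s\<close> the essential supremum of the inverse weight on the square,
  \<open>1 \<le> s * w z\<close> almost everywhere there. Integrating over \<open>E\<close> bounds
  the area of \<open>E\<close> by \<open>s\<close> times its weight, and \<open>s\<close> times the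
  average of \<open>w\<close> is bounded.\<close>

lemma A1_muckenhoupt_comparison:
  assumes "A1_restricted w"
  shows "muckenhoupt_comparison 1 w"
proof -
  from assms obtain r where w: "weight w" and r: "0 < r"
    and fin: "\<And>a. esssup (lebesgue_on (square a r)) (\<lambda>z. inverse (ennreal (w z))) < \<infinity>"
    and sup: "(SUP a. ennreal (average w (square a r)) *
               esssup (lebesgue_on (square a r)) (\<lambda>z. inverse (ennreal (w z)))) < \<infinity>"
    unfolding A1_restricted_def by blast
  \<comment> \<open>The added 1 makes the constant positive.\<close>
  define B where "B = enn2real (SUP a. ennreal (average w (square a r)) *
               esssup (lebesgue_on (square a r)) (\<lambda>z. inverse (ennreal (w z)))) + 1"
  have B: "0 < B" unfolding B_def using enn2real_nonneg by (metis add_nonneg_pos zero_less_one)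
  have main: "0 < (LINT z:E|lebesgue. w z) \<and>
      (LINT z:square a r|lebesgue. w z) * (measure lebesgue E / r\<^sup>2) powr 1 \<le> B * (LINT z:E|lebesgue. w z)"
    if E: "E \<in> sets lebesgue" "E \<subseteq> square a r" "0 < measure lebesgue E" for a E
  proof -
    let ?Q = "square a r"
    define s where "s = enn2real (esssup (lebesgue_on ?Q) (\<lambda>z. inverse (ennreal (w z))))"
    have s: "esssup (lebesgue_on ?Q) (\<lambda>z. inverse (ennreal (w z))) = ennreal s"
      unfolding s_def using fin[of a] by (simp add: less_top[symmetric])
    have s0: "0 \<le> s" by (simp add: s_def)
    let ?X = "LINT z:?Q|lebesgue. w z" and ?Y = "LINT z:E|lebesgue. w z"
    have X0: "0 \<le> ?X" and Y0: "0 \<le> ?Y" using weight_nonneg[OF w] by (auto intro!: set_lebesgue_integral_nonneg)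
    have avg: "average w ?Q = ?X / r\<^sup>2"
      unfolding average_def using r by (simp add: measure_square)
    have "ennreal (?X / r\<^sup>2) * ennreal s \<le> ennreal B"
    proof -
      have "ennreal (average w ?Q) * esssup (lebesgue_on ?Q) (\<lambda>z. inverse (ennreal (w z)))
          \<le> (SUP a. ennreal (average w (square a r)) *
               esssup (lebesgue_on (square a r)) (\<lambda>z. inverse (ennreal (w z))))"
        by (rule SUP_upper) simp
      also have "\<dots> = ennreal (enn2real (SUP a. ennreal (average w (square a r)) *
               esssup (lebesgue_on (square a r)) (\<lambda>z. inverse (ennreal (w z)))))"
        using sup by (simp add: less_top[symmetric])
      also have "\<dots> \<le> ennreal B" unfolding B_def by (intro ennreal_leI) simp
      finally show ?thesis unfolding s avg .
    qed
    then have XB: "?X / r\<^sup>2 * s \<le> B"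
      using X0 s0 B by (simp add: ennreal_mult[symmetric] ennreal_le_iff)
    have ae: "AE z in lebesgue. z \<in> ?Q \<longrightarrow> 1 \<le> s * w z"
    proof -
      have "AE z in lebesgue_on ?Q. inverse (ennreal (w z)) \<le> ennreal s"
        using esssup_AE[of "\<lambda>z. inverse (ennreal (w z))" "lebesgue_on ?Q"] unfolding s .
      then have "AE z in lebesgue. z \<in> ?Q \<longrightarrow> inverse (ennreal (w z)) \<le> ennreal s"
        using square_lmeasurable[of a r] by (subst (asm) AE_restrict_space_iff) (auto simp: fmeasurable_def)
      then show ?thesis
      proof eventually_elim
        case (elim z)
        show ?case
        proof
          assume "z \<in> ?Q"
          then have *: "inverse (ennreal (w z)) \<le> ennreal s" using elim by simp
          \<comment> \<open>At a zero of \<open>w\<close> the inverse would be infinite, contrary to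
            the finite bound \<open>s\<close>.\<close>
          then have "w z \<noteq> 0" using ennreal_less_top[of s] by (auto simp: top_unique)
          then have "0 < w z" using weight_nonneg[OF w, of z] by linarith
          then have "inverse (w z) \<le> s" using * s0 by (simp add: inverse_ennreal ennreal_le_iff)
          then show "1 \<le> s * w z" using \<open>0 < w z\<close> by (simp add: field_simps)
        qed
      qed
    qed
    have "measure lebesgue E \<le> (LINT z:E|lebesgue. s * w z)"
    proof (rule set_integral_ge_measure)
      show "(\<lambda>z. s * w z) absolutely_integrable_on E"
        using set_integrable_subset[OF weight_integrable_square[OF w] E(1,2)] by simp
      show "E \<in> lmeasurable" using subset_square_lmeasurable E by blast
      show "AE z in lebesgue. z \<in> E \<longrightarrow> 1 \<le> s * w z"
        using ae by eventually_elim (use E(2) in blast)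
    qed
    then have EY: "measure lebesgue E \<le> s * ?Y" by simp
    then have "0 < s * ?Y" using E(3) by linarith
    then have "0 < ?Y" using s0 Y0 by (simp add: zero_less_mult_iff)
    moreover have "?X * (measure lebesgue E / r\<^sup>2) \<le> B * ?Y"
    proof -
      have "?X * (measure lebesgue E / r\<^sup>2) \<le> ?X * (s * ?Y / r\<^sup>2)"
        using EY X0 by (intro mult_left_mono divide_right_mono) auto
      also have "\<dots> = ?X / r\<^sup>2 * s * ?Y" by simp
      also have "\<dots> \<le> B * ?Y" by (intro mult_right_mono XB Y0)
      finally show ?thesis .
    qed
    ultimately show ?thesis using E(3) by simp
  qed
  then show ?thesis unfolding muckenhoupt_comparison_def using r B by blast
qed

lemma Ap_muckenhoupt_comparison:
  assumes p: "1 < p" and "Ap_restricted p w"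
  shows "muckenhoupt_comparison p w"
proof -
  \<comment> \<open>In terms of \<open>p\<close> alone: \<open>q\<close> is \<open>p' / p\<close>,
    and the outer exponent \<open>p / p'\<close> is \<open>p - 1\<close>.\<close>
  define q where "q = 1 / (p - 1)"
  have q: "0 < q" using p by (simp add: q_def)
  have pq: "- (p / (p - 1)) / p = - q" "p / (p / (p - 1)) = p - 1" using p by (simp_all add: q_def)
  from assms(2) obtain r where w: "weight w" and r: "0 < r"
    and ae: "\<And>a. AE z in lebesgue_on (square a r). 0 < w z"
    and int: "\<And>a. (\<lambda>z. w z powr (- q)) absolutely_integrable_on square a r"
    and bdd: "bdd_above (range (\<lambda>a. average w (square a r) *
                average (\<lambda>z. w z powr (- q)) (square a r) powr (p - 1)))"
    unfolding Ap_restricted_def Let_def pq by blast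
  obtain B0 where B0: "\<And>a. average w (square a r) *
                average (\<lambda>z. w z powr (- q)) (square a r) powr (p - 1) \<le> B0"
    using bdd unfolding bdd_above_def by blast
  define B where "B = max B0 1"
  have B: "0 < B" "B0 \<le> B" by (simp_all add: B_def)
  have main: "0 < (LINT z:E|lebesgue. w z) \<and>
      (LINT z:square a r|lebesgue. w z) * (measure lebesgue E / r\<^sup>2) powr p
        \<le> 2 powr p * B * (LINT z:E|lebesgue. w z)"
    if E: "E \<in> sets lebesgue" "E \<subseteq> square a r" "0 < measure lebesgue E" for a E
  proof -
    let ?Q = "square a r"
    let ?X = "LINT z:?Q|lebesgue. w z" and ?S = "LINT z:?Q|lebesgue. w z powr (- q)"
    have X0: "0 \<le> ?X" and S0: "0 \<le> ?S"
      using weight_nonneg[OF w] by (auto intro!: set_lebesgue_integral_nonneg)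
    have ae': "AE z in lebesgue. z \<in> ?Q \<longrightarrow> 0 < w z"
      using ae[of a] square_lmeasurable[of a r]
      by (subst (asm) AE_restrict_space_iff) (auto simp: fmeasurable_def)
    have young: "measure lebesgue F \<le> t * (LINT z:F|lebesgue. w z) + t powr (- q) * ?S"
      if F: "F \<in> sets lebesgue" "F \<subseteq> ?Q" and t: "0 < t" for F t
    proof -
      have iw: "w absolutely_integrable_on F"
        by (rule set_integrable_subset[OF weight_integrable_square[OF w] F])
      have iq: "(\<lambda>z. w z powr (- q)) absolutely_integrable_on F"
        by (rule set_integrable_subset[OF int F])
      have "measure lebesgue F \<le> (LINT z:F|lebesgue. t * w z + t powr (- q) * w z powr (- q))"
      proof (rule set_integral_ge_measure)
        show "(\<lambda>z. t * w z + t powr (- q) * w z powr (- q)) absolutely_integrable_on F"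
          using iw iq by (intro set_integral_add set_integrable_mult_right)
        show "F \<in> lmeasurable" using subset_square_lmeasurable F by blast
        show "AE z in lebesgue. z \<in> F \<longrightarrow> 1 \<le> t * w z + t powr (- q) * w z powr (- q)"
          using ae'
        proof eventually_elim
          case (elim z)
          show ?case
          proof
            assume "z \<in> F"
            then have wz: "0 < w z" using elim F(2) by blast
            have eq: "t powr (- q) * w z powr (- q) = (t * w z) powr (- q)"
              using t wz by (simp add: powr_mult)
            show "1 \<le> t * w z + t powr (- q) * w z powr (- q)"
            proof (cases "1 \<le> t * w z")
              case True
              then show ?thesis unfolding eq by (simp add: add_increasing2)
            next
              case False
              have "0 < t * w z" using t wz by simp
              then have "1 \<le> (t * w z) powr (- q)"
                using False q powr_mono2'[of "- q" "t * w z" 1] by simp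
              then show ?thesis unfolding eq using \<open>0 < t * w z\<close> by linarith
            qed
          qed
        qed
      qed
      also have "\<dots> = t * (LINT z:F|lebesgue. w z) + t powr (- q) * (LINT z:F|lebesgue. w z powr (- q))"
        using iw iq by (subst set_integral_add) auto
      also have "\<dots> \<le> t * (LINT z:F|lebesgue. w z) + t powr (- q) * ?S"
      proof -
        have "(LINT z:F|lebesgue. w z powr (- q)) \<le> ?S"
          unfolding set_lebesgue_integral_def
        proof (rule integral_mono)
          show "indicat_real F z *\<^sub>R w z powr (- q) \<le> indicat_real ?Q z *\<^sub>R w z powr (- q)" for z
            using F(2) by (auto simp: indicator_def)
        qed (use iq int in \<open>simp_all add: set_integrable_def\<close>)
        then show ?thesis by (intro add_left_mono mult_left_mono) auto
      qed
      finally show ?thesis .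
    qed
    have "?S \<noteq> 0"
    proof
      assume "?S = 0"
      \<comment> \<open>If \<open>?S\<close> vanished, \<open>young\<close> on the whole square
        would bound its area by \<open>t * ?X\<close> for every positive \<open>t\<close>; this
        \<open>t\<close> is small enough to contradict it.\<close>
      define t where "t = r\<^sup>2 / (2 * (?X + 1))"
      have t: "0 < t" using r X0 by (simp add: t_def)
      have "r\<^sup>2 \<le> t * ?X"
        using young[of ?Q t] t \<open>?S = 0\<close> square_lmeasurable[of a r] measure_square[of r a] r
        by (simp add: fmeasurable_def)
      also have "\<dots> \<le> t * (?X + 1)" using t by simp
      also have "\<dots> = r\<^sup>2 / 2"
      proof -
        have *: "c / (2 * d) * d = c / 2" if "0 < d" for c d :: real using that by simp
        show ?thesis unfolding t_def by (rule *) (use X0 in linarith)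
      qed
      finally show False using r by simp
    qed
    with S0 have S: "0 < ?S" by linarith
    define e where "e = measure lebesgue E"
    have e: "0 < e" using E(3) by (simp add: e_def)
    let ?Y = "LINT z:E|lebesgue. w z"
    \<comment> \<open>Chosen so that the second term of \<open>young\<close> equals
      \<open>e / 2\<close>, exactly half of the left side, and is absorbed there.\<close>
    define t where "t = (2 * ?S / e) powr (p - 1)"
    have t: "0 < t" using S e by (simp add: t_def)
    have "t powr (- q) = e / (2 * ?S)"
    proof -
      have "t powr (- q) = (2 * ?S / e) powr (- 1)"
        unfolding t_def powr_powr using p by (simp add: q_def)
      also have "\<dots> = e / (2 * ?S)" using S e by (simp add: powr_minus)
      finally show ?thesis .
    qed
    then have "t powr (- q) * ?S = e / 2" using S by simp
    then have Y: "e / 2 \<le> t * ?Y" using young[OF E(1,2) t] by (simp add: e_def)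
    then have "0 < t * ?Y" using e by linarith
    then have Ypos: "0 < ?Y" using t by (simp add: zero_less_mult_iff)
    have YS: "(e / 2) powr p \<le> ?Y * ?S powr (p - 1)"
    proof -
      have "t = ?S powr (p - 1) / (e / 2) powr (p - 1)"
        unfolding t_def using S e by (simp add: powr_divide[symmetric] mult.commute)
      then have tS: "t * (e / 2) powr (p - 1) = ?S powr (p - 1)" using e by simp
      have "e / 2 * (e / 2) powr (p - 1) \<le> t * ?Y * (e / 2) powr (p - 1)"
        by (intro mult_right_mono Y) simp
      also have "\<dots> = ?Y * ?S powr (p - 1)" unfolding tS[symmetric] by simp
      finally have "e / 2 * (e / 2) powr (p - 1) \<le> ?Y * ?S powr (p - 1)" .
      moreover have "e / 2 * (e / 2) powr (p - 1) = (e / 2) powr p"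
        using e p powr_add[of "e / 2" 1 "p - 1"] by simp
      ultimately show ?thesis by simp
    qed
    have XS: "?X * ?S powr (p - 1) \<le> B * (r\<^sup>2) powr p"
    proof -
      have "?X / r\<^sup>2 * (?S / r\<^sup>2) powr (p - 1) \<le> B"
        using B0[of a] B(2) r by (simp add: average_def measure_square)
      then have "?X / r\<^sup>2 * (?S powr (p - 1) / (r\<^sup>2) powr (p - 1)) \<le> B"
        using S r by (simp add: powr_divide)
      then have "?X * ?S powr (p - 1) \<le> B * (r\<^sup>2 * (r\<^sup>2) powr (p - 1))"
        using r by (simp add: field_simps)
      also have "r\<^sup>2 * (r\<^sup>2) powr (p - 1) = (r\<^sup>2) powr p"
        using r p powr_add[of "r\<^sup>2" 1 "p - 1"] by simp
      finally show ?thesis .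
    qed
    have "?X * (e / 2) powr p \<le> ?X * (?Y * ?S powr (p - 1))" by (intro mult_left_mono YS X0)
    also have "\<dots> = (?X * ?S powr (p - 1)) * ?Y" by simp
    also have "\<dots> \<le> B * (r\<^sup>2) powr p * ?Y" using Ypos by (intro mult_right_mono XS) simp
    finally have "?X * (e powr p / 2 powr p) \<le> B * (r\<^sup>2) powr p * ?Y" using e by (simp add: powr_divide)
    then have "?X * (e / r\<^sup>2) powr p \<le> 2 powr p * B * ?Y"
      using e r by (simp add: powr_divide field_simps)
    with Ypos show ?thesis unfolding e_def by blast
  qed
  have "0 < 2 powr p * B" using B by simp
  with main r show ?thesis unfolding muckenhoupt_comparison_def by blast
qed

section \<open>The weight as a Borel measure, and its doubling property\<close>

text \<open>Weights are only Lebesgue measurable, whereas \<open>\<mu>\<close> and the Fock space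
  setting live on the Borel sets; pushing forward along the identity forgets the extra sets.\<close>

definition weight_measure :: "(complex \<Rightarrow> real) \<Rightarrow> complex measure" where
  "weight_measure w = distr (density lebesgue (\<lambda>z. ennreal (w z))) borel (\<lambda>z. z)"

lemma sets_weight_measure: "sets (weight_measure w) = sets borel"
  by (simp add: weight_measure_def)

text \<open>A weight is integrable on compact sets, so its truncations to \<open>cball 0 n\<close>
  are measurable, and they converge to it pointwise.\<close>

lemma weight_borel_measurable:
  assumes "weight w"
  shows "w \<in> borel_measurable lebesgue"
proof (rule borel_measurable_LIMSEQ_real)
  fix z :: complex
  obtain n where "norm z < real n" using reals_Archimedean2 by blast
  then have "\<forall>\<^sub>F n in sequentially. indicat_real (cball 0 (real n)) z *\<^sub>R w z = w z"
    by (intro eventually_mono[OF eventually_ge_at_top[of n]]) (simp add: indicator_def)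
  then show "(\<lambda>n. indicat_real (cball 0 (real n)) z *\<^sub>R w z) \<longlonglongrightarrow> w z" by (rule tendsto_eventually)
next
  fix n :: nat
  have "w absolutely_integrable_on cball 0 (real n)" using assms by (simp add: weight_def)
  then show "(\<lambda>z. indicat_real (cball 0 (real n)) z *\<^sub>R w z) \<in> borel_measurable lebesgue"
    unfolding set_integrable_def by (rule borel_measurable_integrable)
qed

lemma nn_integral_weight_measure:
  assumes w: "weight w" and [measurable]: "g \<in> borel_measurable borel"
  shows "(\<integral>\<^sup>+z. g z \<partial>weight_measure w) = (\<integral>\<^sup>+z. g z * ennreal (w z) \<partial>lebesgue)"
proof -
  note [measurable] = weight_borel_measurable[OF w]
  have [measurable]: "g \<in> borel_measurable lebesgue" by (rule measurable_completion) simp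
  have [measurable]: "(\<lambda>z. z) \<in> density lebesgue (\<lambda>z. ennreal (w z)) \<rightarrow>\<^sub>M borel"
    unfolding measurable_density_eq1 by (rule measurable_completion) simp
  show ?thesis
    unfolding weight_measure_def
    by (simp add: nn_integral_distr nn_integral_density mult.commute)
qed

lemma emeasure_weight_measure:
  assumes "weight w" "E \<in> sets borel"
  shows "emeasure (weight_measure w) E = (\<integral>\<^sup>+z\<in>E. ennreal (w z) \<partial>lebesgue)"
  using nn_integral_weight_measure[OF assms(1), of "indicator E"] assms(2)
  by (simp add: sets_weight_measure mult.commute)

lemma emeasure_weight_measure_integral:
  assumes w: "weight w" and E: "E \<in> sets borel" "E \<subseteq> square a l"
  shows "emeasure (weight_measure w) E = ennreal (LINT z:E|lebesgue. w z)"
proof -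
  have "w absolutely_integrable_on E"
    using E by (intro set_integrable_subset[OF weight_integrable_square[OF w]]) auto
  then have i: "integrable lebesgue (\<lambda>z. indicator E z *\<^sub>R w z)" unfolding set_integrable_def .
  have "(\<integral>\<^sup>+z. ennreal (indicator E z *\<^sub>R w z) \<partial>lebesgue) = ennreal (LINT z:E|lebesgue. w z)"
    unfolding set_lebesgue_integral_def
    using weight_nonneg[OF w] by (intro nn_integral_eq_integral i) simp
  moreover have "(\<integral>\<^sup>+z. ennreal (indicator E z *\<^sub>R w z) \<partial>lebesgue) = (\<integral>\<^sup>+z\<in>E. ennreal (w z) \<partial>lebesgue)"
    by (intro nn_integral_cong) (simp add: indicator_def)
  ultimately show ?thesis using emeasure_weight_measure[OF w E(1)] by simp
qed

text \<open>Both disks lie in the square of side \<open>r\<close> centred at \<open>z\<close>, so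
  the comparison with \<open>E = ball \<zeta> t\<close> bounds the weight of that disk below by a
  power of \<open>pi * t\<^sup>2 / r\<^sup>2\<close> times the weight of the square.\<close>

lemma muckenhoupt_doubling:
  assumes w: "weight w" and p: "1 \<le> p" and "muckenhoupt_comparison p w" and \<alpha>: "0 < \<alpha>"
  shows "\<exists>\<rho> \<kappa> N. doubling_fock \<alpha> \<rho> \<kappa> N (weight_measure w)"
proof -
  from assms(3) obtain r C where r: "0 < r" and C: "0 < C"
    and main: "\<forall>a E. E \<in> sets lebesgue \<longrightarrow> E \<subseteq> square a r \<longrightarrow> 0 < measure lebesgue E \<longrightarrow>
      0 < (LINT z:E|lebesgue. w z) \<and>
      (LINT z:square a r|lebesgue. w z) * (measure lebesgue E / r\<^sup>2) powr p \<le> C * (LINT z:E|lebesgue. w z)"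
    unfolding muckenhoupt_comparison_def by (elim exE conjE)
  note pos = main[rule_format, THEN conjunct1] and comp = main[rule_format, THEN conjunct2]
  \<comment> \<open>Centres at distance at most \<open>\<rho>\<close> and radii at most
    \<open>\<rho>\<close> stay within \<open>r / 2\<close> of \<open>z\<close>.\<close>
  define \<rho> where "\<rho> = r / 4"
  define N where "N = nat \<lceil>p\<rceil>"
  have N: "0 < N" "p \<le> real N" using p by (auto simp: N_def real_nat_ceiling_ge)
  define \<kappa> where "\<kappa> = (pi / r\<^sup>2) ^ N / C"
  let ?M = "weight_measure w"
  have sub: "ball \<zeta> t \<subseteq> square (z - Complex (r/2) (r/2)) r" if "dist z \<zeta> \<le> \<rho>" "t \<le> \<rho>" for z \<zeta> t
  proof
    fix x assume "x \<in> ball \<zeta> t"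
    then have "cmod (x - z) \<le> r / 2"
      using that dist_triangle[of z x \<zeta>] by (simp add: \<rho>_def dist_norm norm_minus_commute)
    then have "\<bar>Re (x - z)\<bar> \<le> r / 2" "\<bar>Im (x - z)\<bar> \<le> r / 2"
      using abs_Re_le_cmod[of "x - z"] abs_Im_le_cmod[of "x - z"] by linarith+
    then have "Re z - r / 2 \<le> Re x" "Re x \<le> Re z + r / 2" "Im z - r / 2 \<le> Im x" "Im x \<le> Im z + r / 2"
      unfolding minus_complex.sel abs_le_iff by linarith+
    then show "x \<in> square (z - Complex (r/2) (r/2)) r" by (simp add: square_def)
  qed
  have mb: "measure lebesgue (ball \<zeta> t) = pi * t\<^sup>2" if "0 < t" for \<zeta> :: complex and t
    using that content_ball[of t \<zeta>] by (simp add: unit_ball_vol_2)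
  have em: "emeasure ?M (ball \<zeta> t) = ennreal (LINT z:ball \<zeta> t|lebesgue. w z)"
    if "dist z \<zeta> \<le> \<rho>" "t \<le> \<rho>" for z \<zeta> t
    by (rule emeasure_weight_measure_integral[OF w _ sub[OF that]]) simp
  have "doubling_fock \<alpha> \<rho> \<kappa> N ?M"
  proof
    show "0 < emeasure ?M (ball z \<rho>)" for z
    proof -
      have "0 < (LINT z:ball z \<rho>|lebesgue. w z)"
        using mb[of \<rho> z] r by (intro pos[OF _ sub[of z z]]) (simp_all add: \<rho>_def)
      then show ?thesis using r by (subst em[of z]) (simp_all add: \<rho>_def)
    qed
    show "emeasure ?M (ball z \<rho>) < \<infinity>" for z
      using r by (subst em[of z]) (simp_all add: \<rho>_def)
    fix z \<zeta> :: complex and t assume d: "dist z \<zeta> \<le> \<rho>" "0 < t" "t \<le> \<rho>"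
    let ?Q = "square (z - Complex (r/2) (r/2)) r"
    let ?X = "LINT z:?Q|lebesgue. w z" and ?Y = "LINT z:ball \<zeta> t|lebesgue. w z"
    have X0: "0 \<le> ?X" using weight_nonneg[OF w] by (rule set_lebesgue_integral_nonneg)
    let ?x = "pi * t\<^sup>2 / r\<^sup>2"
    have x0: "0 < ?x" using d r by simp
    have "measure lebesgue (ball \<zeta> t) \<le> measure lebesgue ?Q"
      using sub[OF d(1,3)] by (intro measure_mono_fmeasurable square_lmeasurable) auto
    then have "?x \<le> 1" using mb[OF d(2)] r measure_square[of r] by simp
    \<comment> \<open>Rounding \<open>p\<close> up to \<open>N\<close> only weakens the bound: the
      area ratio is at most 1, because the disk lies in the square.\<close>
    then have "?x ^ N \<le> ?x powr p"
      using x0 N(2) powr_mono'[of p "real N" ?x] by (simp add: powr_realpow)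
    then have "?X * ?x ^ N \<le> ?X * ?x powr p" by (intro mult_left_mono X0)
    also have "\<dots> \<le> C * ?Y"
      using comp[OF _ sub[OF d(1,3)]] d(2) unfolding mb[OF d(2), of \<zeta>] by simp
    finally have "?X * ?x ^ N \<le> C * ?Y" .
    then have XY: "\<kappa> * t ^ (2 * N) * ?X \<le> ?Y"
    proof -
      have "\<kappa> * t ^ (2 * N) = ?x ^ N / C"
        unfolding \<kappa>_def power_mult by (simp add: power_divide power_mult_distrib)
      with \<open>?X * ?x ^ N \<le> C * ?Y\<close> C show ?thesis by (simp add: pos_divide_le_eq mult.commute)
    qed
    have "emeasure ?M (ball z \<rho>) \<le> emeasure ?M ?Q"
    proof (rule emeasure_mono)
      show "ball z \<rho> \<subseteq> ?Q" using r by (intro sub) (simp_all add: \<rho>_def)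
    qed (simp add: sets_weight_measure square_eq_cbox)
    also have "\<dots> = ennreal ?X"
      by (rule emeasure_weight_measure_integral[OF w _ order_refl]) (simp add: square_eq_cbox)
    finally have "ennreal (\<kappa> * t ^ (2 * N)) * emeasure ?M (ball z \<rho>) \<le> ennreal (\<kappa> * t ^ (2 * N)) * ennreal ?X"
      by (intro mult_left_mono) simp_all
    also have "\<dots> = ennreal (\<kappa> * t ^ (2 * N) * ?X)"
      using X0 C by (intro ennreal_mult[symmetric]) (simp_all add: \<kappa>_def)
    also have "\<dots> \<le> emeasure ?M (ball \<zeta> t)"
      unfolding em[OF d(1,3)] by (intro ennreal_leI XY)
    finally show "ennreal (\<kappa> * t ^ (2 * N)) * emeasure ?M (ball z \<rho>) \<le> emeasure ?M (ball \<zeta> t)" .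
  qed (use r C \<alpha> N in \<open>auto simp: \<rho>_def \<kappa>_def sets_weight_measure\<close>)
  then show ?thesis by blast
qed

section \<open>Toeplitz operators\<close>

lemma divide_le_divide_ennreal:
  assumes "ennreal d \<le> b" "0 < d"
  shows "a / b \<le> a / ennreal d"
proof (cases b rule: ennreal_cases)
  case (real m)
  then have "d \<le> m" using assms by (simp add: ennreal_le_iff)
  then have "inverse (ennreal m) \<le> inverse (ennreal d)"
    using assms(2) by (simp add: inverse_ennreal ennreal_leI le_imp_inverse_le)
  then show ?thesis unfolding divide_ennreal_def real by (rule mult_left_mono) simp
qed simp

lemma Limsup_ennreal_mult_le:
  fixes f g :: "'a \<Rightarrow> ennreal"
  assumes c: "0 < c" and le: "\<And>x. ennreal c * f x \<le> g x"
  shows "ennreal c * Limsup F f \<le> Limsup F g"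
proof (rule dense_ge)
  fix y assume y: "Limsup F g < y"
  have *: "x \<le> ennreal (1 / c) * y" if "ennreal c * x \<le> y" for x y
  proof -
    have "x = ennreal (1 / c) * (ennreal c * x)" using c by (simp add: mult.assoc[symmetric] ennreal_mult[symmetric])
    also have "\<dots> \<le> ennreal (1 / c) * y" by (intro mult_left_mono that) simp
    finally show ?thesis .
  qed
  have "\<forall>\<^sub>F x in F. f x \<le> ennreal (1 / c) * y"
    using Limsup_lessD[OF y]
  proof eventually_elim
    case (elim x)
    then show ?case using le[of x] by (intro *) simp
  qed
  then have "Limsup F f \<le> ennreal (1 / c) * y" by (rule Limsup_bounded)
  then have "ennreal c * Limsup F f \<le> ennreal c * (ennreal (1 / c) * y)" by (rule mult_left_mono) simp
  also have "\<dots> = y" using c by (simp add: mult.assoc[symmetric] ennreal_mult[symmetric])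
  finally show "ennreal c * Limsup F f \<le> y" .
qed

text \<open>A density keeps the Borel sets of the whole plane, so the result is again a measure to
  which the Carleson and Toeplitz lemmas apply.\<close>

definition restrict_to :: "'a set \<Rightarrow> 'a measure \<Rightarrow> 'a measure" where
  "restrict_to E \<mu> = density \<mu> (indicator E)"

lemma sets_restrict_to: "sets (restrict_to E \<mu>) = sets \<mu>"
  by (simp add: restrict_to_def)

lemma emeasure_restrict_to: "E \<in> sets \<mu> \<Longrightarrow> F \<in> sets \<mu> \<Longrightarrow> emeasure (restrict_to E \<mu>) F = emeasure \<mu> (E \<inter> F)"
  unfolding restrict_to_def
  by (subst emeasure_density)
    (simp_all add: indicator_inter_arith[symmetric] nn_integral_indicator[symmetric] del: nn_integral_indicator)

locale weighted_fock = doubling_fock \<alpha> \<rho> \<kappa> N "weight_measure w"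
  for \<alpha> \<rho> \<kappa> N w +
  assumes w: "weight w"
begin

abbreviation M :: "complex measure" where "M \<equiv> weight_measure w"

section \<open>Fock space notions in terms of \<open>holL2\<close>, \<open>ip\<close> and
  \<open>kern\<close>\<close>

lemma
  fixes g :: "complex \<Rightarrow> 'a :: {banach, second_countable_topology}"
  assumes g: "g \<in> borel_measurable borel"
  shows integrable_P: "integrable P g \<longleftrightarrow> integrable lebesgue (\<lambda>z. (gauss z * w z) *\<^sub>R g z)"
    and integral_P: "(LINT z|P. g z) = (LINT z|lebesgue. (gauss z * w z) *\<^sub>R g z)"
proof -
  note [measurable] = g weight_borel_measurable[OF w]
  have [measurable]: "g \<in> borel_measurable lebesgue" "gauss \<in> borel_measurable lebesgue"
    by (rule measurable_completion, simp)+
  have [measurable]: "(\<lambda>z. z) \<in> density lebesgue (\<lambda>z. ennreal (w z)) \<rightarrow>\<^sub>M borel"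
    unfolding measurable_density_eq1 by (rule measurable_completion) simp
  have gM: "g \<in> borel_measurable M" "gauss \<in> borel_measurable M"
    using g gauss_measurable sets_weight_measure measurable_cong_sets by blast+
  have 1: "integrable P g \<longleftrightarrow> integrable M (\<lambda>z. gauss z *\<^sub>R g z)"
    unfolding P_def using gM gauss_pos by (intro integrable_density) (auto simp: less_imp_le)
  also have "\<dots> \<longleftrightarrow> integrable (density lebesgue (\<lambda>z. ennreal (w z))) (\<lambda>z. gauss z *\<^sub>R g z)"
    unfolding weight_measure_def by (rule integrable_distr_eq) simp_all
  also have "\<dots> \<longleftrightarrow> integrable lebesgue (\<lambda>z. w z *\<^sub>R gauss z *\<^sub>R g z)"
    using weight_nonneg[OF w] by (intro integrable_density) simp_all
  finally show "integrable P g \<longleftrightarrow> integrable lebesgue (\<lambda>z. (gauss z * w z) *\<^sub>R g z)"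
    by (simp add: mult.commute)
  have "(LINT z|P. g z) = (LINT z|M. gauss z *\<^sub>R g z)"
    unfolding P_def using gM gauss_pos by (intro integral_density) (auto simp: less_imp_le)
  also have "\<dots> = (LINT z|density lebesgue (\<lambda>z. ennreal (w z)). gauss z *\<^sub>R g z)"
    unfolding weight_measure_def by (rule integral_distr) simp_all
  also have "\<dots> = (LINT z|lebesgue. w z *\<^sub>R gauss z *\<^sub>R g z)"
    using weight_nonneg[OF w] by (intro integral_density) simp_all
  finally show "(LINT z|P. g z) = (LINT z|lebesgue. (gauss z * w z) *\<^sub>R g z)"
    by (simp add: mult.commute)
qed

lemma fock_space_eq: "fock_space \<alpha> w = holL2 P"
proof -
  have "integrable P (\<lambda>z. (cmod (f z))\<^sup>2) \<longleftrightarrow>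
      integrable lebesgue (\<lambda>z. (cmod (f z))\<^sup>2 * exp (- \<alpha> * (cmod z)\<^sup>2) * w z)"
    if "f holomorphic_on UNIV" for f
  proof -
    note [measurable] = entire_borel[OF that]
    show ?thesis by (subst integrable_P) (simp_all add: gauss_def mult_ac)
  qed
  then show ?thesis unfolding fock_space_def holL2_def by blast
qed

lemma fock_norm_eq:
  assumes "f \<in> holL2 P"
  shows "fock_norm \<alpha> w f = sqrt (nrm2 P f)"
proof -
  have "f holomorphic_on UNIV" using assms by (simp add: holL2_def)
  note [measurable] = entire_borel[OF this]
  show ?thesis unfolding fock_norm_def nrm2_def
    by (subst integral_P) (simp_all add: gauss_def mult_ac)
qed

lemma fock_inner_eq:
  assumes "f \<in> holL2 P" "g \<in> holL2 P"
  shows "fock_inner \<alpha> w f g = ip P f g"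
proof -
  have "f holomorphic_on UNIV" "g holomorphic_on UNIV" using assms by (simp_all add: holL2_def)
  note [measurable] = this[THEN entire_borel]
  have [measurable]: "(\<lambda>z. f z * cnj (g z)) \<in> borel_measurable borel"
    by (intro borel_measurable_times borel_measurable_continuous_on[of cnj] continuous_intros) simp_all
  show ?thesis unfolding fock_inner_def ip_def
    by (subst integral_P) (simp_all add: gauss_def scaleR_conv_of_real mult_ac)
qed

lemma rep_kernel_eq: "rep_kernel \<alpha> w z = kern z"
proof -
  have "(g \<in> holL2 P \<and> (\<forall>f\<in>holL2 P. f z = fock_inner \<alpha> w f g)) \<longleftrightarrow>
      (g \<in> holL2 P \<and> (\<forall>f\<in>holL2 P. f z = ip P f g))" for g
    by (rule conj_cong[OF refl], rule ball_cong[OF refl]) (simp add: fock_inner_eq)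
  then show ?thesis unfolding rep_kernel_def kern_def fock_space_eq by simp
qed

text \<open>Absorbs the Gaussian of \<open>toeplitz_integrand\<close> into the measure, which brings
  Toeplitz operators into the form of \<open>toeplitz_carleson\<close>.\<close>

definition gaussian_density :: "complex measure \<Rightarrow> complex measure" where
  "gaussian_density \<nu> = density \<nu> (\<lambda>z. ennreal (gauss z))"

lemma sets_gaussian_density: "sets (gaussian_density \<nu>) = sets \<nu>"
  by (simp add: gaussian_density_def)

lemma kern_entire: "kern z holomorphic_on UNIV"
  using kern_holL2[of z] by (simp add: holL2_def)

lemma kern_product_measurable:
  assumes "sets \<nu> = sets borel" "f holomorphic_on UNIV"
  shows "(\<lambda>u. f u * cnj (kern z u)) \<in> borel_measurable \<nu>"
proof -
  note [measurable] = assms(2)[THEN entire_borel_measurable, OF assms(1)]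
    kern_entire[THEN entire_borel_measurable, OF assms(1)]
  show ?thesis
    by (intro borel_measurable_times borel_measurable_continuous_on[of cnj] continuous_intros) simp_all
qed

lemma gauss_measurable_sets: "sets \<nu> = sets borel \<Longrightarrow> gauss \<in> borel_measurable \<nu>"
  using gauss_measurable measurable_cong_sets by blast

lemma toeplitz_integrand_eq: "toeplitz_integrand \<alpha> w f z u = gauss u *\<^sub>R (f u * cnj (kern z u))"
  unfolding toeplitz_integrand_def rep_kernel_eq gauss_def scaleR_conv_of_real by (simp add: mult_ac)

lemma toeplitz_gaussian_density:
  assumes "sets \<nu> = sets borel" "f holomorphic_on UNIV"
  shows "(LINT u|gaussian_density \<nu>. f u * cnj (kern z u)) = toeplitz \<alpha> w \<nu> f z"
    and "integrable (gaussian_density \<nu>) (\<lambda>u. f u * cnj (kern z u))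
      \<longleftrightarrow> integrable \<nu> (toeplitz_integrand \<alpha> w f z)"
proof -
  note m = kern_product_measurable[OF assms, of z] gauss_measurable_sets[OF assms(1)]
  show "(LINT u|gaussian_density \<nu>. f u * cnj (kern z u)) = toeplitz \<alpha> w \<nu> f z"
    unfolding toeplitz_def toeplitz_integrand_eq gaussian_density_def
    by (rule integral_density) (use m in \<open>auto simp: gauss_pos less_imp_le\<close>)
  have "integrable (gaussian_density \<nu>) (\<lambda>u. f u * cnj (kern z u))
      \<longleftrightarrow> integrable \<nu> (\<lambda>u. gauss u *\<^sub>R (f u * cnj (kern z u)))"
    unfolding gaussian_density_def
    by (rule integrable_density) (use m in \<open>auto simp: gauss_pos less_imp_le\<close>)
  then show "integrable (gaussian_density \<nu>) (\<lambda>u. f u * cnj (kern z u))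
      \<longleftrightarrow> integrable \<nu> (toeplitz_integrand \<alpha> w f z)"
    unfolding toeplitz_integrand_eq[abs_def] .
qed

lemma nn_integral_gaussian_density:
  assumes "sets \<nu> = sets borel" "f holomorphic_on UNIV"
  shows "(\<integral>\<^sup>+u. ennreal ((cmod (f u))\<^sup>2) \<partial>gaussian_density \<nu>) = (\<integral>\<^sup>+u. ennreal ((cmod (f u))\<^sup>2 * gauss u) \<partial>\<nu>)"
proof -
  note [measurable] = gauss_measurable_sets[OF assms(1)] entire_borel_measurable[OF assms(2,1)]
  show ?thesis unfolding gaussian_density_def
    by (subst nn_integral_density)
      (simp_all add: ennreal_mult[symmetric] gauss_pos less_imp_le mult.commute)
qed

section \<open>Berezin transform of a bounded Toeplitz operator\<close>

text \<open>At \<open>f = kern z\<close>, evaluated at \<open>z\<close>, the Toeplitz integrand is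
  nonnegative, and its absolute convergence makes the Berezin transform a finite number
  \<open>b\<close>; dividing by \<open>K z\<close> normalizes the kernel.\<close>

lemma toeplitz_bounded_kern:
  assumes \<mu>: "sets \<mu> = sets borel" and "toeplitz_bounded \<alpha> w \<mu>"
  obtains b where "0 \<le> b" "berezin \<alpha> w \<mu> z = ennreal b" "toeplitz \<alpha> w \<mu> (kern z) z = of_real (b * K z)"
    "(\<integral>\<^sup>+u. ennreal ((cmod (kern z u))\<^sup>2 * gauss u) \<partial>\<mu>) = ennreal (b * K z)"
proof -
  have int: "integrable \<mu> (toeplitz_integrand \<alpha> w (kern z) z)"
    using assms(2) kern_holL2 unfolding toeplitz_bounded_def fock_space_eq by blast
  have eq: "toeplitz_integrand \<alpha> w (kern z) z = (\<lambda>u. of_real ((cmod (kern z u))\<^sup>2 * gauss u))"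
    unfolding toeplitz_integrand_eq[abs_def] scaleR_conv_of_real complex_norm_square[symmetric]
    by (simp add: mult.commute)
  have int': "integrable \<mu> (\<lambda>u. (cmod (kern z u))\<^sup>2 * gauss u)"
    using int unfolding eq complex_of_real_integrable_eq .
  define J where "J = (LINT u|\<mu>. (cmod (kern z u))\<^sup>2 * gauss u)"
  have J0: "0 \<le> J" unfolding J_def using gauss_pos by (simp add: less_imp_le)
  have nn: "(\<integral>\<^sup>+u. ennreal ((cmod (kern z u))\<^sup>2 * gauss u) \<partial>\<mu>) = ennreal J"
    unfolding J_def by (rule nn_integral_eq_integral[OF int']) (simp add: gauss_pos less_imp_le)
  note [measurable] = gauss_measurable_sets[OF \<mu>] entire_borel_measurable[OF kern_entire \<mu>]
  have "berezin \<alpha> w \<mu> z = (\<integral>\<^sup>+u. ennreal (1 / K z) * ennreal ((cmod (kern z u))\<^sup>2 * gauss u) \<partial>\<mu>)"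
    unfolding berezin_def
  proof (rule nn_integral_cong)
    fix u
    have "(cmod (normalized_kernel \<alpha> w z u))\<^sup>2 = (cmod (kern z u))\<^sup>2 / K z"
      unfolding normalized_kernel_def rep_kernel_eq fock_norm_eq[OF kern_holL2]
      using nrm2_nonneg[of P "kern z"] by (simp add: norm_divide power_divide)
    then have "(cmod (normalized_kernel \<alpha> w z u))\<^sup>2 * exp (- \<alpha> * (cmod u)\<^sup>2)
        = 1 / K z * ((cmod (kern z u))\<^sup>2 * gauss u)"
      by (simp add: gauss_def)
    moreover have "ennreal (1 / K z * ((cmod (kern z u))\<^sup>2 * gauss u))
        = ennreal (1 / K z) * ennreal ((cmod (kern z u))\<^sup>2 * gauss u)"
      using K_pos[of z] gauss_pos[of u] by (intro ennreal_mult) simp_all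
    ultimately show "ennreal ((cmod (normalized_kernel \<alpha> w z u))\<^sup>2 * exp (- \<alpha> * (cmod u)\<^sup>2))
        = ennreal (1 / K z) * ennreal ((cmod (kern z u))\<^sup>2 * gauss u)"
      by (simp only:)
  qed
  also have "\<dots> = ennreal (1 / K z) * ennreal J"
    unfolding nn[symmetric] by (rule nn_integral_cmult) simp
  also have "\<dots> = ennreal (J / K z)"
    using K_pos[of z] J0 by (simp add: ennreal_mult[symmetric])
  finally have 1: "berezin \<alpha> w \<mu> z = ennreal (J / K z)" .
  have JK: "J / K z * K z = J" using K_pos[of z] by simp
  have 2: "toeplitz \<alpha> w \<mu> (kern z) z = of_real J"
    unfolding toeplitz_def eq J_def by (rule integral_complex_of_real)
  show ?thesis
  proof (rule that[of "J / K z"])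
    show "0 \<le> J / K z" using J0 K_pos[of z] by simp
  qed (simp_all only: 1 2 JK nn)
qed

text \<open>Only the part of the Berezin integral over \<open>ball z r\<close> is kept, where
  \<open>kern_off_diagonal\<close> bounds the integrand from below. \<open>\<delta>\<close> and
  \<open>c\<close> are chosen before \<open>\<mu>\<close>.\<close>

lemma berezin_lower_bound:
  "\<exists>\<delta>>0. \<exists>c>0. \<forall>\<mu> z r. sets \<mu> = sets borel \<longrightarrow> toeplitz_bounded \<alpha> w \<mu> \<longrightarrow> r \<le> \<delta> \<longrightarrow>
    ennreal (c / v z) * emeasure \<mu> (ball z r) \<le> berezin \<alpha> w \<mu> z"
proof -
  obtain \<delta> c where \<delta>: "0 < \<delta>" and c: "0 < c"
    and off: "\<And>z \<xi>. dist z \<xi> < \<delta> \<Longrightarrow> c * K z \<le> (cmod (kern z \<xi>))\<^sup>2 * gauss \<xi> * v z"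
    using kern_off_diagonal by metis
  have "ennreal (c / v z) * emeasure \<mu> (ball z r) \<le> berezin \<alpha> w \<mu> z"
    if \<mu>: "sets \<mu> = sets borel" and T: "toeplitz_bounded \<alpha> w \<mu>" and r: "r \<le> \<delta>" for \<mu> z r
  proof -
    obtain b where b: "0 \<le> b" "berezin \<alpha> w \<mu> z = ennreal b"
      "(\<integral>\<^sup>+u. ennreal ((cmod (kern z u))\<^sup>2 * gauss u) \<partial>\<mu>) = ennreal (b * K z)"
      by (rule toeplitz_bounded_kern[OF \<mu> T, of z]) blast
    have "ennreal (c * K z / v z) * emeasure \<mu> (ball z r)
        = (\<integral>\<^sup>+u. ennreal (c * K z / v z) * indicator (ball z r) u \<partial>\<mu>)"
      by (rule nn_integral_cmult_indicator[symmetric]) (simp add: \<mu>)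
    also have "\<dots> \<le> (\<integral>\<^sup>+u. ennreal ((cmod (kern z u))\<^sup>2 * gauss u) \<partial>\<mu>)"
    proof (rule nn_integral_mono)
      fix u
      show "ennreal (c * K z / v z) * indicator (ball z r) u \<le> ennreal ((cmod (kern z u))\<^sup>2 * gauss u)"
      proof (cases "u \<in> ball z r")
        case True
        then have "c * K z \<le> (cmod (kern z u))\<^sup>2 * gauss u * v z" using r by (intro off) simp
        then have "c * K z / v z \<le> (cmod (kern z u))\<^sup>2 * gauss u" using v_pos[of z] by (simp add: pos_divide_le_eq)
        then show ?thesis using True by (simp add: ennreal_leI)
      qed simp
    qed
    finally have le: "ennreal (c * K z / v z) * emeasure \<mu> (ball z r) \<le> ennreal (b * K z)" unfolding b(3) .
    have "ennreal (c / v z) * emeasure \<mu> (ball z r) = ennreal (1 / K z) * (ennreal (c * K z / v z) * emeasure \<mu> (ball z r))"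
      using K_pos[of z] c v_pos[of z] by (simp add: mult.assoc[symmetric] ennreal_mult[symmetric])
    also have "\<dots> \<le> ennreal (1 / K z) * ennreal (b * K z)" by (intro mult_left_mono le) simp
    also have "\<dots> = ennreal b" using K_pos[of z] b(1) by (simp add: ennreal_mult[symmetric])
    finally show ?thesis unfolding b(2) .
  qed
  with \<delta> c show ?thesis by blast
qed

text \<open>The Berezin transform is finite at each point, so small disks have finite mass by
  \<open>berezin_lower_bound\<close>; finitely many of them cover a large disk.\<close>

lemma toeplitz_bounded_finite_on_balls:
  assumes \<mu>: "sets \<mu> = sets borel" and T: "toeplitz_bounded \<alpha> w \<mu>"
  shows "emeasure \<mu> (cball 0 R) < \<infinity>"
proof -
  obtain \<delta> c where \<delta>: "0 < \<delta>" and c: "0 < c"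
    and low: "\<And>z. ennreal (c / v z) * emeasure \<mu> (ball z \<delta>) \<le> berezin \<alpha> w \<mu> z"
    using berezin_lower_bound \<mu> T by (metis order_refl)
  have fin: "emeasure \<mu> (ball z \<delta>) < \<infinity>" for z
  proof -
    obtain b where "berezin \<alpha> w \<mu> z = ennreal b" by (rule toeplitz_bounded_kern[OF \<mu> T, of z]) blast
    then have "ennreal (c / v z) * emeasure \<mu> (ball z \<delta>) < \<infinity>"
      using low[of z] by (simp add: le_less_trans[OF _ ennreal_less_top])
    moreover have "0 < ennreal (c / v z)" using c v_pos[of z] by simp
    ultimately show ?thesis
      using c v_pos[of z]
      by (cases "emeasure \<mu> (ball z \<delta>) = top") (simp_all add: ennreal_mult_top less_top)
  qed
  have "cball 0 R \<subseteq> (\<Union>e\<in>cball (0::complex) R. ball e \<delta>)" using \<delta> by (auto intro!: bexI)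
  then obtain F where F: "F \<subseteq> cball (0::complex) R" "finite F" "cball 0 R \<subseteq> (\<Union>e\<in>F. ball e \<delta>)"
    by (rule compactE_image[OF compact_cball open_ball])
  have "emeasure \<mu> (cball 0 R) \<le> emeasure \<mu> (\<Union>e\<in>F. ball e \<delta>)"
    using F(2,3) by (intro emeasure_mono) (auto simp: \<mu>)
  also have "\<dots> \<le> (\<Sum>e\<in>F. emeasure \<mu> (ball e \<delta>))"
    using F(2) by (intro emeasure_subadditive_finite) (auto simp: \<mu>)
  also have "\<dots> < \<infinity>" using F(2) fin by simp
  finally show ?thesis .
qed

lemma fock_opnorm_bound:
  assumes "fock_opnorm \<alpha> w T \<le> ennreal y" "0 \<le> y" "f \<in> holL2 P" "nrm2 P f \<le> 1"
    and "T f \<in> holL2 P"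
  shows "nrm2 P (T f) \<le> y\<^sup>2"
proof -
  have "fock_norm \<alpha> w f \<le> 1" using assms(4) by (simp add: fock_norm_eq[OF assms(3)])
  then have "ennreal (fock_norm \<alpha> w (T f)) \<le> fock_opnorm \<alpha> w T"
    unfolding fock_opnorm_def using assms(3) by (intro SUP_upper) (simp add: fock_space_eq)
  also note assms(1)
  finally have "sqrt (nrm2 P (T f)) \<le> y" using assms(2) by (simp add: fock_norm_eq[OF assms(5)] ennreal_le_iff)
  then show ?thesis by (simp add: real_sqrt_le_iff' sqrt_le_D)
qed

section \<open>Lower bound for the essential norm\<close>

text \<open>For the normalized kernel \<open>f n\<close> at \<open>s n\<close>, the value of its
  Toeplitz image at \<open>s n\<close> is the Berezin transform times \<open>sqrt (K (s n))\<close>.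
  Compactness gives a norm limit \<open>g\<close> of \<open>K0 (f n)\<close> along a subsequence,
  and the values of \<open>g\<close>, divided by the same root, tend to 0. What remains is
  controlled by the operator norm of the difference, with constant 1.\<close>

lemma berezin_le_opnorm_compact_perturbation:
  assumes \<mu>: "sets \<mu> = sets borel" and T: "toeplitz_bounded \<alpha> w \<mu>" and K0: "fock_compact \<alpha> w K0"
  shows "Limsup at_infinity (berezin \<alpha> w \<mu>) \<le> fock_opnorm \<alpha> w (\<lambda>f z. toeplitz \<alpha> w \<mu> f z - K0 f z)"
proof (rule ccontr)
  assume "\<not> ?thesis"
  then have "fock_opnorm \<alpha> w (\<lambda>f z. toeplitz \<alpha> w \<mu> f z - K0 f z) < Limsup at_infinity (berezin \<alpha> w \<mu>)"
    by (simp add: not_le)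
  from dense[OF this] obtain y' where y': "fock_opnorm \<alpha> w (\<lambda>f z. toeplitz \<alpha> w \<mu> f z - K0 f z) < y'"
      "y' < Limsup at_infinity (berezin \<alpha> w \<mu>)"
    by blast
  obtain y where y: "fock_opnorm \<alpha> w (\<lambda>f z. toeplitz \<alpha> w \<mu> f z - K0 f z) = ennreal y" "0 \<le> y"
    using y'(1) by (cases "fock_opnorm \<alpha> w (\<lambda>f z. toeplitz \<alpha> w \<mu> f z - K0 f z)" rule: ennreal_cases) auto
  obtain x where x: "y' = ennreal x" "0 \<le> x"
    using y'(2) by (cases y' rule: ennreal_cases) auto
  have yx: "y < x" using y'(1) y(2) x by (simp add: y(1) ennreal_less_iff)
  have "\<exists>z. real n \<le> cmod z \<and> y' < berezin \<alpha> w \<mu> z" for n :: nat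
  proof (rule ccontr)
    assume "\<not> (\<exists>z. real n \<le> cmod z \<and> y' < berezin \<alpha> w \<mu> z)"
    then have "\<forall>\<^sub>F z in at_infinity. berezin \<alpha> w \<mu> z \<le> y'"
      unfolding eventually_at_infinity by (auto simp: not_less)
    then have "Limsup at_infinity (berezin \<alpha> w \<mu>) \<le> y'" by (rule Limsup_bounded)
    with y'(2) show False by simp
  qed
  then obtain s where s: "\<And>n. real n \<le> cmod (s n)" "\<And>n. y' < berezin \<alpha> w \<mu> (s n)" by metis
  define f where "f n = (\<lambda>u. of_real (1 / sqrt (K (s n))) * kern (s n) u)" for n
  have fL: "f n \<in> holL2 P" for n unfolding f_def by (intro scale_holL2 kern_holL2)
  have f1: "nrm2 P (f n) = 1" for n
    unfolding f_def nrm2_scale using K_pos[of "s n"] by (simp add: norm_divide power_divide)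
  have K0L: "K0 g \<in> holL2 P" if "g \<in> holL2 P" for g
    using K0 that unfolding fock_compact_def fock_operator_def fock_space_eq by blast
  have TL: "toeplitz \<alpha> w \<mu> g \<in> holL2 P" if "g \<in> holL2 P" for g
    using T that unfolding toeplitz_bounded_def fock_space_eq by blast
  have "(\<forall>n. f n \<in> fock_space \<alpha> w) \<and> bdd_above (range (\<lambda>n. fock_norm \<alpha> w (f n)))"
    using fL by (simp add: fock_space_eq fock_norm_eq f1)
  then have "\<exists>\<sigma>. strict_mono \<sigma> \<and> (\<exists>g\<in>fock_space \<alpha> w.
      (\<lambda>n. fock_norm \<alpha> w (\<lambda>z. K0 (f (\<sigma> n)) z - g z)) \<longlonglongrightarrow> 0)"
    using K0 unfolding fock_compact_def by simp
  then obtain \<sigma> g where \<sigma>: "strict_mono \<sigma>" and g: "g \<in> holL2 P"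
    and lim: "(\<lambda>n. fock_norm \<alpha> w (\<lambda>z. K0 (f (\<sigma> n)) z - g z)) \<longlonglongrightarrow> 0"
    unfolding fock_space_eq by (elim exE conjE bexE)
  define e where "e n = sqrt (nrm2 P (\<lambda>z. K0 (f (\<sigma> n)) z - g z))" for n
  have e: "e \<longlonglongrightarrow> 0"
    using lim unfolding e_def by (subst (asm) fock_norm_eq) (auto intro!: diff_holL2 K0L fL g)
  define d where "d n = cmod (g (s (\<sigma> n))) / sqrt (K (s (\<sigma> n)))" for n
  have "filterlim (\<lambda>n. s (\<sigma> n)) at_infinity sequentially"
    unfolding filterlim_at_infinity_conv_norm_at_top
  proof (rule filterlim_at_top_mono[OF filterlim_real_sequentially always_eventually], rule allI)
    fix n
    have "real n \<le> real (\<sigma> n)" using seq_suble[OF \<sigma>, of n] by simp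
    then show "real n \<le> cmod (s (\<sigma> n))" using s(1)[of "\<sigma> n"] by linarith
  qed
  from normalized_kernel_weakly_null[OF g this]
  have "(\<lambda>n. sqrt ((cmod (g (s (\<sigma> n))))\<^sup>2 / K (s (\<sigma> n)))) \<longlonglongrightarrow> sqrt 0" by (rule tendsto_real_sqrt)
  then have d: "d \<longlonglongrightarrow> 0" unfolding d_def by (simp add: real_sqrt_divide)
  have "x \<le> y + (e n + d n)" for n
  proof -
    let ?z = "s (\<sigma> n)" and ?f = "f (\<sigma> n)"
    let ?k = "sqrt (K ?z)"
    have k: "0 < ?k" "?k\<^sup>2 = K ?z" using K_pos[of ?z] by simp_all
    obtain b where b: "0 \<le> b" "berezin \<alpha> w \<mu> ?z = ennreal b" "toeplitz \<alpha> w \<mu> (kern ?z) ?z = of_real (b * K ?z)"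
      by (rule toeplitz_bounded_kern[OF \<mu> T, of ?z]) blast
    have xb: "x < b" using s(2)[of "\<sigma> n"] x b by (simp add: ennreal_less_iff)
    have "toeplitz \<alpha> w \<mu> ?f ?z = of_real (1 / ?k) * toeplitz \<alpha> w \<mu> (kern ?z) ?z"
      unfolding toeplitz_def toeplitz_integrand_def f_def mult.assoc
      by (rule integral_mult_right_zero)
    also have "\<dots> = of_real (1 / ?k * (b * K ?z))" unfolding b(3) by (rule of_real_mult[symmetric])
    also have "1 / ?k * (b * K ?z) = b * ?k"
    proof -
      have *: "1 / c * (b * c\<^sup>2) = b * c" if "0 < c" for c :: real using that by (simp add: power2_eq_square)
      show ?thesis using *[OF k(1)] unfolding k(2) .
    qed
    finally have Tz: "cmod (toeplitz \<alpha> w \<mu> ?f ?z) = b * ?k" using b(1) k(1) by (simp add: norm_mult)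
    let ?D = "\<lambda>u. toeplitz \<alpha> w \<mu> ?f u - K0 ?f u"
    have DL: "?D \<in> holL2 P" by (intro diff_holL2 TL K0L fL)
    have "nrm2 P ?D \<le> y\<^sup>2"
      using fock_opnorm_bound[of "\<lambda>f z. toeplitz \<alpha> w \<mu> f z - K0 f z" y ?f] y fL f1 DL by simp
    then have "sqrt (nrm2 P ?D) \<le> y" using y(2) by (simp add: real_le_lsqrt)
    have ev: "cmod (h ?z) \<le> sqrt (nrm2 P h) * ?k" if "h \<in> holL2 P" for h
      using real_sqrt_le_mono[OF eval_le_kern[OF that, of ?z]] by (simp add: real_sqrt_mult)
    have 1: "cmod (?D ?z) \<le> y * ?k"
      using ev[OF DL] mult_right_mono[OF \<open>sqrt (nrm2 P ?D) \<le> y\<close>, of ?k] k(1) by linarith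
    have 2: "cmod (K0 ?f ?z - g ?z) \<le> e n * ?k"
      using ev[OF diff_holL2[OF K0L[OF fL] g]] unfolding e_def .
    have 3: "cmod (g ?z) = d n * ?k" using k(1) by (simp add: d_def)
    \<comment> \<open>The Toeplitz image at \<open>?z\<close> is split into the difference with
      \<open>K0 ?f\<close>, the deviation of \<open>K0 ?f\<close> from \<open>g\<close>, and
      \<open>g\<close>; each is a coefficient times \<open>?k\<close>, which finally
      cancels.\<close>
    have "cmod (a + (b + c)) \<le> cmod a + (cmod b + cmod c)" for a b c :: complex
      by (rule order_trans[OF norm_triangle_ineq add_left_mono[OF norm_triangle_ineq]])
    from this[of "?D ?z" "K0 ?f ?z - g ?z" "g ?z"]
    have "b * ?k \<le> cmod (?D ?z) + (cmod (K0 ?f ?z - g ?z) + cmod (g ?z))"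
      unfolding Tz[symmetric] by simp
    also have "\<dots> \<le> (y + (e n + d n)) * ?k" using 1 2 3 by (simp add: algebra_simps)
    finally have "b \<le> y + (e n + d n)" using k(1) by (rule_tac mult_right_le_imp_le)
    with xb show ?thesis by linarith
  qed
  moreover have "(\<lambda>n. y + (e n + d n)) \<longlonglongrightarrow> y"
    using tendsto_add[OF tendsto_const[of y] tendsto_add[OF e d]] by simp
  ultimately have "x \<le> y" by (intro LIMSEQ_le_const) auto
  with yx show False by simp
qed

section \<open>Splitting the measure; compactness of the inner part\<close>

lemma toeplitz_split:
  assumes \<mu>: "sets \<mu> = sets borel" and E: "E \<in> sets borel" and f: "f holomorphic_on UNIV"
    and int: "integrable \<mu> (toeplitz_integrand \<alpha> w f z)"
  shows "toeplitz \<alpha> w \<mu> f z = toeplitz \<alpha> w (restrict_to E \<mu>) f z + toeplitz \<alpha> w (restrict_to (- E) \<mu>) f z"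
proof -
  let ?h = "toeplitz_integrand \<alpha> w f z"
  have hm[measurable]: "?h \<in> borel_measurable \<mu>" using int by (rule borel_measurable_integrable)
  have E\<mu>[measurable]: "E \<in> sets \<mu>" "- E \<in> sets \<mu>" using E by (simp_all add: \<mu> borel_comp)
  have r: "toeplitz \<alpha> w (restrict_to F \<mu>) f z = (LINT u|\<mu>. indicator F u *\<^sub>R ?h u)" if "F \<in> sets \<mu>" for F
  proof -
    have [measurable]: "F \<in> sets \<mu>" by (rule that)
    have "density \<mu> (indicator F) = density \<mu> (\<lambda>u. ennreal (indicator F u))"
      by (rule arg_cong2[of _ _ _ _ density]) (auto simp: indicator_def)
    then show ?thesis unfolding toeplitz_def restrict_to_def
      by (simp only:) (rule integral_density, simp_all)
  qed
  have "toeplitz \<alpha> w \<mu> f z = (LINT u|\<mu>. indicator E u *\<^sub>R ?h u + indicator (- E) u *\<^sub>R ?h u)"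
    unfolding toeplitz_def by (intro Bochner_Integration.integral_cong) (auto simp: indicator_def)
  also have "\<dots> = (LINT u|\<mu>. indicator E u *\<^sub>R ?h u) + (LINT u|\<mu>. indicator (- E) u *\<^sub>R ?h u)"
    using int by (intro Bochner_Integration.integral_add integrable_mult_indicator E\<mu>)
  finally show ?thesis unfolding r[OF E\<mu>(1)] r[OF E\<mu>(2)] .
qed

text \<open>The third conclusion keeps the integral of the squared modulus over
  \<open>\<nu>\<close>: smallness of \<open>f\<close> where \<open>\<nu>\<close> lives makes the
  image small, which yields compactness. The fourth bounds the operator norm by
  \<open>C\<close>.\<close>

lemma carleson_toeplitz:
  assumes \<nu>: "sets \<nu> = sets borel" and C: "0 \<le> C"
    and carleson: "\<And>f. f \<in> holL2 P \<Longrightarrow> (\<integral>\<^sup>+u. ennreal ((cmod (f u))\<^sup>2 * gauss u) \<partial>\<nu>) \<le> ennreal (C * nrm2 P f)"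
    and f: "f \<in> holL2 P"
  shows "integrable \<nu> (toeplitz_integrand \<alpha> w f z)"
    and "toeplitz \<alpha> w \<nu> f \<in> holL2 P"
    and "ennreal (nrm2 P (toeplitz \<alpha> w \<nu> f)) \<le> ennreal C * (\<integral>\<^sup>+u. ennreal ((cmod (f u))\<^sup>2 * gauss u) \<partial>\<nu>)"
    and "nrm2 P (toeplitz \<alpha> w \<nu> f) \<le> C\<^sup>2 * nrm2 P f"
proof -
  have s: "sets (gaussian_density \<nu>) = sets borel" by (simp add: sets_gaussian_density \<nu>)
  have hol: "g holomorphic_on UNIV" if "g \<in> holL2 P" for g using that by (simp add: holL2_def)
  have c: "(\<integral>\<^sup>+u. ennreal ((cmod (g u))\<^sup>2) \<partial>gaussian_density \<nu>) \<le> ennreal (C * nrm2 P g)" if "g \<in> holL2 P" for g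
    unfolding nn_integral_gaussian_density[OF \<nu> hol[OF that]] by (rule carleson[OF that])
  have eq: "(\<lambda>z. LINT u|gaussian_density \<nu>. f u * cnj (kern z u)) = toeplitz \<alpha> w \<nu> f"
    using toeplitz_gaussian_density(1)[OF \<nu> hol[OF f]] by blast
  note t = toeplitz_carleson[OF s C c f, unfolded eq]
  show "integrable \<nu> (toeplitz_integrand \<alpha> w f z)"
    using t(1) unfolding toeplitz_gaussian_density(2)[OF \<nu> hol[OF f]] .
  show "toeplitz \<alpha> w \<nu> f \<in> holL2 P" by (rule t(2))
  show "nrm2 P (toeplitz \<alpha> w \<nu> f) \<le> C\<^sup>2 * nrm2 P f" by (rule t(4))
  have i: "integrable (gaussian_density \<nu>) (\<lambda>u. (cmod (f u))\<^sup>2)"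
    using c[OF f] entire_borel_measurable[OF hol[OF f] s]
    by (intro integrableI_bounded) (simp_all add: le_less_trans[OF _ ennreal_less_top])
  have "ennreal (LINT u|gaussian_density \<nu>. (cmod (f u))\<^sup>2) = (\<integral>\<^sup>+u. ennreal ((cmod (f u))\<^sup>2 * gauss u) \<partial>\<nu>)"
    unfolding nn_integral_gaussian_density[OF \<nu> hol[OF f], symmetric]
    by (rule nn_integral_eq_integral[OF i, symmetric]) simp
  moreover have "ennreal (nrm2 P (toeplitz \<alpha> w \<nu> f)) \<le> ennreal (C * (LINT u|gaussian_density \<nu>. (cmod (f u))\<^sup>2))"
    by (rule ennreal_leI[OF t(3)])
  ultimately show "ennreal (nrm2 P (toeplitz \<alpha> w \<nu> f)) \<le> ennreal C * (\<integral>\<^sup>+u. ennreal ((cmod (f u))\<^sup>2 * gauss u) \<partial>\<nu>)"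
    using C by (simp add: ennreal_mult')
qed

lemma toeplitz_integrand_lincomb:
  "toeplitz_integrand \<alpha> w (\<lambda>z. a * f z + b * g z) z u
    = a * toeplitz_integrand \<alpha> w f z u + b * toeplitz_integrand \<alpha> w g z u"
  by (simp add: toeplitz_integrand_def algebra_simps)

lemma toeplitz_lincomb:
  assumes "integrable \<nu> (toeplitz_integrand \<alpha> w f z)" "integrable \<nu> (toeplitz_integrand \<alpha> w g z)"
  shows "toeplitz \<alpha> w \<nu> (\<lambda>z. a * f z + b * g z) z = a * toeplitz \<alpha> w \<nu> f z + b * toeplitz \<alpha> w \<nu> g z"
  unfolding toeplitz_def toeplitz_integrand_lincomb using assms by simp

lemma gauss_le_1: "gauss u \<le> 1"
  using \<alpha> by (simp add: gauss_def)

lemma nn_integral_restrict_cball_le: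
  assumes \<mu>: "sets \<mu> = sets borel" and f: "f holomorphic_on UNIV"
    and le: "\<And>u. u \<in> cball 0 R \<Longrightarrow> (cmod (f u))\<^sup>2 \<le> B" and B: "0 \<le> B"
  shows "(\<integral>\<^sup>+u. ennreal ((cmod (f u))\<^sup>2 * gauss u) \<partial>restrict_to (cball 0 R) \<mu>) \<le> ennreal B * emeasure \<mu> (cball 0 R)"
proof -
  note [measurable] = gauss_measurable_sets[OF \<mu>] entire_borel_measurable[OF f \<mu>]
  have [measurable]: "cball 0 R \<in> sets \<mu>" by (simp add: \<mu>)
  have "(\<integral>\<^sup>+u. ennreal ((cmod (f u))\<^sup>2 * gauss u) \<partial>restrict_to (cball 0 R) \<mu>)
      = (\<integral>\<^sup>+u. indicator (cball 0 R) u * ennreal ((cmod (f u))\<^sup>2 * gauss u) \<partial>\<mu>)"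
    unfolding restrict_to_def by (rule nn_integral_density) simp_all
  also have "\<dots> \<le> (\<integral>\<^sup>+u. ennreal B * indicator (cball 0 R) u \<partial>\<mu>)"
  proof (rule nn_integral_mono)
    fix u
    show "indicator (cball 0 R) u * ennreal ((cmod (f u))\<^sup>2 * gauss u) \<le> ennreal B * indicator (cball 0 R) u"
    proof (cases "u \<in> cball 0 R")
      case True
      have "(cmod (f u))\<^sup>2 * gauss u \<le> B * 1"
        by (intro mult_mono le[OF True] gauss_le_1 B) (simp add: gauss_pos less_imp_le)
      then show ?thesis using True by (simp add: ennreal_leI)
    qed simp
  qed
  also have "\<dots> = ennreal B * emeasure \<mu> (cball 0 R)"
    by (rule nn_integral_cmult_indicator) simp
  finally show ?thesis .
qed

text \<open>A bounded sequence has a subsequence converging uniformly on \<open>cball 0 R\<close>,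
  hence in the mean with respect to the restricted measure, whose mass is finite; the third part of
  \<open>carleson_toeplitz\<close> turns this into norm convergence of the images.\<close>

lemma toeplitz_restrict_cball:
  assumes \<mu>: "sets \<mu> = sets borel" and fin: "emeasure \<mu> (cball 0 R) < \<infinity>"
  shows "fock_compact \<alpha> w (toeplitz \<alpha> w (restrict_to (cball 0 R) \<mu>))"
proof -
  let ?\<nu> = "restrict_to (cball 0 R) \<mu>"
  let ?T = "toeplitz \<alpha> w ?\<nu>"
  have \<nu>: "sets ?\<nu> = sets borel" by (simp add: sets_restrict_to \<mu>)
  obtain m where m: "emeasure \<mu> (cball 0 R) = ennreal m" "0 \<le> m"
    using fin by (cases "emeasure \<mu> (cball 0 R)" rule: ennreal_cases) auto
  obtain C0 where C0: "\<forall>f\<in>holL2 P. \<forall>z\<in>cball 0 R. (cmod (f z))\<^sup>2 \<le> C0 * nrm2 P f"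
    using eval_bound[of R] by (elim exE)
  define C where "C = \<bar>C0\<bar> * m"
  have C: "0 \<le> C" using m(2) by (simp add: C_def)
  have hol: "f holomorphic_on UNIV" if "f \<in> holL2 P" for f using that by (simp add: holL2_def)
  have carl: "(\<integral>\<^sup>+u. ennreal ((cmod (f u))\<^sup>2 * gauss u) \<partial>?\<nu>) \<le> ennreal (C * nrm2 P f)" if f: "f \<in> holL2 P" for f
  proof -
    have "(\<integral>\<^sup>+u. ennreal ((cmod (f u))\<^sup>2 * gauss u) \<partial>?\<nu>) \<le> ennreal (\<bar>C0\<bar> * nrm2 P f) * emeasure \<mu> (cball 0 R)"
    proof (rule nn_integral_restrict_cball_le[OF \<mu> hol[OF f]])
      fix u :: complex assume "u \<in> cball 0 R"
      then have "(cmod (f u))\<^sup>2 \<le> C0 * nrm2 P f" using C0 f by simp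
      also have "\<dots> \<le> \<bar>C0\<bar> * nrm2 P f" by (intro mult_right_mono nrm2_nonneg) simp
      finally show "(cmod (f u))\<^sup>2 \<le> \<bar>C0\<bar> * nrm2 P f" .
    qed (simp add: nrm2_nonneg)
    also have "\<dots> = ennreal (C * nrm2 P f)"
      unfolding m(1) using m(2) nrm2_nonneg[of P f] by (simp add: ennreal_mult[symmetric] C_def mult_ac)
    finally show ?thesis .
  qed
  have ct1: "integrable ?\<nu> (toeplitz_integrand \<alpha> w f z)" if "f \<in> holL2 P" for f z
    by (rule carleson_toeplitz(1)[OF \<nu> C carl that])
  have ct2: "?T f \<in> holL2 P" if "f \<in> holL2 P" for f
    by (rule carleson_toeplitz(2)[OF \<nu> C carl that])
  have ct3: "ennreal (nrm2 P (?T f)) \<le> ennreal C * (\<integral>\<^sup>+u. ennreal ((cmod (f u))\<^sup>2 * gauss u) \<partial>?\<nu>)"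
    if "f \<in> holL2 P" for f
    by (rule carleson_toeplitz(3)[OF \<nu> C carl that])
  have lin: "?T (\<lambda>z. a * f z + b * g z) = (\<lambda>z. a * ?T f z + b * ?T g z)"
    if "f \<in> holL2 P" "g \<in> holL2 P" for f g a b
    using toeplitz_lincomb[OF ct1[OF that(1)] ct1[OF that(2)]] by (intro ext)
  have "\<exists>\<sigma>. strict_mono \<sigma> \<and> (\<exists>g\<in>holL2 P. (\<lambda>n. fock_norm \<alpha> w (\<lambda>z. ?T (s (\<sigma> n)) z - g z)) \<longlonglongrightarrow> 0)"
    if s: "\<And>n. s n \<in> holL2 P" and bdd: "bdd_above (range (\<lambda>n. fock_norm \<alpha> w (s n)))" for s :: "nat \<Rightarrow> complex \<Rightarrow> complex"
  proof -
    from bdd obtain B where "\<forall>x\<in>range (\<lambda>n. fock_norm \<alpha> w (s n)). x \<le> B"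
      unfolding bdd_above_def by (elim exE)
    then have B: "fock_norm \<alpha> w (s n) \<le> B" for n by simp
    have nB: "nrm2 P (s n) \<le> B\<^sup>2" for n
      using B[of n] unfolding fock_norm_eq[OF s] by (rule sqrt_le_D)
    obtain f \<sigma> where f: "f \<in> holL2 P" and \<sigma>: "strict_mono (\<sigma> :: nat \<Rightarrow> nat)"
      and unif: "\<And>R. uniform_limit (cball 0 R) (\<lambda>n. s (\<sigma> n)) f sequentially"
      by (rule bounded_sequence_limit[of s "B\<^sup>2", OF s nB]) blast
    have dL: "(\<lambda>z. s (\<sigma> n) z - f z) \<in> holL2 P" for n by (rule diff_holL2[OF s f])
    have TD: "(\<lambda>z. ?T (s (\<sigma> n)) z - ?T f z) = ?T (\<lambda>z. s (\<sigma> n) z - f z)" for n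
      using lin[OF s f, of 1 "\<sigma> n" "-1"] by simp
    have "(\<lambda>n. nrm2 P (?T (\<lambda>z. s (\<sigma> n) z - f z))) \<longlonglongrightarrow> 0"
    proof (rule LIMSEQ_I)
      fix \<epsilon> :: real assume \<epsilon>: "0 < \<epsilon>"
      \<comment> \<open>Gives \<open>C * (\<eta> * m) < \<epsilon>\<close>; the added 1 keeps the
        denominator positive.\<close>
      define \<eta> where "\<eta> = \<epsilon> / (2 * (C * m + 1))"
      have "0 \<le> C * m" using C m(2) by simp
      then have \<eta>: "0 < \<eta>" using \<epsilon> by (simp add: \<eta>_def)
      have small: "C * (\<eta> * m) < \<epsilon>"
      proof -
        have "C * (\<eta> * m) \<le> (C * m + 1) * \<eta>" using \<eta> by (simp add: algebra_simps)
        also have "\<dots> = \<epsilon> / 2"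
        proof -
          have *: "d * (e / (2 * d)) = e / 2" if "0 < d" for d e :: real using that by simp
          show ?thesis unfolding \<eta>_def by (rule *) (use \<open>0 \<le> C * m\<close> in linarith)
        qed
        finally show ?thesis using \<epsilon> by simp
      qed
      have "\<forall>\<^sub>F n in sequentially. \<forall>u\<in>cball 0 R. dist (s (\<sigma> n) u) (f u) < sqrt \<eta>"
        using unif[of R] \<eta> unfolding uniform_limit_iff by simp
      then obtain n0 where "\<forall>n\<ge>n0. \<forall>u\<in>cball 0 R. dist (s (\<sigma> n) u) (f u) < sqrt \<eta>"
        unfolding eventually_sequentially by (elim exE)
      then have n0: "dist (s (\<sigma> n) u) (f u) < sqrt \<eta>" if "n0 \<le> n" "u \<in> cball 0 R" for n u
        using that by simp
      have "norm (nrm2 P (?T (\<lambda>z. s (\<sigma> n) z - f z)) - 0) < \<epsilon>" if "n0 \<le> n" for n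
      proof -
        have sm: "(cmod (s (\<sigma> n) u - f u))\<^sup>2 \<le> \<eta>" if "u \<in> cball 0 R" for u
        proof -
          have "(cmod (s (\<sigma> n) u - f u))\<^sup>2 \<le> (sqrt \<eta>)\<^sup>2"
            using n0[OF \<open>n0 \<le> n\<close> that] by (intro power_mono) (auto simp: dist_norm)
          then show ?thesis using \<eta> by simp
        qed
        have "(\<integral>\<^sup>+u. ennreal ((cmod (s (\<sigma> n) u - f u))\<^sup>2 * gauss u) \<partial>?\<nu>) \<le> ennreal \<eta> * emeasure \<mu> (cball 0 R)"
          by (rule nn_integral_restrict_cball_le[OF \<mu> hol[OF dL] sm]) (use \<eta> in simp_all)
        then have "(\<integral>\<^sup>+u. ennreal ((cmod (s (\<sigma> n) u - f u))\<^sup>2 * gauss u) \<partial>?\<nu>) \<le> ennreal (\<eta> * m)"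
          using \<eta> m by (simp add: ennreal_mult)
        then have "ennreal C * (\<integral>\<^sup>+u. ennreal ((cmod (s (\<sigma> n) u - f u))\<^sup>2 * gauss u) \<partial>?\<nu>) \<le> ennreal C * ennreal (\<eta> * m)"
          by (rule mult_left_mono) simp
        with ct3[OF dL, of n] have "ennreal (nrm2 P (?T (\<lambda>z. s (\<sigma> n) z - f z))) \<le> ennreal C * ennreal (\<eta> * m)"
          by (rule order_trans)
        also have "\<dots> = ennreal (C * (\<eta> * m))" using C \<eta> m(2) by (simp add: ennreal_mult)
        finally have "nrm2 P (?T (\<lambda>z. s (\<sigma> n) z - f z)) \<le> C * (\<eta> * m)"
          using C \<eta> m(2) by (subst (asm) ennreal_le_iff) simp_all
        then show ?thesis using small nrm2_nonneg[of P "?T (\<lambda>z. s (\<sigma> n) z - f z)"] by simp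
      qed
      then show "\<exists>no. \<forall>n\<ge>no. norm (nrm2 P (?T (\<lambda>z. s (\<sigma> n) z - f z)) - 0) < \<epsilon>" by (intro exI[of _ n0] allI impI)
    qed
    then have "(\<lambda>n. sqrt (nrm2 P (?T (\<lambda>z. s (\<sigma> n) z - f z)))) \<longlonglongrightarrow> sqrt 0" by (rule tendsto_real_sqrt)
    then have "(\<lambda>n. fock_norm \<alpha> w (\<lambda>z. ?T (s (\<sigma> n)) z - ?T f z)) \<longlonglongrightarrow> 0"
      unfolding TD by (simp add: fock_norm_eq[OF ct2[OF dL]])
    with \<sigma> ct2[OF f] show ?thesis by (intro exI[of _ \<sigma>] conjI bexI[of _ "?T f"])
  qed
  then show ?thesis
    unfolding fock_compact_def fock_operator_def fock_space_eq using lin ct2 by simp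
qed

section \<open>Comparison with the averages\<close>

lemma average_function_eq: "average_function w \<mu> r z = emeasure \<mu> (ball z r) / emeasure M (ball z r)"
  unfolding average_function_def by (simp add: emeasure_weight_measure[OF w])

text \<open>For \<open>S\<close> above the upper limit of the averages, the part of
  \<open>\<mu>\<close> outside a large disk satisfies the Carleson condition with \<open>S\<close>
  at every centre, so removing the compact inner part leaves norm at most \<open>C * S\<close>. Then
  \<open>S\<close> decreases to the upper limit.\<close>

lemma essnorm_le_average:
  assumes r: "0 < r" "r \<le> \<rho>"
  shows "\<exists>C>0. \<forall>\<mu>. sets \<mu> = sets borel \<longrightarrow> toeplitz_bounded \<alpha> w \<mu> \<longrightarrow>
    fock_essnorm \<alpha> w (toeplitz \<alpha> w \<mu>) \<le> ennreal C * Limsup at_infinity (average_function w \<mu> r)"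
proof -
  obtain C where C: "0 < C" and carl: "\<And>\<nu> S f. sets \<nu> = sets borel \<Longrightarrow> (\<And>R. emeasure \<nu> (ball 0 R) < \<infinity>) \<Longrightarrow> 0 \<le> S \<Longrightarrow>
    (\<And>u. emeasure \<nu> (ball u r) \<le> ennreal (S * v u)) \<Longrightarrow> f \<in> holL2 P \<Longrightarrow>
    (\<integral>\<^sup>+\<xi>. ennreal ((cmod (f \<xi>))\<^sup>2 * gauss \<xi>) \<partial>\<nu>) \<le> ennreal (C * S * nrm2 P f)"
    using carleson_embedding[OF r] by (elim exE conjE) simp
  have main: "fock_essnorm \<alpha> w (toeplitz \<alpha> w \<mu>) \<le> ennreal (C * S)"
    if \<mu>: "sets \<mu> = sets borel" and T: "toeplitz_bounded \<alpha> w \<mu>" and S: "0 \<le> S"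
      and L: "Limsup at_infinity (average_function w \<mu> r) < ennreal S" for \<mu> S
  proof -
    have "\<forall>\<^sub>F z in at_infinity. average_function w \<mu> r z < ennreal S"
      by (rule Limsup_lessD[OF L])
    then obtain R0 where R0: "\<And>z. R0 \<le> cmod z \<Longrightarrow> average_function w \<mu> r z < ennreal S"
      unfolding eventually_at_infinity by auto
    \<comment> \<open>The margin \<open>r\<close> makes disks centred inside
      \<open>cball 0 R0\<close> miss the outer part altogether.\<close>
    define R where "R = R0 + r"
    let ?E = "cball 0 R :: complex set"
    let ?\<nu> = "restrict_to (- ?E) \<mu>"
    have fin: "emeasure \<mu> (cball 0 R) < \<infinity>" for R
      by (rule toeplitz_bounded_finite_on_balls[OF \<mu> T])
    have E: "?E \<in> sets borel" "- ?E \<in> sets \<mu>" by (simp_all add: \<mu>)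
    have \<nu>: "sets ?\<nu> = sets borel" by (simp add: sets_restrict_to \<mu>)
    have \<nu>le: "emeasure ?\<nu> F \<le> emeasure \<mu> F" if "F \<in> sets borel" for F
      using E that by (subst emeasure_restrict_to) (auto simp: \<mu> intro!: emeasure_mono)
    have "emeasure ?\<nu> (ball 0 t) < \<infinity>" for t
    proof -
      have "emeasure ?\<nu> (ball 0 t) \<le> emeasure \<mu> (ball 0 t)" by (rule \<nu>le) simp
      also have "\<dots> \<le> emeasure \<mu> (cball 0 t)" by (intro emeasure_mono ball_subset_cball) (simp add: \<mu>)
      also note fin
      finally show ?thesis .
    qed
    moreover have "emeasure ?\<nu> (ball u r) \<le> ennreal (S * v u)" for u
    proof (cases "R0 \<le> cmod u")
      case True
      obtain m where m: "emeasure M (ball u r) = ennreal m" "0 \<le> m"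
        using emeasure_ball_finite[of u r]
        by (cases "emeasure M (ball u r)" rule: ennreal_cases) auto
      \<comment> \<open>Positivity of the weight of \<open>ball u r\<close> is what allows the
        division in the average to be undone.\<close>
      have "0 < \<kappa> * r ^ (2 * N) * v u" using \<kappa> r v_pos[of u] by simp
      moreover have "ennreal (\<kappa> * r ^ (2 * N) * v u) \<le> ennreal m"
        using doubling_real[of u u r] r \<rho> unfolding m(1) by simp
      ultimately have m0: "0 < m" using m(2) by (simp add: ennreal_le_iff)
      have "ennreal m \<le> ennreal (v u)"
        unfolding m(1)[symmetric] emeasure_ball_v[symmetric] using r
        by (intro emeasure_mono subset_ball) (simp_all add: sets_weight_measure)
      then have mv: "m \<le> v u" using v_pos[of u] by (simp add: ennreal_le_iff)
      have "emeasure \<mu> (ball u r) / ennreal m < ennreal S"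
        using R0[OF True] unfolding average_function_eq m(1) .
      then have "emeasure \<mu> (ball u r) / ennreal m * ennreal m \<le> ennreal S * ennreal m"
        by (intro mult_right_mono) simp_all
      then have "emeasure \<mu> (ball u r) \<le> ennreal (S * m)"
        using m0 S by (simp add: ennreal_mult[symmetric] ennreal_divide_times)
      also have "\<dots> \<le> ennreal (S * v u)" using mv S by (intro ennreal_leI mult_left_mono)
      finally show ?thesis using \<nu>le[of "ball u r"] by simp
    next
      case False
      have "- ?E \<inter> ball u r = {}"
      proof (rule ccontr)
        assume "- ?E \<inter> ball u r \<noteq> {}"
        then obtain x where "R < cmod x" "dist u x < r" by (auto simp: not_le)
        then show False using False norm_triangle_ineq2[of x u] by (simp add: R_def dist_norm norm_minus_commute)
      qed
      then show ?thesis using E by (subst emeasure_restrict_to) (simp_all add: \<mu>)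
    qed
    ultimately have c2: "(\<integral>\<^sup>+\<xi>. ennreal ((cmod (f \<xi>))\<^sup>2 * gauss \<xi>) \<partial>?\<nu>) \<le> ennreal (C * S * nrm2 P f)"
      if "f \<in> holL2 P" for f
      by (rule carl[OF \<nu> _ S _ that])
    have CS: "0 \<le> C * S" using C S by simp
    let ?K = "toeplitz \<alpha> w (restrict_to ?E \<mu>)"
    have comp: "fock_compact \<alpha> w ?K" by (rule toeplitz_restrict_cball[OF \<mu> fin])
    have "fock_opnorm \<alpha> w (\<lambda>f z. toeplitz \<alpha> w \<mu> f z - ?K f z) \<le> ennreal (C * S)"
      unfolding fock_opnorm_def
    proof (rule SUP_least)
      fix f assume "f \<in> {f \<in> fock_space \<alpha> w. fock_norm \<alpha> w f \<le> 1}"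
      then have f: "f \<in> holL2 P" and f1: "fock_norm \<alpha> w f \<le> 1" by (simp_all add: fock_space_eq)
      have fh: "f holomorphic_on UNIV" using f by (simp add: holL2_def)
      have int: "integrable \<mu> (toeplitz_integrand \<alpha> w f z)" for z
        using T f unfolding toeplitz_bounded_def fock_space_eq by simp
      have eq: "(\<lambda>z. toeplitz \<alpha> w \<mu> f z - ?K f z) = toeplitz \<alpha> w ?\<nu> f"
        using toeplitz_split[OF \<mu> E(1) fh int] by (intro ext) simp
      have "nrm2 P f \<le> 1" using f1 by (simp add: fock_norm_eq[OF f])
      then have "(C * S)\<^sup>2 * nrm2 P f \<le> (C * S)\<^sup>2" by (simp add: mult_left_le)
      with carleson_toeplitz(4)[OF \<nu> CS c2 f] have "nrm2 P (toeplitz \<alpha> w ?\<nu> f) \<le> (C * S)\<^sup>2" by linarith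
      then have "sqrt (nrm2 P (toeplitz \<alpha> w ?\<nu> f)) \<le> C * S" using CS by (simp add: real_le_lsqrt)
      then have "fock_norm \<alpha> w (toeplitz \<alpha> w ?\<nu> f) \<le> C * S"
        by (subst fock_norm_eq) (rule carleson_toeplitz(2)[OF \<nu> CS c2 f])
      then show "ennreal (fock_norm \<alpha> w (\<lambda>z. toeplitz \<alpha> w \<mu> f z - ?K f z)) \<le> ennreal (C * S)"
        unfolding eq by (rule ennreal_leI)
    qed
    moreover have "fock_essnorm \<alpha> w (toeplitz \<alpha> w \<mu>) \<le> fock_opnorm \<alpha> w (\<lambda>f z. toeplitz \<alpha> w \<mu> f z - ?K f z)"
      unfolding fock_essnorm_def using comp by (intro INF_lower) simp
    ultimately show ?thesis by (rule order_trans[rotated])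
  qed
  have "fock_essnorm \<alpha> w (toeplitz \<alpha> w \<mu>) \<le> ennreal C * Limsup at_infinity (average_function w \<mu> r)"
    if \<mu>: "sets \<mu> = sets borel" and T: "toeplitz_bounded \<alpha> w \<mu>" for \<mu>
  proof (cases "Limsup at_infinity (average_function w \<mu> r)" rule: ennreal_cases)
    case top
    then show ?thesis using C by (simp add: ennreal_mult_top)
  next
    case (real l)
    \<comment> \<open>The bound \<open>main\<close> wants \<open>S\<close> strictly above the upper
      limit, so it is applied at \<open>l + e / C\<close>, which costs exactly
      \<open>e\<close>.\<close>
    show ?thesis
    proof (rule ennreal_le_epsilon)
      fix e :: real assume e: "0 < e"
      have "Limsup at_infinity (average_function w \<mu> r) < ennreal (l + e / C)"
        using e C real by (simp add: ennreal_less_iff)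
      then have "fock_essnorm \<alpha> w (toeplitz \<alpha> w \<mu>) \<le> ennreal (C * (l + e / C))"
        using e C real by (intro main[OF \<mu> T]) simp_all
      also have "C * (l + e / C) = C * l + e" using C by (simp add: algebra_simps)
      also have "ennreal (C * l + e) = ennreal C * Limsup at_infinity (average_function w \<mu> r) + ennreal e"
        using e C real by (simp add: ennreal_mult)
      finally show "fock_essnorm \<alpha> w (toeplitz \<alpha> w \<mu>)
          \<le> ennreal C * Limsup at_infinity (average_function w \<mu> r) + ennreal e" .
    qed
  qed
  with C show ?thesis by blast
qed

text \<open>\<open>berezin_lower_bound\<close> compares with the weight at size
  \<open>\<rho>\<close>, the average divides by the weight at size \<open>r\<close>; doubling
  bridges the two, so the constant carries a factor \<open>r ^ (2 * N)\<close>.\<close>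

lemma average_le_berezin:
  "\<exists>\<delta>>0. \<forall>r. 0 < r \<longrightarrow> r \<le> \<delta> \<longrightarrow> (\<exists>c>0. \<forall>\<mu> z. sets \<mu> = sets borel \<longrightarrow> toeplitz_bounded \<alpha> w \<mu> \<longrightarrow>
    ennreal c * average_function w \<mu> r z \<le> berezin \<alpha> w \<mu> z)"
proof -
  obtain \<delta> c where \<delta>: "0 < \<delta>" and c: "0 < c"
    and low: "\<And>\<mu> z r. sets \<mu> = sets borel \<Longrightarrow> toeplitz_bounded \<alpha> w \<mu> \<Longrightarrow> r \<le> \<delta> \<Longrightarrow>
      ennreal (c / v z) * emeasure \<mu> (ball z r) \<le> berezin \<alpha> w \<mu> z"
    using berezin_lower_bound by metis
  have "ennreal (c * \<kappa> * r ^ (2 * N)) * average_function w \<mu> r z \<le> berezin \<alpha> w \<mu> z"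
    if r: "0 < r" "r \<le> min \<delta> \<rho>" and \<mu>: "sets \<mu> = sets borel" and T: "toeplitz_bounded \<alpha> w \<mu>" for r \<mu> z
  proof -
    let ?d = "\<kappa> * r ^ (2 * N) * v z"
    have d: "0 < ?d" using \<kappa> r v_pos[of z] by simp
    have "ennreal ?d \<le> emeasure M (ball z r)" using doubling_real[of z z r] r \<rho> by simp
    then have "average_function w \<mu> r z \<le> emeasure \<mu> (ball z r) / ennreal ?d"
      unfolding average_function_eq using d by (rule divide_le_divide_ennreal)
    then have "ennreal (c * \<kappa> * r ^ (2 * N)) * average_function w \<mu> r z
        \<le> ennreal (c * \<kappa> * r ^ (2 * N)) * (emeasure \<mu> (ball z r) / ennreal ?d)"
      by (rule mult_left_mono) simp
    also have "\<dots> = (ennreal (c * \<kappa> * r ^ (2 * N)) / ennreal ?d) * emeasure \<mu> (ball z r)"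
      by (simp add: ennreal_times_divide mult.commute)
    also have "ennreal (c * \<kappa> * r ^ (2 * N)) / ennreal ?d = ennreal (c / v z)"
      using c \<kappa> r d v_pos[of z] by (simp add: divide_ennreal)
    also have "ennreal (c / v z) * emeasure \<mu> (ball z r) \<le> berezin \<alpha> w \<mu> z"
      using r by (intro low[OF \<mu> T]) simp
    finally show ?thesis .
  qed
  moreover have "0 < c * \<kappa> * r ^ (2 * N)" if "0 < r" for r using c \<kappa> that by simp
  moreover have "0 < min \<delta> \<rho>" using \<delta> \<rho> by simp
  ultimately show ?thesis by metis
qed

end

theorem theorem1p2:
  fixes \<alpha> :: real and w :: "complex \<Rightarrow> real"
  assumes "\<alpha> > 0" and "Ainf_restricted w"
  shows "\<exists>\<delta>. 0 < \<delta> \<and> \<delta> < 1 \<and>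
    (\<forall>r. 0 < r \<and> r < \<delta> \<longrightarrow>
      (\<exists>c C :: real. 0 < c \<and> 0 < C \<and>
        (\<forall>\<mu> :: complex measure. sets \<mu> = sets borel \<and> toeplitz_bounded \<alpha> w \<mu> \<longrightarrow>
          ennreal c * Limsup at_infinity (berezin \<alpha> w \<mu>) \<le> fock_essnorm \<alpha> w (toeplitz \<alpha> w \<mu>) \<and>
          fock_essnorm \<alpha> w (toeplitz \<alpha> w \<mu>) \<le> ennreal C * Limsup at_infinity (berezin \<alpha> w \<mu>) \<and>
          ennreal c * Limsup at_infinity (average_function w \<mu> r)
            \<le> Limsup at_infinity (berezin \<alpha> w \<mu>) \<and>
          Limsup at_infinity (berezin \<alpha> w \<mu>)
            \<le> ennreal C * Limsup at_infinity (average_function w \<mu> r))))"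
proof -
  have "\<exists>p\<ge>1. weight w \<and> muckenhoupt_comparison p w"
    using assms(2) unfolding Ainf_restricted_def
  proof
    assume "A1_restricted w"
    then show ?thesis using A1_muckenhoupt_comparison by (intro exI[of _ 1]) (simp add: A1_restricted_def)
  next
    assume "\<exists>p>1. Ap_restricted p w"
    then obtain p where "1 < p" "Ap_restricted p w" by (elim exE conjE)
    then show ?thesis using Ap_muckenhoupt_comparison by (intro exI[of _ p]) (simp add: Ap_restricted_def)
  qed
  then obtain p where w: "weight w" and "1 \<le> p" "muckenhoupt_comparison p w" by (elim exE conjE)
  then obtain \<rho> \<kappa> N where "doubling_fock \<alpha> \<rho> \<kappa> N (weight_measure w)"
    using muckenhoupt_doubling \<open>\<alpha> > 0\<close> by metis
  then interpret weighted_fock \<alpha> \<rho> \<kappa> N w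
    using w by (simp add: weighted_fock_def weighted_fock_axioms_def)
  obtain \<delta>0 where \<delta>0: "0 < \<delta>0"
    and avg: "\<forall>r. 0 < r \<longrightarrow> r \<le> \<delta>0 \<longrightarrow> (\<exists>c>0. \<forall>\<mu> z. sets \<mu> = sets borel \<longrightarrow> toeplitz_bounded \<alpha> w \<mu> \<longrightarrow>
      ennreal c * average_function w \<mu> r z \<le> berezin \<alpha> w \<mu> z)"
    using average_le_berezin by (elim exE conjE)
  \<comment> \<open>\<open>\<delta>0\<close> is the range of the lower Berezin bound,
    \<open>\<rho>\<close> that of the Carleson embedding, and \<open>1 / 2\<close> secures
    \<open>\<delta> < 1\<close>.\<close>
  define \<delta> where "\<delta> = min \<delta>0 (min \<rho> (1/2))"
  have "0 < \<delta>" "\<delta> < 1" using \<delta>0 \<rho> by (simp_all add: \<delta>_def)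
  moreover have "\<exists>c C :: real. 0 < c \<and> 0 < C \<and>
        (\<forall>\<mu> :: complex measure. sets \<mu> = sets borel \<and> toeplitz_bounded \<alpha> w \<mu> \<longrightarrow>
          ennreal c * Limsup at_infinity (berezin \<alpha> w \<mu>) \<le> fock_essnorm \<alpha> w (toeplitz \<alpha> w \<mu>) \<and>
          fock_essnorm \<alpha> w (toeplitz \<alpha> w \<mu>) \<le> ennreal C * Limsup at_infinity (berezin \<alpha> w \<mu>) \<and>
          ennreal c * Limsup at_infinity (average_function w \<mu> r)
            \<le> Limsup at_infinity (berezin \<alpha> w \<mu>) \<and>
          Limsup at_infinity (berezin \<alpha> w \<mu>)
            \<le> ennreal C * Limsup at_infinity (average_function w \<mu> r))"
    if r: "0 < r" "r < \<delta>" for r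
  proof -
    have r': "r \<le> \<delta>0" "r \<le> \<rho>" using r by (simp_all add: \<delta>_def)
    obtain c0 where c0: "0 < c0" and low: "\<And>\<mu> z. sets \<mu> = sets borel \<Longrightarrow> toeplitz_bounded \<alpha> w \<mu> \<Longrightarrow>
        ennreal c0 * average_function w \<mu> r z \<le> berezin \<alpha> w \<mu> z"
      using avg r(1) r'(1) by metis
    obtain C0 where C0: "0 < C0" and up: "\<And>\<mu>. sets \<mu> = sets borel \<Longrightarrow> toeplitz_bounded \<alpha> w \<mu> \<Longrightarrow>
        fock_essnorm \<alpha> w (toeplitz \<alpha> w \<mu>) \<le> ennreal C0 * Limsup at_infinity (average_function w \<mu> r)"
      using essnorm_le_average[OF r(1) r'(2)] by metis
    \<comment> \<open>One \<open>c\<close> has to serve two lower bounds, whose natural constants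
      are 1 for the essential norm and \<open>c0\<close> for the averages. Passing from averages to
      the Berezin transform in the upper bound divides \<open>C0\<close> by \<open>c\<close>, and
      \<open>c \<le> 1\<close> makes the quotient dominate \<open>C0\<close> as well.\<close>
    define c where "c = min c0 1"
    define C where "C = C0 / c"
    have c: "0 < c" "c \<le> c0" "c \<le> 1" using c0 by (simp_all add: c_def)
    have C: "0 < C" "C0 \<le> C" using c C0 by (simp_all add: C_def field_simps)
    have "ennreal c * Limsup at_infinity (berezin \<alpha> w \<mu>) \<le> fock_essnorm \<alpha> w (toeplitz \<alpha> w \<mu>) \<and>
          fock_essnorm \<alpha> w (toeplitz \<alpha> w \<mu>) \<le> ennreal C * Limsup at_infinity (berezin \<alpha> w \<mu>) \<and>
          ennreal c * Limsup at_infinity (average_function w \<mu> r)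
            \<le> Limsup at_infinity (berezin \<alpha> w \<mu>) \<and>
          Limsup at_infinity (berezin \<alpha> w \<mu>)
            \<le> ennreal C * Limsup at_infinity (average_function w \<mu> r)"
      if \<mu>: "sets \<mu> = sets borel" "toeplitz_bounded \<alpha> w \<mu>" for \<mu>
    proof -
      let ?B = "Limsup at_infinity (berezin \<alpha> w \<mu>)" and ?A = "Limsup at_infinity (average_function w \<mu> r)"
      let ?E = "fock_essnorm \<alpha> w (toeplitz \<alpha> w \<mu>)"
      have BE: "?B \<le> ?E"
        unfolding fock_essnorm_def
        by (rule INF_greatest) (simp add: berezin_le_opnorm_compact_perturbation[OF \<mu>])
      have EA: "?E \<le> ennreal C0 * ?A" by (rule up[OF \<mu>])
      have "ennreal c0 * ?A \<le> ?B" by (rule Limsup_ennreal_mult_le[OF c0 low[OF \<mu>]])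
      moreover have "ennreal c * ?A \<le> ennreal c0 * ?A" using c(2) by (intro mult_right_mono ennreal_leI) simp_all
      ultimately have AB: "ennreal c * ?A \<le> ?B" by simp
      have "ennreal c * ?B \<le> ennreal 1 * ?E" using BE c(3) by (intro mult_mono ennreal_leI) simp_all
      moreover have "ennreal C0 * ?A = ennreal C * (ennreal c * ?A)"
        using c C by (simp add: C_def mult.assoc[symmetric] ennreal_mult[symmetric])
      then have "?E \<le> ennreal C * ?B"
        using EA mult_left_mono[OF AB, of "ennreal C"] by simp
      moreover have "ennreal C0 * ?A \<le> ennreal C * ?A" using C(2) by (intro mult_right_mono ennreal_leI) simp_all
      then have "?B \<le> ennreal C * ?A" using BE EA by (blast intro: order_trans)
      ultimately show ?thesis using AB by simp
    qed
    with c(1) C(1) show ?thesis by (intro exI[of _ c] exI[of _ C]) simp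
  qed
  ultimately show ?thesis by (intro exI[of _ \<delta>]) simp
qed

end
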